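(* There is an absolute constant $C$ such that the following holds. Let $A\in\mathbb{R}^{m\times n}$ have singular values $\sigma_1\ge\sigma_2\ge\dots$, and let $\bar A=QA$, where $Q$ is an $m\times m$ randomized Hadamard transform. Let $\delta\in(0,1)$ and $C\log(m/\delta)\le k<\mathrm{rank}(A)$, and let $\bar\lambda=\frac1k\sum_{i>k}\sigma_i^2$. Let $S\sim\mathcal{U}(m,s)$ be a uniformly random subset of $[m]$ of size $s\ge Ck\log(m\bar\kappa_k)$. Then for any $0\le\lambda\le\frac{k}{m}\bar\lambda$, with probability $1-\delta$ (over $Q$) the transformed matrix $\bar A$ satisfies $$\mathbb{E}_{S\sim\mathcal{U}(m,s)}\Big[\bar A_S^\top\big(\bar A_S\bar A_S^\top+\lambda I\big)^\dagger\bar A_S\Big]\succeq\frac12A^\top(AA^\top+\bar\lambda I)^{-1}A.$$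
   Context: Randomized Hadamard transform (RHT): $Q=HD$, where $H$ is the $m\times m$ Hadamard matrix ($m$ a power of $2$, $H_1=1$, $H_{2\ell}=\begin{bmatrix}H_\ell&H_\ell\\H_\ell&-H_\ell\end{bmatrix}$) and $D$ is an $m\times m$ diagonal matrix with independent uniformly random $\pm1/\sqrt m$ diagonal entries (so $Q^\top Q=I$). $\bar\kappa_k:=\bar\kappa(A-A_k)$, where $A_k=\sum_{i=1}^k\sigma_iu_iv_i^\top$ is the top-$k$ part of the SVD of $A$ and $\bar\kappa(M):=\|M\|_F\|M^\dagger\|/\sqrt{\mathrm{rank}(M)}$. $\bar A_S$ is the submatrix of rows of $\bar A$ indexed by $S$; $\dagger$ is the Moore-Penrose pseudoinverse; $\succeq$ is the positive semidefinite (Loewner) order. The constant $C$ is assumed to be at least $64$. *)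

theory Defs
  imports
    "HOL-Probability.Product_PMF"
    "Jordan_Normal_Form.DL_Rank"
    "Jordan_Normal_Form.DL_Submatrix"
    "Jordan_Normal_Form.Gauss_Jordan_Elimination"
begin

text \<open>
  Matrices are \<open>real mat\<close> with explicit dimensions, so that the absolute constant can be
  quantified outside the dimensions. All indices start at 0: the paper's \<open>\<sigma>\<^sub>1, \<sigma>\<^sub>2, \<dots>\<close> are
  \<open>\<sigma> 0, \<sigma> 1, \<dots>\<close>, and \<open>[m]\<close> is \<open>{..<m}\<close>.
\<close>

abbreviation mat_rank :: "real mat \<Rightarrow> nat" where
  "mat_rank A \<equiv> vec_space.rank (dim_row A) A"

subsection \<open>Singular value decomposition\<close>

text \<open>
  Full SVD \<open>A = U \<Sigma> V\<^sup>T\<close> with square orthogonal \<open>U\<close>, \<open>V\<close>; the left and right singular vectors are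
  the columns of \<open>U\<close> and \<open>V\<close>. Values \<open>\<sigma> i\<close> with \<open>i \<ge> min m n\<close> are irrelevant.
\<close>

definition is_svd :: "real mat \<Rightarrow> real mat \<Rightarrow> (nat \<Rightarrow> real) \<Rightarrow> real mat \<Rightarrow> bool" where
  "is_svd A U \<sigma> V \<longleftrightarrow>
     (let m = dim_row A; n = dim_col A in
        U \<in> carrier_mat m m \<and> transpose_mat U * U = 1\<^sub>m m \<and>
        V \<in> carrier_mat n n \<and> transpose_mat V * V = 1\<^sub>m n \<and>
        (\<forall>i < min m n. 0 \<le> \<sigma> i) \<and>
        (\<forall>i j. i \<le> j \<and> j < min m n \<longrightarrow> \<sigma> j \<le> \<sigma> i) \<and>
        A = U * mat m n (\<lambda>(i, j). if i = j then \<sigma> i else 0) * transpose_mat V)"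

text \<open>\<open>A\<^sub>k = (\<Sum>i<k. \<sigma>\<^sub>i u\<^sub>i v\<^sub>i\<^sup>T)\<close>, written entrywise.\<close>

definition svd_top :: "nat \<Rightarrow> real mat \<Rightarrow> (nat \<Rightarrow> real) \<Rightarrow> real mat \<Rightarrow> real mat" where
  "svd_top k U \<sigma> V = mat (dim_row U) (dim_row V) (\<lambda>(a, b). \<Sum>i<k. \<sigma> i * U $$ (a, i) * V $$ (b, i))"

subsection \<open>Pseudoinverse, norms and averaged condition number\<close>

definition is_pinv :: "real mat \<Rightarrow> real mat \<Rightarrow> bool" where
  "is_pinv A X \<longleftrightarrow>
     X \<in> carrier_mat (dim_col A) (dim_row A) \<and>
     A * X * A = A \<and> X * A * X = X \<and>
     transpose_mat (A * X) = A * X \<and> transpose_mat (X * A) = X * A"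

definition pinv :: "real mat \<Rightarrow> real mat" where
  "pinv A = (THE X. is_pinv A X)"

definition frob_norm :: "real mat \<Rightarrow> real" where
  "frob_norm A = sqrt (\<Sum>i<dim_row A. \<Sum>j<dim_col A. (A $$ (i, j))\<^sup>2)"

definition eucl_norm :: "real vec \<Rightarrow> real" where
  "eucl_norm v = sqrt (v \<bullet> v)"

definition spec_norm :: "real mat \<Rightarrow> real" where
  "spec_norm A = (SUP v \<in> {v \<in> carrier_vec (dim_col A). eucl_norm v \<le> 1}. eucl_norm (A *\<^sub>v v))"

definition kappa_bar :: "real mat \<Rightarrow> real" where
  "kappa_bar M = frob_norm M * spec_norm (pinv M) / sqrt (real (mat_rank M))"

subsection \<open>Loewner order\<close>

definition psd :: "real mat \<Rightarrow> bool" where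
  "psd M \<longleftrightarrow> M \<in> carrier_mat (dim_row M) (dim_row M) \<and> transpose_mat M = M \<and>
     (\<forall>v \<in> carrier_vec (dim_row M). 0 \<le> v \<bullet> (M *\<^sub>v v))"

definition loewner_le :: "real mat \<Rightarrow> real mat \<Rightarrow> bool" where
  "loewner_le A B \<longleftrightarrow> dim_row A = dim_row B \<and> dim_col A = dim_col B \<and> psd (B - A)"

subsection \<open>Randomized Hadamard transform and random row sampling\<close>

text \<open>\<open>hadamard p\<close> is the Hadamard matrix of order \<open>2 ^ p\<close>.\<close>

fun hadamard :: "nat \<Rightarrow> real mat" where
  "hadamard 0 = 1\<^sub>m 1"
| "hadamard (Suc p) =
     four_block_mat (hadamard p) (hadamard p) (hadamard p) (- hadamard p)"

text \<open>
  The distribution of \<open>Q = H D\<close> for \<open>m = 2 ^ p\<close>. The entries of \<open>d\<close> outside \<open>{..<m}\<close> (set to 0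
  by \<open>Pi_pmf\<close>) do not enter \<open>mat_diag m d\<close>.
\<close>

definition rht :: "nat \<Rightarrow> real mat pmf" where
  "rht p = (let m = 2 ^ p in
     map_pmf (\<lambda>d. hadamard p * mat_diag m d)
       (Pi_pmf {..<m} 0 (\<lambda>_. pmf_of_set {1 / sqrt (real m), - 1 / sqrt (real m)})))"

text \<open>\<open>\<U>(m, s)\<close>; meaningful only for \<open>s \<le> m\<close>.\<close>

definition unif_subset :: "nat \<Rightarrow> nat \<Rightarrow> nat set pmf" where
  "unif_subset m s = pmf_of_set {S. S \<subseteq> {..<m} \<and> card S = s}"

abbreviation rows_of :: "real mat \<Rightarrow> nat set \<Rightarrow> real mat" where
  "rows_of A S \<equiv> submatrix A S UNIV"

text \<open>Entrywise expectation of a random \<open>a \<times> b\<close> matrix.\<close>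

definition mat_expectation :: "nat \<Rightarrow> nat \<Rightarrow> 'a pmf \<Rightarrow> ('a \<Rightarrow> real mat) \<Rightarrow> real mat" where
  "mat_expectation a b P F =
     mat a b (\<lambda>(i, j). measure_pmf.expectation P (\<lambda>x. F x $$ (i, j)))"

text \<open>\<open>M\<^sup>T (M M\<^sup>T + l I)\<^sup>\<dagger> M\<close>\<close>

definition reg_proj :: "real \<Rightarrow> real mat \<Rightarrow> real mat" where
  "reg_proj l M =
     transpose_mat M * pinv (M * transpose_mat M + l \<cdot>\<^sub>m 1\<^sub>m (dim_row M)) * M"

text \<open>
  \<open>A\<^sup>T (A A\<^sup>T + l I)\<^sup>-\<^sup>1 A\<close>; for \<open>l > 0\<close> the inner matrix is positive definite, so \<open>mat_inverse\<close>
  does return its inverse.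
\<close>

definition ridge_proj :: "real \<Rightarrow> real mat \<Rightarrow> real mat" where
  "ridge_proj l A =
     transpose_mat A * the (mat_inverse (A * transpose_mat A + l \<cdot>\<^sub>m 1\<^sub>m (dim_row A))) * A"

end

theory Submission
  imports
    Defs
    "HOL-Probability.Hoeffding"
    "HOL-Probability.Distributions"
begin

text \<open>
  Write \<open>a\<^sub>j\<close> for the rows of \<open>Q A\<close> in the basis of right singular vectors and \<open>M\<close> for the diagonal
  matrix with entries \<open>\<sigma>\<^sub>i\<^sup>2 / (\<sigma>\<^sub>i\<^sup>2 + lbar)\<close>, whose trace is at most \<open>2 k\<close>. A Gaussian linearization
  of the Rademacher chaos shows that with probability \<open>1 - \<delta>\<close> all
  ridge leverage scores of the rows are at most \<open>8 k / m\<close>; only this property of \<open>Q\<close> is used.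

  Uniform subsets are replaced by independent draws, of which the two halves play different roles.
  For the first half, a randomized Kaczmarz iteration in whitened coordinates contracts every basis
  vector; telescoping its energy turns this contraction into the statement that, with probability
  at least \<open>1/2\<close>, the sampled Gram matrix plus a multiple of the identity dominates all \<open>2 a\<^sub>j a\<^sub>j\<^sup>T\<close>.
  For the second half, the regularized projection is bounded from below by its variational
  characterization: use weights \<open>a\<^sub>j\<^sup>T h\<close> with a deterministic \<open>h\<close>, and let the first half correct the
  residual optimally. A second moment computation then yields the bound \<open>M\<close> on average.
\<close>

section \<open>Averages over random subsets and over random lists\<close>

text \<open>The sample is split because of a variance obstacle. Weights \<open>a_j^T h\<close>
  reproduce the wanted vector on average, but in the Euclidean norm their fluctuation involves
  \<open>|a_j|^2\<close>, which a ridge leverage bound leaves uncontrolled when leading singular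
  values are huge. Correcting the residual \<open>z\<close> with the first half replaces
  \<open>|z|^2\<close> by \<open>\<mu> z^T Y^-1 z\<close>, where \<open>Y\<close> is
  \<open>\<mu> I\<close> plus the first-half Gram matrix. Since \<open>Y\<close> dominates each
  \<open>2 a_j a_j^T\<close>, one draw of weight \<open>b\<close> adds at most
  \<open>\<mu> b^2 / 2\<close>, however large the spectrum. The factor 1/2 of the theorem is the
  probability of a good first half; given one, the second half reaches all of \<open>M\<close> on
  average. The Kaczmarz detour stands in for a matrix concentration inequality: only expected
  squared lengths of vectors are tracked, coordinate by coordinate. The bound on \<lambda> keeps the
  penalty on the weights within the same budget as the fluctuation. The condition number enters
  through \<open>m * kappa_bar \<ge> sqrt m\<close>, which turns the hypothesis on \<open>s\<close>
  into a multiple of \<open>k log m\<close>.\<close>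

primrec iid_avg :: "nat \<Rightarrow> nat \<Rightarrow> (nat list \<Rightarrow> real) \<Rightarrow> real" where
  "iid_avg m 0 F = F []"
| "iid_avg m (Suc s) F = (\<Sum>j<m. iid_avg m s (\<lambda>xs. F (j # xs))) / real m"

lemma iid_avg_mono:
  assumes "\<And>xs. set xs \<subseteq> {..<m} \<Longrightarrow> length xs = s \<Longrightarrow> F xs \<le> G xs"
  shows "iid_avg m s F \<le> iid_avg m s G"
  using assms
proof (induction s arbitrary: F G)
  case (Suc s)
  then show ?case
    by (auto intro!: divide_right_mono sum_mono Suc.IH)
qed simp

lemma iid_avg_cong:
  assumes "\<And>xs. set xs \<subseteq> {..<m} \<Longrightarrow> length xs = s \<Longrightarrow> F xs = G xs"
  shows "iid_avg m s F = iid_avg m s G"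
  by (intro antisym iid_avg_mono) (simp_all add: assms)

lemma iid_avg_const: "0 < m \<Longrightarrow> iid_avg m s (\<lambda>_. c) = c"
  by (induction s) auto

lemma iid_avg_add: "iid_avg m s (\<lambda>xs. F xs + G xs) = iid_avg m s F + iid_avg m s G"
  by (induction s arbitrary: F G) (simp_all add: sum.distrib add_divide_distrib)

lemma iid_avg_cmult: "iid_avg m s (\<lambda>xs. c * F xs) = c * iid_avg m s F"
  by (induction s arbitrary: F) (simp_all add: sum_distrib_left)

lemma iid_avg_sum: "iid_avg m s (\<lambda>xs. \<Sum>i\<in>I. F i xs) = (\<Sum>i\<in>I. iid_avg m s (F i))"
proof (induction I rule: infinite_finite_induct)
  case (insert x A)
  then show ?case by (simp add: iid_avg_add)
next
  have "iid_avg m s (\<lambda>_. 0) = 0" by (induction s) auto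
  then show "iid_avg m s (\<lambda>xs. \<Sum>i\<in>{}. F i xs) = (\<Sum>i\<in>{}. iid_avg m s (F i))"
    "infinite A \<Longrightarrow> iid_avg m s (\<lambda>xs. \<Sum>i\<in>A. F i xs) = (\<Sum>i\<in>A. iid_avg m s (F i))" for A :: "'a set"
    by simp_all
qed

lemma iid_avg_append:
  "iid_avg m (s + t) F = iid_avg m s (\<lambda>xs. iid_avg m t (\<lambda>ys. F (xs @ ys)))"
  by (induction s arbitrary: F) simp_all

text \<open>Each draw contributes an independent factor with mean \<open>1 + (e - 1) / m\<close>.
  This exponential moment later bounds how often a single row is drawn.\<close>

lemma iid_avg_exp_count:
  assumes "j < m"
  shows "iid_avg m s (\<lambda>xs. exp (real (count_list xs j))) = (1 + (exp 1 - 1) / m) ^ s"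
proof (induction s)
  case (Suc s)
  have "(\<Sum>i<m. iid_avg m s (\<lambda>xs. exp (real (count_list (i # xs) j))))
      = (\<Sum>i<m. (1 + (if i = j then exp 1 - 1 else 0)) * (1 + (exp 1 - 1) / m) ^ s)"
  proof (rule sum.cong)
    fix i
    have "iid_avg m s (\<lambda>xs. exp (real (count_list (i # xs) j)))
        = iid_avg m s (\<lambda>xs. (1 + (if i = j then exp 1 - 1 else 0)) * exp (real (count_list xs j)))"
      by (rule iid_avg_cong) (auto simp: exp_add)
    then show "iid_avg m s (\<lambda>xs. exp (real (count_list (i # xs) j)))
        = (1 + (if i = j then exp 1 - 1 else 0)) * (1 + (exp 1 - 1) / m) ^ s"
      using Suc by (simp add: iid_avg_cmult)
  qed simp
  also have "\<dots> = (real m + (exp 1 - 1)) * (1 + (exp 1 - 1) / m) ^ s"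
    using assms by (simp add: sum_distrib_right[symmetric] sum.distrib)
  finally show ?case
    using assms by (simp add: field_simps)
qed simp

section \<open>Uniform subsets and their comparison with independent draws\<close>

definition subset_avg :: "nat \<Rightarrow> nat \<Rightarrow> (nat set \<Rightarrow> real) \<Rightarrow> real" where
  "subset_avg m s g = (\<Sum>S | S \<subseteq> {..<m} \<and> card S = s. g S) / real (m choose s)"

lemma finite_subsets_card: "finite {S. S \<subseteq> {..<m::nat} \<and> card S = s}"
  by (rule finite_subset[of _ "Pow {..<m}"]) auto

lemma subset_avg_mono:
  assumes "\<And>S. S \<subseteq> {..<m} \<Longrightarrow> card S = s \<Longrightarrow> f S \<le> g S"
  shows "subset_avg m s f \<le> subset_avg m s g"
  unfolding subset_avg_def using assms by (intro divide_right_mono sum_mono) auto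

text \<open>Double counting of pairs: a set with a new point corresponds to a larger set with one of
  its points marked, and each larger set has \<open>Suc s\<close> points to mark.\<close>

lemma sum_insert_subsets:
  fixes g :: "nat set \<Rightarrow> real"
  shows "(\<Sum>S | S \<subseteq> {..<m} \<and> card S = s. \<Sum>j\<in>{..<m} - S. g (insert j S))
    = real (Suc s) * (\<Sum>S | S \<subseteq> {..<m} \<and> card S = Suc s. g S)"
proof -
  let ?A = "SIGMA S:{S. S \<subseteq> {..<m} \<and> card S = s}. {..<m} - S"
  let ?B = "SIGMA S:{S. S \<subseteq> {..<m} \<and> card S = Suc s}. S"
  have fin: "finite S" if "S \<subseteq> {..<m}" for S using that finite_subset by blast
  have "(\<Sum>S | S \<subseteq> {..<m} \<and> card S = s. \<Sum>j\<in>{..<m} - S. g (insert j S))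
      = (\<Sum>(S, j)\<in>?A. g (insert j S))"
    by (rule sum.Sigma) (auto simp: finite_subsets_card)
  also have "\<dots> = (\<Sum>(S, j)\<in>?B. g S)"
    by (rule sum.reindex_bij_witness[of _ "\<lambda>(S, j). (S - {j}, j)" "\<lambda>(S, j). (insert j S, j)"])
      (auto simp: fin card_insert_if card_Diff_singleton insert_absorb)
  also have "\<dots> = (\<Sum>S | S \<subseteq> {..<m} \<and> card S = Suc s. \<Sum>j\<in>S. g S)"
    by (rule sum.Sigma[symmetric]) (auto simp: finite_subsets_card fin)
  also have "\<dots> = real (Suc s) * (\<Sum>S | S \<subseteq> {..<m} \<and> card S = Suc s. g S)"
    by (simp add: sum_distrib_left)
  finally show ?thesis .
qed

text \<open>A draw that hits \<open>S\<close> leaves \<open>S\<close> unchanged. By monotonicity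
  redrawing until the point is new can only increase the average, and a uniform \<open>S\<close>
  with a uniform new point is a uniform set of size \<open>Suc s\<close>.\<close>

lemma subset_avg_insert_le:
  assumes mono: "\<And>S T. S \<subseteq> T \<Longrightarrow> T \<subseteq> {..<m} \<Longrightarrow> g S \<le> g T" and s: "Suc s \<le> m"
  shows "(\<Sum>j<m. subset_avg m s (\<lambda>S. g (insert j S))) / m \<le> subset_avg m (Suc s) g"
proof -
  let ?F = "{S. S \<subseteq> {..<m} \<and> card S = s}"
  have ch: "real (m choose s) > 0" "real (m choose Suc s) > 0" using s by auto
  have chS: "real (Suc s) * real (m choose Suc s) = real (m - s) * real (m choose s)"
  proof -
    have "Suc s * (m choose Suc s) = (m - s) * (m choose s)"
      using binomial_absorb_comp[of m s] binomial_absorption[of s "m"] s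
      by (metis Suc_times_binomial_add add_diff_inverse_nat diff_Suc_Suc leD le_add_diff_inverse mult.commute
          Suc_diff_Suc Suc_le_eq add_Suc_right)
    then show ?thesis by (metis of_nat_mult)
  qed
  \<comment> \<open>The \<open>s\<close> repeated draws have value \<open>g S\<close>, which is at
    most the mean over the \<open>m - s\<close> fresh ones.\<close>
  have each: "(\<Sum>j<m. g (insert j S)) / m \<le> (\<Sum>j\<in>{..<m} - S. g (insert j S)) / (m - s)"
    if S: "S \<in> ?F" for S
  proof -
    have fS: "finite S" and cS: "card S = s" and sub: "S \<subseteq> {..<m}"
      using S finite_subset by auto
    have "(\<Sum>j<m. g (insert j S)) = (\<Sum>j\<in>S. g (insert j S)) + (\<Sum>j\<in>{..<m} - S. g (insert j S))"
      using sum.subset_diff[OF sub, of "\<lambda>j. g (insert j S)"] by simp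
    also have "(\<Sum>j\<in>S. g (insert j S)) = s * g S"
      using cS by (simp add: insert_absorb)
    finally have 1: "(\<Sum>j<m. g (insert j S)) = s * g S + (\<Sum>j\<in>{..<m} - S. g (insert j S))" .
    have "(\<Sum>j\<in>{..<m} - S. g S) \<le> (\<Sum>j\<in>{..<m} - S. g (insert j S))"
      using sub by (intro sum_mono mono) auto
    then have 2: "real (m - s) * g S \<le> (\<Sum>j\<in>{..<m} - S. g (insert j S))"
      using sub fS cS by (simp add: card_Diff_subset)
    have "real (m - s) * (s * g S + (\<Sum>j\<in>{..<m} - S. g (insert j S)))
       \<le> real m * (\<Sum>j\<in>{..<m} - S. g (insert j S))"
      using mult_left_mono[OF 2, of "real s"] s by (simp add: of_nat_diff algebra_simps)
    then show ?thesis unfolding 1 using s by (simp add: field_simps of_nat_diff)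
  qed
  have "(\<Sum>j<m. subset_avg m s (\<lambda>S. g (insert j S))) / m
      = (\<Sum>S\<in>?F. (\<Sum>j<m. g (insert j S)) / m) / real (m choose s)"
    unfolding subset_avg_def sum_divide_distrib[symmetric] by (subst sum.swap) simp
  also have "\<dots> \<le> (\<Sum>S\<in>?F. (\<Sum>j\<in>{..<m} - S. g (insert j S)) / (m - s)) / real (m choose s)"
    by (intro divide_right_mono sum_mono each) auto
  also have "\<dots> = (\<Sum>S\<in>?F. (\<Sum>j\<in>{..<m} - S. g (insert j S))) / (real (m - s) * real (m choose s))"
    by (simp add: sum_divide_distrib[symmetric])
  also have "\<dots> = subset_avg m (Suc s) g"
    unfolding sum_insert_subsets chS[symmetric] subset_avg_def by simp
  finally show ?thesis .
qed

text \<open>Repeated draws only shrink the sampled set, so for a monotone function sampling with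
  replacement is a lower bound for sampling without replacement.\<close>

lemma iid_avg_le_subset_avg:
  assumes "\<And>S T. S \<subseteq> T \<Longrightarrow> T \<subseteq> {..<m} \<Longrightarrow> g S \<le> g T" and "s \<le> m"
  shows "iid_avg m s (\<lambda>xs. g (set xs)) \<le> subset_avg m s g"
  using assms
proof (induction s arbitrary: g)
  case 0
  have "{S. S \<subseteq> {..<m} \<and> card S = 0} = {{}}"
    by (auto dest: finite_subset)
  then show ?case by (simp add: subset_avg_def)
next
  case (Suc s)
  have "iid_avg m (Suc s) (\<lambda>xs. g (set xs)) = (\<Sum>j<m. iid_avg m s (\<lambda>xs. g (insert j (set xs)))) / m"
    by simp
  also have "\<dots> \<le> (\<Sum>j<m. subset_avg m s (\<lambda>S. g (insert j S))) / m"
    using Suc.prems by (intro divide_right_mono sum_mono Suc.IH Suc.prems(1)) auto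
  also have "\<dots> \<le> subset_avg m (Suc s) g"
    by (rule subset_avg_insert_le) (use Suc.prems in auto)
  finally show ?case .
qed

lemma expectation_unif_subset:
  assumes "s \<le> m"
  shows "measure_pmf.expectation (unif_subset m s) f = subset_avg m s f"
proof -
  have "\<exists>S. S \<subseteq> {..<m} \<and> card S = s"
    using assms by (intro exI[of _ "{..<s}"]) auto
  then show ?thesis
    unfolding unif_subset_def subset_avg_def
    by (subst integral_pmf_of_set) (auto simp: finite_subsets_card n_subsets)
qed

section \<open>A lower tail bound from randomized Kaczmarz iterations\<close>

lemma iid_avg_markov:
  assumes "0 < m" "0 < a"
    and "\<And>xs. set xs \<subseteq> {..<m} \<Longrightarrow> length xs = s \<Longrightarrow> 0 \<le> F xs"
    and "\<And>xs. set xs \<subseteq> {..<m} \<Longrightarrow> length xs = s \<Longrightarrow> P xs \<Longrightarrow> a \<le> F xs"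
  shows "iid_avg m s (\<lambda>xs. of_bool (P xs)) \<le> iid_avg m s F / a"
proof -
  have "iid_avg m s (\<lambda>xs. of_bool (P xs)) \<le> iid_avg m s (\<lambda>xs. (1 / a) * F xs)"
    using assms by (intro iid_avg_mono) (auto simp: of_bool_def field_simps)
  then show ?thesis by (simp only: iid_avg_cmult) simp
qed

text \<open>The average of \<open>v_j v_j^T\<close> over the rows is
  \<open>diag M / \<kappa>\<close>, so random projections alone contract poorly in coordinates with
  small \<open>M i\<close>.\<close>

locale kaczmarz =
  fixes m r :: nat and v :: "nat \<Rightarrow> nat \<Rightarrow> real" and M :: "nat \<Rightarrow> real" and \<kappa> :: real
  assumes m_pos: "0 < m" and kappa: "1 \<le> \<kappa>"
    and M_bounds: "\<And>i. i < r \<Longrightarrow> 0 \<le> M i \<and> M i \<le> 1"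
    and v_norm: "\<And>j. j < m \<Longrightarrow> (\<Sum>i<r. (v j i)\<^sup>2) \<le> 1"
    and v_cov: "\<And>y. (\<Sum>j<m. (\<Sum>i<r. v j i * y i)\<^sup>2) = m / \<kappa> * (\<Sum>i<r. M i * (y i)\<^sup>2)"
begin

text \<open>Chosen so that \<open>M i / \<kappa> + shrink i = 1 / \<kappa>\<close>: projection and
  contraction together damp every coordinate at one common rate.\<close>

definition shrink :: "nat \<Rightarrow> real" where "shrink i = (1 - M i) / \<kappa>"

lemma shrink_bounds: "i < r \<Longrightarrow> 0 \<le> shrink i \<and> shrink i \<le> 1"
  using M_bounds[of i] kappa by (auto simp: shrink_def divide_simps)

text \<open>Project along \<open>v j\<close> (exactly, if \<open>v j\<close> is a unit vector) after a slight contraction of the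
  coordinates that the random vectors rarely see.\<close>

definition step :: "nat \<Rightarrow> (nat \<Rightarrow> real) \<Rightarrow> nat \<Rightarrow> real" where
  "step j x i = (1 - shrink i) * x i - v j i * (\<Sum>l<r. v j l * ((1 - shrink l) * x l))"

definition iter :: "nat list \<Rightarrow> (nat \<Rightarrow> real) \<Rightarrow> nat \<Rightarrow> real" where
  "iter xs x = fold step xs x"

lemma iter_simps [simp]: "iter [] x = x" "iter (j # xs) x = iter xs (step j x)"
  by (simp_all add: iter_def)

text \<open>The sampled Gram form plus one copy of \<open>diag shrink\<close> per draw. After the
  whitening is undone, this diagonal becomes a multiple of the identity.\<close>

definition energy :: "nat list \<Rightarrow> (nat \<Rightarrow> real) \<Rightarrow> real" where
  "energy xs p = length xs * (\<Sum>i<r. shrink i * (p i)\<^sup>2) + (\<Sum>j\<leftarrow>xs. (\<Sum>i<r. v j i * p i)\<^sup>2)"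

lemma norm_step_le:
  assumes j: "j < m"
  shows "(\<Sum>i<r. (step j x i)\<^sup>2)
    \<le> (\<Sum>i<r. ((1 - shrink i) * x i)\<^sup>2) - (\<Sum>i<r. v j i * ((1 - shrink i) * x i))\<^sup>2"
proof -
  define y where "y i = (1 - shrink i) * x i" for i
  define c where "c = (\<Sum>i<r. v j i * y i)"
  have "(\<Sum>i<r. (step j x i)\<^sup>2) = (\<Sum>i<r. (y i)\<^sup>2 - 2 * c * (v j i * y i) + c\<^sup>2 * (v j i)\<^sup>2)"
    unfolding step_def y_def[symmetric] c_def[symmetric]
    by (intro sum.cong refl) (simp add: power2_eq_square algebra_simps)
  also have "\<dots> = (\<Sum>i<r. (y i)\<^sup>2) - 2 * c * c + c\<^sup>2 * (\<Sum>i<r. (v j i)\<^sup>2)"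
    by (simp add: sum.distrib sum_subtractf sum_distrib_left[symmetric] c_def)
  also have "\<dots> \<le> (\<Sum>i<r. (y i)\<^sup>2) - 2 * c * c + c\<^sup>2 * 1"
    using v_norm[OF j] by (intro add_left_mono mult_left_mono) auto
  finally show ?thesis by (simp add: y_def c_def power2_eq_square)
qed

text \<open>Telescoping: Young's inequality bounds the displacement of one step, tested against
  \<open>p\<close>, by the energy of \<open>p\<close> in that step plus a quarter of the drop of the
  squared norm. The drops add up to the total drop.\<close>

lemma inner_diff_iter_le:
  assumes "set xs \<subseteq> {..<m}"
  shows "(\<Sum>i<r. p i * (x i - iter xs x i))
    \<le> energy xs p + ((\<Sum>i<r. (x i)\<^sup>2) - (\<Sum>i<r. (iter xs x i)\<^sup>2)) / 4"
  using assms
proof (induction xs arbitrary: x)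
  case Nil
  then show ?case by (simp add: energy_def)
next
  case (Cons j xs)
  define y where "y i = (1 - shrink i) * x i" for i
  define c where "c = (\<Sum>i<r. v j i * y i)"
  define d where "d = (\<Sum>i<r. v j i * p i)"
  have j: "j < m" using Cons.prems by auto
  have "(\<Sum>i<r. p i * (x i - iter (j # xs) x i))
      = (\<Sum>i<r. p i * (x i - step j x i)) + (\<Sum>i<r. p i * (step j x i - iter xs (step j x) i))"
    by (simp add: sum.distrib[symmetric] algebra_simps)
  moreover have "(\<Sum>i<r. p i * (step j x i - iter xs (step j x) i))
     \<le> energy xs p + ((\<Sum>i<r. (step j x i)\<^sup>2) - (\<Sum>i<r. (iter xs (step j x) i)\<^sup>2)) / 4"
    using Cons by auto
  moreover have "(\<Sum>i<r. p i * (x i - step j x i))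
     \<le> (\<Sum>i<r. shrink i * (p i)\<^sup>2) + d\<^sup>2 + ((\<Sum>i<r. (x i)\<^sup>2) - (\<Sum>i<r. (step j x i)\<^sup>2)) / 4"
  proof -
    have "(\<Sum>i<r. p i * (x i - step j x i)) = (\<Sum>i<r. shrink i * (p i * x i) + c * (v j i * p i))"
      unfolding step_def y_def[symmetric] c_def[symmetric]
      by (intro sum.cong refl) (simp add: y_def algebra_simps)
    also have "\<dots> = (\<Sum>i<r. shrink i * (p i * x i)) + c * d"
      by (simp add: sum.distrib sum_distrib_left d_def)
    \<comment> \<open>Young's inequality for both parts of the displacement; the contraction part
      uses \<open>(1 - t)^2 \<le> 1 - t\<close> to charge \<open>shrink i * (x i)^2\<close> to the
      loss of norm.\<close>
    also have "\<dots> \<le> (\<Sum>i<r. shrink i * (p i)\<^sup>2 + ((x i)\<^sup>2 - (y i)\<^sup>2) / 4) + (d\<^sup>2 + c\<^sup>2 / 4)"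
    proof (intro add_mono sum_mono)
      fix i assume "i \<in> {..<r}"
      then have b: "0 \<le> shrink i" "shrink i \<le> 1" using shrink_bounds by auto
      have "(1 - shrink i)\<^sup>2 \<le> 1 - shrink i"
        using b mult_left_le[of "1 - shrink i" "1 - shrink i"] by (simp add: power2_eq_square)
      then have "(y i)\<^sup>2 \<le> (1 - shrink i) * (x i)\<^sup>2"
        unfolding y_def power_mult_distrib by (rule mult_right_mono) simp
      moreover have "p i * x i \<le> (p i)\<^sup>2 + (x i)\<^sup>2 / 4"
        using zero_le_power2[of "p i - x i / 2"] by (simp add: power2_eq_square algebra_simps)
      then have "shrink i * (p i * x i) \<le> shrink i * ((p i)\<^sup>2 + (x i)\<^sup>2 / 4)"
        using b by (intro mult_left_mono)
      ultimately show "shrink i * (p i * x i) \<le> shrink i * (p i)\<^sup>2 + ((x i)\<^sup>2 - (y i)\<^sup>2) / 4"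
        by (simp add: distrib_left left_diff_distrib diff_divide_distrib)
    next
      show "c * d \<le> d\<^sup>2 + c\<^sup>2 / 4"
        using zero_le_power2[of "d - c / 2"] by (simp add: power2_eq_square algebra_simps)
    qed
    also have "\<dots> = (\<Sum>i<r. shrink i * (p i)\<^sup>2) + d\<^sup>2
        + ((\<Sum>i<r. (x i)\<^sup>2) - ((\<Sum>i<r. (y i)\<^sup>2) - c\<^sup>2)) / 4"
      by (simp add: sum.distrib sum_subtractf sum_divide_distrib[symmetric])
    also have "\<dots> \<le> (\<Sum>i<r. shrink i * (p i)\<^sup>2) + d\<^sup>2
        + ((\<Sum>i<r. (x i)\<^sup>2) - (\<Sum>i<r. (step j x i)\<^sup>2)) / 4"
      using norm_step_le[OF j, of x] unfolding c_def y_def by simp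
    finally show ?thesis .
  qed
  moreover have "energy (j # xs) p = energy xs p + (\<Sum>i<r. shrink i * (p i)\<^sup>2) + d\<^sup>2"
    by (simp add: energy_def d_def algebra_simps)
  ultimately show ?case unfolding iter_simps diff_divide_distrib by linarith
qed

text \<open>Take \<open>x = p\<close> in \<open>inner_diff_iter_le\<close>. With \<open>a\<close>
  and \<open>b\<close> the squared norms of \<open>p\<close> and of its image, the energy is at
  least \<open>a / 2 - 3 * b / 4\<close>, and \<open>b \<le> a / 4\<close> leaves
  \<open>5 * a / 16\<close>.\<close>

lemma energy_ge:
  assumes "set xs \<subseteq> {..<m}" and "4 * (\<Sum>i<r. (iter xs p i)\<^sup>2) \<le> (\<Sum>i<r. (p i)\<^sup>2)"
  shows "(\<Sum>i<r. (p i)\<^sup>2) / 4 \<le> energy xs p"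
proof -
  define a where "a = (\<Sum>i<r. (p i)\<^sup>2)"
  define b where "b = (\<Sum>i<r. (iter xs p i)\<^sup>2)"
  define c where "c = (\<Sum>i<r. p i * iter xs p i)"
  have "(\<Sum>i<r. p i * iter xs p i) \<le> (\<Sum>i<r. (p i)\<^sup>2 / 4 + (iter xs p i)\<^sup>2)"
  proof (rule sum_mono)
    fix i show "p i * iter xs p i \<le> (p i)\<^sup>2 / 4 + (iter xs p i)\<^sup>2"
      using zero_le_power2[of "p i / 2 - iter xs p i"] by (simp add: power2_eq_square algebra_simps)
  qed
  then have "c \<le> a / 4 + b"
    by (simp add: sum.distrib sum_divide_distrib a_def b_def c_def)
  moreover have "a - c \<le> energy xs p + (a - b) / 4"
    using inner_diff_iter_le[OF assms(1), of p p]
    by (simp add: right_diff_distrib sum_subtractf power2_eq_square a_def b_def c_def)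
  moreover have "0 \<le> a" unfolding a_def by (rule sum_nonneg) simp
  ultimately show ?thesis using assms(2) unfolding a_def[symmetric] b_def[symmetric] by (simp add: field_simps)
qed

text \<open>On average one step multiplies the square of coordinate \<open>i\<close> by at most
  \<open>(1 - M i / \<kappa>) * (1 - shrink i)^2\<close>, which is at most
  \<open>exp (- 1 / \<kappa>)\<close> by the choice of \<open>shrink\<close>.\<close>

lemma iid_avg_norm_iter_le:
  "iid_avg m s (\<lambda>xs. \<Sum>i<r. (iter xs x i)\<^sup>2) \<le> exp (- real s / \<kappa>) * (\<Sum>i<r. (x i)\<^sup>2)"
proof (induction s arbitrary: x)
  case (Suc s)
  have "iid_avg m (Suc s) (\<lambda>xs. \<Sum>i<r. (iter xs x i)\<^sup>2)
      \<le> (\<Sum>j<m. exp (- real s / \<kappa>) * (\<Sum>i<r. (step j x i)\<^sup>2)) / m"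
    using Suc by (auto intro!: divide_right_mono sum_mono)
  also have "\<dots> = exp (- real s / \<kappa>) * ((\<Sum>j<m. \<Sum>i<r. (step j x i)\<^sup>2) / m)"
    by (simp add: sum_distrib_left)
  also have "\<dots> \<le> exp (- real s / \<kappa>) * (exp (- 1 / \<kappa>) * (\<Sum>i<r. (x i)\<^sup>2))"
  proof (rule mult_left_mono)
    define y where "y i = (1 - shrink i) * x i" for i
    have "(\<Sum>j<m. \<Sum>i<r. (step j x i)\<^sup>2) \<le> (\<Sum>j<m. (\<Sum>i<r. (y i)\<^sup>2) - (\<Sum>i<r. v j i * y i)\<^sup>2)"
      unfolding y_def by (intro sum_mono norm_step_le) auto
    also have "\<dots> = m * (\<Sum>i<r. (1 - M i / \<kappa>) * (y i)\<^sup>2)"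
      unfolding sum_subtractf v_cov
      by (simp add: sum_subtractf left_diff_distrib right_diff_distrib sum_distrib_left mult_ac)
    finally have "(\<Sum>j<m. \<Sum>i<r. (step j x i)\<^sup>2) / m \<le> (\<Sum>i<r. (1 - M i / \<kappa>) * (y i)\<^sup>2)"
      using m_pos by (simp add: field_simps)
    also have "\<dots> \<le> (\<Sum>i<r. exp (- 1 / \<kappa>) * (x i)\<^sup>2)"
    proof (rule sum_mono)
      fix i assume "i \<in> {..<r}"
      then have i: "i < r" by simp
      have k: "0 < \<kappa>" using kappa by simp
      have b: "0 \<le> shrink i" "shrink i \<le> 1" using shrink_bounds[OF i] by auto
      have "1 - M i / \<kappa> \<ge> 0" using M_bounds[OF i] kappa by (simp add: field_simps)
      have "(1 - shrink i)\<^sup>2 \<le> 1 - shrink i"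
        using b mult_left_le[of "1 - shrink i" "1 - shrink i"] by (simp add: power2_eq_square)
      also have "\<dots> \<le> exp (- shrink i)" using exp_ge_add_one_self[of "- shrink i"] by simp
      finally have "(1 - M i / \<kappa>) * (1 - shrink i)\<^sup>2 \<le> exp (- (M i / \<kappa>)) * exp (- shrink i)"
        using exp_ge_add_one_self[of "- (M i / \<kappa>)"] \<open>1 - M i / \<kappa> \<ge> 0\<close> by (intro mult_mono) auto
      also have "\<dots> = exp (- 1 / \<kappa>)"
        using k by (simp add: exp_add[symmetric] shrink_def field_simps)
      finally have "(1 - M i / \<kappa>) * (1 - shrink i)\<^sup>2 \<le> exp (- 1 / \<kappa>)" .
      then show "(1 - M i / \<kappa>) * (y i)\<^sup>2 \<le> exp (- 1 / \<kappa>) * (x i)\<^sup>2"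
        using mult_right_mono[of _ _ "(x i)\<^sup>2"] unfolding y_def power_mult_distrib
        by (simp add: mult.assoc[symmetric])
    qed
    finally show "(\<Sum>j<m. \<Sum>i<r. (step j x i)\<^sup>2) / m \<le> exp (- 1 / \<kappa>) * (\<Sum>i<r. (x i)\<^sup>2)"
      by (simp add: sum_distrib_left)
  qed simp
  also have "\<dots> = exp (- real (Suc s) / \<kappa>) * (\<Sum>i<r. (x i)\<^sup>2)"
    by (simp add: exp_add[symmetric] mult.assoc[symmetric] add_divide_distrib diff_divide_distrib)
  finally show ?case .
qed simp

text \<open>Linearity lets bounds for the \<open>r\<close> basis vectors control all
  \<open>p\<close> at once, for each fixed sample.\<close>

lemma iter_linear:
  "i < r \<Longrightarrow> iter xs x i = (\<Sum>l<r. x l * iter xs (\<lambda>i. of_bool (i = l)) i)"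
proof -
  have lin: "iter xs (\<lambda>i. \<Sum>l\<in>I. c l * f l i) = (\<lambda>i. \<Sum>l\<in>I. c l * iter xs (f l) i)"
    for I :: "nat set" and c f
  proof (induction xs arbitrary: f)
    case (Cons j xs)
    have "step j (\<lambda>i. \<Sum>l\<in>I. c l * f l i) = (\<lambda>i. \<Sum>l\<in>I. c l * step j (f l) i)"
    proof
      fix i
      have "(\<Sum>q<r. v j q * ((1 - shrink q) * (\<Sum>l\<in>I. c l * f l q)))
          = (\<Sum>l\<in>I. c l * (\<Sum>q<r. v j q * ((1 - shrink q) * f l q)))"
        unfolding sum_distrib_left by (subst sum.swap) (simp add: mult_ac)
      then show "step j (\<lambda>i. \<Sum>l\<in>I. c l * f l i) i = (\<Sum>l\<in>I. c l * step j (f l) i)"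
        unfolding step_def
        by (simp add: sum_distrib_left[of _ _ I] right_diff_distrib[of "c _"] sum_subtractf mult_ac)
    qed
    then show ?case using Cons by simp
  qed simp
  \<comment> \<open>The basis expansion agrees with \<open>x\<close> only below \<open>r\<close>, so
    it must be known that the iteration reads no other coordinates.\<close>
  have cong: "i < r \<Longrightarrow> iter xs f i = iter xs g i" if "\<And>i. i < r \<Longrightarrow> f i = g i" for f g i
    using that
  proof (induction xs arbitrary: f g)
    case (Cons j xs)
    show ?case using Cons.prems
      by (auto intro!: Cons.IH simp: step_def)
  qed auto
  assume "i < r"
  moreover have "(\<Sum>l<r. x l * of_bool (i = l)) = x i" if "i < r" for i
    using that by (subst sum.remove[of _ i]) auto
  ultimately have "iter xs x i = iter xs (\<lambda>i. \<Sum>l<r. x l * of_bool (i = l)) i"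
    by (intro cong) auto
  then show ?thesis by (simp only: lin)
qed

text \<open>The iteration sends every basis vector to a short vector on average. If the product of all
  the steps is a strong contraction, then the energy form must be large.\<close>

lemma prob_energy_small:
  "iid_avg m s (\<lambda>xs. of_bool (\<exists>p. energy xs p < (\<Sum>i<r. (p i)\<^sup>2) / 4)) \<le> 4 * r * exp (- real s / \<kappa>)"
proof -
  let ?e = "\<lambda>l i. of_bool (i = l) :: real"
  \<comment> \<open>Markov's inequality for the squared Frobenius norm of the product of the steps.
    Below 1/4 it gives \<open>energy_ge\<close> its hypothesis for every \<open>p\<close>; the
    factor \<open>r\<close> counts basis vectors.\<close>
  have "iid_avg m s (\<lambda>xs. of_bool (\<exists>p. energy xs p < (\<Sum>i<r. (p i)\<^sup>2) / 4))
      \<le> iid_avg m s (\<lambda>xs. \<Sum>l<r. \<Sum>i<r. (iter xs (?e l) i)\<^sup>2) / (1 / 4)"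
  proof (rule iid_avg_markov[OF m_pos])
    fix xs assume xs: "set xs \<subseteq> {..<m}" and "\<exists>p. energy xs p < (\<Sum>i<r. (p i)\<^sup>2) / 4"
    then obtain p where p: "energy xs p < (\<Sum>i<r. (p i)\<^sup>2) / 4" by auto
    let ?F = "\<Sum>l<r. \<Sum>i<r. (iter xs (?e l) i)\<^sup>2"
    show "1 / 4 \<le> ?F"
    proof (rule ccontr)
      assume "\<not> 1 / 4 \<le> ?F"
      have "(\<Sum>i<r. (iter xs p i)\<^sup>2) = (\<Sum>i<r. (\<Sum>l<r. p l * iter xs (?e l) i)\<^sup>2)"
        by (intro sum.cong refl arg_cong[of _ _ "\<lambda>x. x\<^sup>2"] iter_linear) auto
      also have "\<dots> \<le> (\<Sum>i<r. (\<Sum>l<r. (p l)\<^sup>2) * (\<Sum>l<r. (iter xs (?e l) i)\<^sup>2))"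
        by (intro sum_mono Cauchy_Schwarz_ineq_sum)
      also have "\<dots> = (\<Sum>l<r. (p l)\<^sup>2) * ?F"
        unfolding sum_distrib_left[symmetric] by (subst sum.swap) simp
      also have "\<dots> \<le> (\<Sum>l<r. (p l)\<^sup>2) * (1 / 4)"
        using \<open>\<not> 1 / 4 \<le> ?F\<close> by (intro mult_left_mono sum_nonneg) auto
      finally have "4 * (\<Sum>i<r. (iter xs p i)\<^sup>2) \<le> (\<Sum>i<r. (p i)\<^sup>2)" by simp
      from energy_ge[OF xs this] p show False by simp
    qed
  qed (auto intro!: sum_nonneg)
  also have "iid_avg m s (\<lambda>xs. \<Sum>l<r. \<Sum>i<r. (iter xs (?e l) i)\<^sup>2)
      \<le> (\<Sum>l<r. exp (- real s / \<kappa>) * (\<Sum>i<r. (?e l i)\<^sup>2))"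
    unfolding iid_avg_sum[of m s "\<lambda>l xs. \<Sum>i<r. (iter xs (?e l) i)\<^sup>2"]
    by (intro sum_mono iid_avg_norm_iter_le)
  also have "\<dots> = r * exp (- real s / \<kappa>)"
    by (simp add: of_bool_def if_distrib[of "\<lambda>x. x\<^sup>2"] cong: if_cong)
  finally show ?thesis by simp
qed

end

section \<open>Regularized least squares on a random sample\<close>

text \<open>A form without nontrivial zeros has trivial kernel, so its determinant is nonzero. The
  detour through \<open>mat\<close> supplies an inverse for a matrix given by an index
  function.\<close>

lemma right_inverse_of_definite:
  fixes Y :: "nat \<Rightarrow> nat \<Rightarrow> real"
  assumes "\<And>x. (\<Sum>i<r. x i * (\<Sum>l<r. Y i l * x l)) = 0 \<Longrightarrow> \<forall>i<r. x i = 0"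
  shows "\<exists>R. \<forall>i<r. \<forall>l<r. (\<Sum>q<r. Y i q * R q l) = of_bool (i = l)"
proof -
  define B where "B = mat r r (\<lambda>(i, l). Y i l)"
  have B: "B \<in> carrier_mat r r" by (simp add: B_def)
  have "det B \<noteq> 0"
  proof
    assume "det B = 0"
    then obtain v where v: "v \<in> carrier_vec r" "v \<noteq> 0\<^sub>v r" "B *\<^sub>v v = 0\<^sub>v r"
      using det_0_iff_vec_prod_zero[OF B] by auto
    have "(\<Sum>l<r. Y i l * v $ l) = 0" if "i < r" for i
    proof -
      have "(B *\<^sub>v v) $ i = (\<Sum>l<r. Y i l * v $ l)"
        using that v(1) by (simp add: B_def scalar_prod_def atLeast0LessThan)
      then show ?thesis using v(3) that by simp
    qed
    then have "\<forall>i<r. v $ i = 0" by (intro assms) simp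
    then have "v = 0\<^sub>v r" using v(1) by (intro eq_vecI) auto
    with v(2) show False by simp
  qed
  then have "B \<in> Units (ring_mat TYPE(real) r ())"
    by (rule det_non_zero_imp_unit[OF B])
  then obtain C where C: "C \<in> carrier_mat r r" "B * C = 1\<^sub>m r"
    unfolding Units_def ring_mat_def by auto
  have "(\<Sum>q<r. Y i q * C $$ (q, l)) = of_bool (i = l)" if "i < r" "l < r" for i l
  proof -
    have "(B * C) $$ (i, l) = (\<Sum>q<r. Y i q * C $$ (q, l))"
      using that C(1) by (simp add: B_def scalar_prod_def atLeast0LessThan)
    moreover have "(B * C) $$ (i, l) = of_bool (i = l)"
      unfolding C(2) using that by simp
    ultimately show ?thesis by simp
  qed
  then show ?thesis by (intro exI[of _ "\<lambda>q l. C $$ (q, l)"] allI impI)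
qed

text \<open>Bias plus variance for a nonnegative form of a shifted sum of independent draws. Peeling
  off one draw moves the shift by the mean and adds a variance, here bounded by the second
  moment.\<close>

lemma iid_avg_quadratic_form_le:
  fixes r :: nat and R :: "nat \<Rightarrow> nat \<Rightarrow> real" and u :: "nat \<Rightarrow> nat \<Rightarrow> real"
  defines "Q \<equiv> \<lambda>z. \<Sum>i<r. \<Sum>l<r. R i l * (z i * z l)"
  assumes m: "0 < m" and nonneg: "\<And>z. 0 \<le> Q z"
  shows "iid_avg m s (\<lambda>ys. Q (\<lambda>i. b i - (\<Sum>y\<leftarrow>ys. u y i)))
    \<le> Q (\<lambda>i. b i - s * ((\<Sum>j<m. u j i) / m)) + s * ((\<Sum>j<m. Q (u j)) / m)"
proof (induction s arbitrary: b)
  case 0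
  then show ?case by simp
next
  case (Suc s)
  define ub where "ub i = (\<Sum>j<m. u j i) / m" for i
  define V where "V = (\<Sum>j<m. Q (u j)) / m"
  have step: "(\<Sum>j<m. Q (\<lambda>i. c i - u j i)) / m \<le> Q (\<lambda>i. c i - ub i) + V" for c
  proof -
    define X where "X w = (\<Sum>i<r. \<Sum>l<r. R i l * (c i * w l + w i * c l))" for w
    have Qd: "Q (\<lambda>i. c i - w i) = Q c - X w + Q w" for w
    proof -
      have "R i l * ((c i - w i) * (c l - w l))
          = R i l * (c i * c l) - R i l * (c i * w l + w i * c l) + R i l * (w i * w l)" for i l
        by (simp add: algebra_simps)
      then show ?thesis by (simp only: Q_def X_def sum.distrib sum_subtractf)
    qed
    have "(\<Sum>j<m. X (u j))
        = (\<Sum>i<r. \<Sum>l<r. \<Sum>j<m. R i l * (c i * u j l + u j i * c l))"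
      unfolding X_def by (subst sum.swap, rule sum.cong[OF refl], subst sum.swap, rule refl)
    also have "\<dots> = m * X ub"
      unfolding X_def sum_distrib_left
    proof (intro sum.cong refl)
      fix i l
      have "(\<Sum>j<m. R i l * (c i * u j l + u j i * c l))
          = R i l * (c i * (\<Sum>j<m. u j l) + (\<Sum>j<m. u j i) * c l)"
        by (simp only: distrib_left sum_distrib_left sum_distrib_right sum.distrib mult.assoc)
      also have "\<dots> = real m * (R i l * (c i * ub l + ub i * c l))"
        unfolding ub_def using m by (simp add: distrib_left)
      finally show "(\<Sum>j<m. R i l * (c i * u j l + u j i * c l)) = real m * (R i l * (c i * ub l + ub i * c l))" .
    qed
    finally have eq: "(\<Sum>j<m. X (u j)) = m * X ub" .
    have "(\<Sum>j<m. Q (\<lambda>i. c i - u j i)) / m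
        = Q c - X ub + V"
      using m by (simp add: Qd sum.distrib sum_subtractf eq V_def add_divide_distrib diff_divide_distrib)
    also have "\<dots> = Q (\<lambda>i. c i - ub i) - Q ub + V" unfolding Qd by simp
    finally show ?thesis using nonneg[of ub] by simp
  qed
  have "iid_avg m (Suc s) (\<lambda>ys. Q (\<lambda>i. b i - (\<Sum>y\<leftarrow>ys. u y i)))
      = (\<Sum>j<m. iid_avg m s (\<lambda>ys. Q (\<lambda>i. (b i - u j i) - (\<Sum>y\<leftarrow>ys. u y i)))) / m"
    by (simp add: algebra_simps)
  also have "\<dots> \<le> (\<Sum>j<m. Q (\<lambda>i. (b i - u j i) - s * ub i) + s * V) / m"
    unfolding ub_def V_def using Suc by (intro divide_right_mono sum_mono) auto
  also have "\<dots> = (\<Sum>j<m. Q (\<lambda>i. (b i - s * ub i) - u j i)) / m + s * V"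
    using m by (simp add: sum.distrib add_divide_distrib algebra_simps)
  also have "\<dots> \<le> Q (\<lambda>i. (b i - s * ub i) - ub i) + V + s * V"
    using step[of "\<lambda>i. b i - s * ub i"] by simp
  also have "(\<lambda>i. (b i - s * ub i) - ub i) = (\<lambda>i. b i - real (Suc s) * ub i)"
    by (simp add: algebra_simps)
  also have "Q (\<lambda>i. b i - real (Suc s) * ub i) + V + s * V = Q (\<lambda>i. b i - real (Suc s) * ub i) + real (Suc s) * V"
    by (simp add: algebra_simps)
  finally show ?case by (simp only: ub_def V_def)
qed

text \<open>The preceding bound for \<open>r = 1\<close> and indicators of \<open>j\<close>, with a
  sign because draws are subtracted there. It gives \<open>(s / m)^2 + s / m\<close>, and
  \<open>s \<le> m\<close> absorbs the square.\<close>

lemma iid_avg_count_square_le: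
  assumes "j < m" "s \<le> m"
  shows "iid_avg m s (\<lambda>ys. (real (count_list ys j))\<^sup>2) \<le> 2 * real s / m"
proof -
  have cnt: "(\<Sum>y\<leftarrow>ys. - of_bool (y = j)) = - real (count_list ys j)" for ys
    by (induction ys) auto
  have "(\<Sum>y<m. - of_bool (y = j)) = (- 1 :: real)"
    using assms(1) by (subst sum.remove[of _ j]) auto
  moreover have "(\<Sum>y<m. of_bool (y = j)) = (1 :: real)"
    using assms(1) by (subst sum.remove[of _ j]) auto
  ultimately have "iid_avg m s (\<lambda>ys. (real (count_list ys j))\<^sup>2) \<le> (real s / m)\<^sup>2 + s / m"
    using iid_avg_quadratic_form_le[of m "\<lambda>_ _. 1" 1 s "\<lambda>_. 0" "\<lambda>y _. - of_bool (y = j)"] assms(1)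
    unfolding cnt by (simp add: power2_eq_square)
  moreover have "(real s / m) * (real s / m) \<le> real s / m"
    using assms by (intro mult_left_le) auto
  ultimately show ?thesis by (simp add: power2_eq_square)
qed

section \<open>The variational value of a ridge problem on sampled rows\<close>

locale sampled_ridge =
  fixes m r :: nat and a :: "nat \<Rightarrow> nat \<Rightarrow> real" and l :: real
  assumes m_pos: "0 < m" and l_nonneg: "0 \<le> l"
begin

definition gain :: "(nat \<Rightarrow> real) \<Rightarrow> (nat \<Rightarrow> real) \<Rightarrow> real" where
  "gain c w = 2 * (\<Sum>j<m. w j * (\<Sum>i<r. a j i * c i)) - (\<Sum>i<r. (\<Sum>j<m. w j * a j i)\<^sup>2)
     - l * (\<Sum>j<m. (w j)\<^sup>2)"

text \<open>With \<open>P\<close> the regularized projection for the rows in \<open>S\<close>, the form \<open>c\<^sup>T P c\<close> is the supremum of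
  \<open>gain c w\<close>, so every weight vector \<open>w\<close> certifies a lower bound.\<close>

definition value_of :: "(nat \<Rightarrow> real) \<Rightarrow> nat set \<Rightarrow> real" where
  "value_of c S = (SUP w\<in>{w. \<forall>j. j \<notin> S \<longrightarrow> w j = 0}. gain c w)"

text \<open>Completing the square: the gain is what ridge regression saves when \<open>c\<close> is
  approximated by a combination of rows.\<close>

lemma gain_eq:
  "gain c w = (\<Sum>i<r. (c i)\<^sup>2) - ((\<Sum>i<r. (c i - (\<Sum>j<m. w j * a j i))\<^sup>2) + l * (\<Sum>j<m. (w j)\<^sup>2))"
proof -
  have "(\<Sum>i<r. (c i - (\<Sum>j<m. w j * a j i))\<^sup>2)
      = (\<Sum>i<r. (c i)\<^sup>2) - 2 * (\<Sum>i<r. c i * (\<Sum>j<m. w j * a j i)) + (\<Sum>i<r. (\<Sum>j<m. w j * a j i)\<^sup>2)"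
    unfolding power2_diff sum.distrib sum_subtractf
    by (simp only: sum_distrib_left[of 2 "\<lambda>i. c i * (\<Sum>j<m. w j * a j i)"] mult.assoc)
  moreover have "(\<Sum>i<r. c i * (\<Sum>j<m. w j * a j i)) = (\<Sum>j<m. w j * (\<Sum>i<r. a j i * c i))"
    unfolding sum_distrib_left by (subst sum.swap) (simp add: mult.left_commute mult.commute)
  ultimately show ?thesis unfolding gain_def by linarith
qed

lemma gain_le: "gain c w \<le> (\<Sum>i<r. (c i)\<^sup>2)"
proof -
  have "0 \<le> (\<Sum>i<r. (c i - (\<Sum>j<m. w j * a j i))\<^sup>2) + l * (\<Sum>j<m. (w j)\<^sup>2)"
    using l_nonneg by (intro add_nonneg_nonneg mult_nonneg_nonneg sum_nonneg) auto
  then show ?thesis unfolding gain_eq by linarith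
qed

lemma bdd_gain: "bdd_above (gain c ` X)"
  by (rule bdd_aboveI2) (rule gain_le)

lemma gain_le_value_of: "(\<And>j. j \<notin> S \<Longrightarrow> w j = 0) \<Longrightarrow> gain c w \<le> value_of c S"
  unfolding value_of_def by (intro cSUP_upper bdd_gain) auto

text \<open>More rows admit more weights. This is the monotonicity that
  \<open>iid_avg_le_subset_avg\<close> asks for.\<close>

lemma value_of_mono: "S \<subseteq> T \<Longrightarrow> value_of c S \<le> value_of c T"
  unfolding value_of_def by (rule cSUP_subset_mono[OF _ bdd_gain]) (auto intro: exI[of _ "\<lambda>_. 0"])

lemma value_of_nonneg: "0 \<le> value_of c S"
  using gain_le_value_of[of S "\<lambda>_. 0" c] by (simp add: gain_def)

lemma value_of_le: "(\<And>w. (\<And>j. j \<notin> S \<Longrightarrow> w j = 0) \<Longrightarrow> gain c w \<le> b) \<Longrightarrow> value_of c S \<le> b"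
  unfolding value_of_def by (rule cSUP_least) (auto intro: exI[of _ "\<lambda>_. 0"])

lemma sum_list_eq_sum_count:
  assumes "set xs \<subseteq> {..<m}"
  shows "(\<Sum>j\<leftarrow>xs. f j) = (\<Sum>j<m. real (count_list xs j) * f j :: real)"
  using assms
proof (induction xs)
  case (Cons x xs)
  have "(\<Sum>j<m. real (count_list (x # xs) j) * f j)
      = (\<Sum>j<m. real (count_list xs j) * f j + of_bool (x = j) * f j)"
    by (intro sum.cong refl) (auto simp: algebra_simps)
  also have "\<dots> = (\<Sum>j<m. real (count_list xs j) * f j) + f x"
  proof -
    have "(\<Sum>j<m. of_bool (x = j) * f j) = f x"
      using Cons.prems by (subst sum.remove[of _ x]) auto
    then show ?thesis by (simp add: sum.distrib)
  qed
  finally show ?case using Cons by simp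
qed simp

text \<open>\<open>R\<close> inverts \<open>Y = \<mu> I + \<Sum> a_j a_j^T\<close> over the first
  half, and \<open>z\<close> is what the second half leaves of \<open>c\<close>. Ridge regression of
  \<open>z\<close> on the first half has loss exactly \<open>\<mu> z^T R z\<close>; the penalty on
  all weights fits into that loss plus a term for the second half.\<close>

lemma value_of_append_ge:
  fixes \<mu> :: real and R :: "nat \<Rightarrow> nat \<Rightarrow> real" and c h :: "nat \<Rightarrow> real"
  assumes xs: "set xs \<subseteq> {..<m}" and ys: "set ys \<subseteq> {..<m}"
    and R: "\<And>i q. i < r \<Longrightarrow> q < r \<Longrightarrow>
      (\<Sum>p<r. (of_bool (i = p) * \<mu> + (\<Sum>j\<leftarrow>xs. a j i * a j p)) * R p q) = of_bool (i = q)"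
    and \<mu>: "0 \<le> \<mu>" and cnt: "\<And>j. j < m \<Longrightarrow> 2 * l * count_list xs j \<le> \<mu>"
  defines "z \<equiv> \<lambda>i. c i - (\<Sum>y\<leftarrow>ys. a y i * (\<Sum>p<r. a y p * h p))"
  shows "(\<Sum>i<r. (c i)\<^sup>2) - (\<mu> * (\<Sum>i<r. \<Sum>q<r. R i q * (z i * z q))
     + 2 * l * (\<Sum>j<m. (real (count_list ys j))\<^sup>2 * (\<Sum>p<r. a j p * h p)\<^sup>2)) \<le> value_of c (set (xs @ ys))"
proof -
  define Y where "Y i p = of_bool (i = p) * \<mu> + (\<Sum>j\<leftarrow>xs. a j i * a j p)" for i p
  define g where "g i = (\<Sum>q<r. R i q * z q)" for i
  define \<alpha> where "\<alpha> j = (\<Sum>i<r. a j i * g i)" for j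
  define \<beta> where "\<beta> j = (\<Sum>i<r. a j i * h i)" for j
  define x where "x j = real (count_list xs j)" for j
  define y where "y j = real (count_list ys j)" for j
  \<comment> \<open>Second-half draws follow \<open>h\<close>; the first-half weights
    \<open>x j * \<alpha> j\<close> solve the ridge problem for \<open>z\<close> with penalty
    \<open>\<mu>\<close>, which leaves the residual \<open>\<mu> * g\<close>.\<close>
  define w where "w j = x j * \<alpha> j + y j * \<beta> j" for j
  have Yg: "\<mu> * g i + (\<Sum>j<m. x j * \<alpha> j * a j i) = z i" if i: "i < r" for i
  proof -
    have "z i = (\<Sum>q<r. of_bool (i = q) * z q)"
      using i by (subst sum.remove[of _ i]) auto
    also have "\<dots> = (\<Sum>q<r. (\<Sum>p<r. Y i p * R p q) * z q)"
      using R[OF i] by (intro sum.cong refl) (simp add: Y_def)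
    also have "\<dots> = (\<Sum>p<r. Y i p * g p)"
      unfolding g_def sum_distrib_left sum_distrib_right by (subst sum.swap) (simp add: mult_ac)
    also have "\<dots> = (\<Sum>p<r. of_bool (i = p) * \<mu> * g p) + (\<Sum>p<r. (\<Sum>j<m. x j * (a j i * a j p)) * g p)"
      unfolding Y_def sum_list_eq_sum_count[OF xs] by (simp add: distrib_right sum.distrib x_def)
    also have "(\<Sum>p<r. of_bool (i = p) * \<mu> * g p) = \<mu> * g i"
      using i by (subst sum.remove[of _ i]) auto
    also have "(\<Sum>p<r. (\<Sum>j<m. x j * (a j i * a j p)) * g p) = (\<Sum>j<m. x j * \<alpha> j * a j i)"
      unfolding \<alpha>_def sum_distrib_left sum_distrib_right by (subst sum.swap) (simp add: mult_ac)
    finally show ?thesis by simp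
  qed
  have res: "c i - (\<Sum>j<m. w j * a j i) = \<mu> * g i" if i: "i < r" for i
  proof -
    have "z i = c i - (\<Sum>j<m. y j * \<beta> j * a j i)"
      unfolding z_def by (subst sum_list_eq_sum_count[OF ys]) (simp add: y_def \<beta>_def mult_ac)
    moreover have "(\<Sum>j<m. w j * a j i) = (\<Sum>j<m. x j * \<alpha> j * a j i) + (\<Sum>j<m. y j * \<beta> j * a j i)"
      by (simp add: w_def distrib_right sum.distrib)
    ultimately show ?thesis using Yg[OF i] by simp
  qed
  have Q: "(\<Sum>i<r. \<Sum>q<r. R i q * (z i * z q)) = \<mu> * (\<Sum>i<r. (g i)\<^sup>2) + (\<Sum>j<m. x j * (\<alpha> j)\<^sup>2)"
  proof -
    have "(\<Sum>i<r. \<Sum>q<r. R i q * (z i * z q)) = (\<Sum>i<r. z i * g i)"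
      by (simp add: g_def sum_distrib_left mult_ac)
    also have "\<dots> = (\<Sum>i<r. (\<mu> * g i + (\<Sum>j<m. x j * \<alpha> j * a j i)) * g i)"
      by (intro sum.cong refl) (simp add: Yg)
    also have "\<dots> = \<mu> * (\<Sum>i<r. (g i)\<^sup>2) + (\<Sum>i<r. (\<Sum>j<m. x j * \<alpha> j * a j i) * g i)"
      by (simp add: distrib_right sum.distrib sum_distrib_left power2_eq_square mult.assoc)
    also have "(\<Sum>i<r. (\<Sum>j<m. x j * \<alpha> j * a j i) * g i) = (\<Sum>j<m. x j * (\<alpha> j)\<^sup>2)"
      unfolding sum_distrib_right
      by (subst sum.swap)
        (simp add: \<alpha>_def power2_eq_square sum_distrib_left sum_distrib_right mult_ac)
    finally show ?thesis .
  qed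
  \<comment> \<open>A row drawn \<open>x j\<close> times costs \<open>(x j)^2\<close> but enters the
    Gram matrix with \<open>x j\<close>. The bound \<open>cnt\<close> pays for the extra
    multiplicity, including the 2 from \<open>(p + q)^2 \<le> 2 p^2 + 2 q^2\<close>.\<close>
  have w2: "l * (\<Sum>j<m. (w j)\<^sup>2) \<le> \<mu> * (\<Sum>j<m. x j * (\<alpha> j)\<^sup>2) + 2 * l * (\<Sum>j<m. (y j)\<^sup>2 * (\<beta> j)\<^sup>2)"
  proof -
    have "l * (w j)\<^sup>2 \<le> \<mu> * (x j * (\<alpha> j)\<^sup>2) + 2 * l * ((y j)\<^sup>2 * (\<beta> j)\<^sup>2)" if j: "j < m" for j
    proof -
      have "(w j)\<^sup>2 \<le> 2 * (x j * \<alpha> j)\<^sup>2 + 2 * (y j * \<beta> j)\<^sup>2"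
        unfolding w_def using zero_le_power2[of "x j * \<alpha> j - y j * \<beta> j"]
        by (simp add: power2_eq_square algebra_simps)
      then have "l * (w j)\<^sup>2 \<le> l * (2 * (x j * \<alpha> j)\<^sup>2 + 2 * (y j * \<beta> j)\<^sup>2)"
        using l_nonneg by (rule mult_left_mono)
      moreover have "(2 * l * x j) * (x j * (\<alpha> j)\<^sup>2) \<le> \<mu> * (x j * (\<alpha> j)\<^sup>2)"
        using cnt[OF j] by (intro mult_right_mono) (auto simp: x_def)
      ultimately show ?thesis by (simp add: power2_eq_square algebra_simps)
    qed
    then have "(\<Sum>j<m. l * (w j)\<^sup>2) \<le> (\<Sum>j<m. \<mu> * (x j * (\<alpha> j)\<^sup>2) + 2 * l * ((y j)\<^sup>2 * (\<beta> j)\<^sup>2))"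
      by (intro sum_mono) auto
    then show ?thesis by (simp add: sum.distrib sum_distrib_left)
  qed
  have "(\<Sum>i<r. (c i - (\<Sum>j<m. w j * a j i))\<^sup>2) = \<mu> * (\<mu> * (\<Sum>i<r. (g i)\<^sup>2))"
    unfolding sum_distrib_left
    by (intro sum.cong refl) (simp add: res power2_eq_square mult_ac)
  then have "(\<Sum>i<r. (c i - (\<Sum>j<m. w j * a j i))\<^sup>2) + l * (\<Sum>j<m. (w j)\<^sup>2)
      \<le> \<mu> * (\<Sum>i<r. \<Sum>q<r. R i q * (z i * z q)) + 2 * l * (\<Sum>j<m. (y j)\<^sup>2 * (\<beta> j)\<^sup>2)"
    using w2 unfolding Q by (simp add: distrib_left)
  moreover have "gain c w \<le> value_of c (set (xs @ ys))"
    by (rule gain_le_value_of) (auto simp: w_def x_def y_def count_list_0_iff)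
  ultimately show ?thesis unfolding gain_eq y_def \<beta>_def by linarith
qed

text \<open>The first half is fixed and the second half averaged. The bias is measured in the
  Euclidean norm, while the variance uses the inverse of \<open>Y\<close>, in which each row has
  squared length at most 1/2.\<close>

lemma iid_avg_value_of_ge:
  fixes \<mu> :: real and c h :: "nat \<Rightarrow> real"
  assumes xs: "set xs \<subseteq> {..<m}" and \<mu>: "0 < \<mu>"
    and cnt: "\<And>j. j < m \<Longrightarrow> 2 * l * count_list xs j \<le> \<mu>"
    and lev: "\<And>j u. j < m \<Longrightarrow> 2 * (\<Sum>i<r. a j i * u i)\<^sup>2
      \<le> \<mu> * (\<Sum>i<r. (u i)\<^sup>2) + (\<Sum>j\<leftarrow>xs. (\<Sum>i<r. a j i * u i)\<^sup>2)"
    and s: "s \<le> m"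
  shows "(\<Sum>i<r. (c i)\<^sup>2) - (\<Sum>i<r. (c i - s * ((\<Sum>j<m. a j i * (\<Sum>p<r. a j p * h p)) / m))\<^sup>2)
     - (\<mu> / 2 + 4 * l) * (s / m) * (\<Sum>j<m. (\<Sum>p<r. a j p * h p)\<^sup>2)
    \<le> iid_avg m s (\<lambda>ys. value_of c (set (xs @ ys)))"
proof -
  define Y where "Y i p = of_bool (i = p) * \<mu> + (\<Sum>j\<leftarrow>xs. a j i * a j p)" for i p
  define \<beta> where "\<beta> j = (\<Sum>i<r. a j i * h i)" for j
  define T where "T u = \<mu> * (\<Sum>i<r. (u i)\<^sup>2) + (\<Sum>j\<leftarrow>xs. (\<Sum>i<r. a j i * u i)\<^sup>2)" for u
  have Yform: "(\<Sum>i<r. u i * (\<Sum>p<r. Y i p * u p)) = T u" for u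
  proof -
    have "(\<Sum>i<r. u i * (\<Sum>p<r. Y i p * u p))
        = (\<Sum>i<r. u i * (\<Sum>p<r. of_bool (i = p) * \<mu> * u p))
         + (\<Sum>i<r. u i * (\<Sum>p<r. (\<Sum>j<m. count_list xs j * (a j i * a j p)) * u p))"
      unfolding Y_def sum_list_eq_sum_count[OF xs] by (simp add: distrib_right distrib_left sum.distrib)
    also have "(\<Sum>i<r. u i * (\<Sum>p<r. of_bool (i = p) * \<mu> * u p)) = \<mu> * (\<Sum>i<r. (u i)\<^sup>2)"
      unfolding sum_distrib_left[of \<mu>]
    proof (intro sum.cong refl)
      fix i assume "i \<in> {..<r}"
      then have "(\<Sum>p<r. of_bool (i = p) * \<mu> * u p) = \<mu> * u i" by (subst sum.remove[of _ i]) auto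
      then show "u i * (\<Sum>p<r. of_bool (i = p) * \<mu> * u p) = \<mu> * (u i)\<^sup>2" by (simp add: power2_eq_square)
    qed
    also have "(\<Sum>i<r. u i * (\<Sum>p<r. (\<Sum>j<m. count_list xs j * (a j i * a j p)) * u p))
        = (\<Sum>i<r. \<Sum>p<r. \<Sum>j<m. count_list xs j * ((a j i * u i) * (a j p * u p)))"
      by (simp add: sum_distrib_left sum_distrib_right mult_ac)
    also have "\<dots> = (\<Sum>j<m. \<Sum>i<r. \<Sum>p<r. count_list xs j * ((a j i * u i) * (a j p * u p)))"
      by (subst (2) sum.swap, subst sum.swap) simp
    also have "\<dots> = (\<Sum>j<m. count_list xs j * (\<Sum>i<r. a j i * u i)\<^sup>2)"
      by (simp only: power2_eq_square sum_product) (simp only: sum_distrib_left)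
    finally show ?thesis unfolding T_def sum_list_eq_sum_count[OF xs] .
  qed
  have T_ge: "\<mu> * (\<Sum>i<r. (u i)\<^sup>2) \<le> T u" for u
    unfolding T_def by (auto intro!: sum_list_nonneg)
  have "\<forall>i<r. x i = 0" if "(\<Sum>i<r. x i * (\<Sum>p<r. Y i p * x p)) = 0" for x
  proof -
    have "\<mu> * (\<Sum>i<r. (x i)\<^sup>2) \<le> 0" using T_ge[of x] that Yform by simp
    then have "(\<Sum>i<r. (x i)\<^sup>2) \<le> 0" using \<mu> by (simp add: mult_le_0_iff)
    then have "(\<Sum>i<r. (x i)\<^sup>2) = 0" by (intro antisym sum_nonneg) auto
    then show ?thesis by (subst (asm) sum_nonneg_eq_0_iff) auto
  qed
  from right_inverse_of_definite[OF this]
  obtain R where R: "\<And>i q. i < r \<Longrightarrow> q < r \<Longrightarrow> (\<Sum>p<r. Y i p * R p q) = of_bool (i = q)"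
    by blast
  define Q where "Q z = (\<Sum>i<r. \<Sum>q<r. R i q * (z i * z q))" for z
  \<comment> \<open>Writing \<open>z = Y g\<close> with \<open>g = R z\<close> gives
    \<open>z^T R z = g^T Y g\<close>. Nonnegativity then follows without proving \<open>R\<close>
    symmetric.\<close>
  have QT: "Q z = T (\<lambda>i. \<Sum>q<r. R i q * z q)" and Qz: "Q z = (\<Sum>i<r. z i * (\<Sum>q<r. R i q * z q))" for z
  proof -
    define g where "g i = (\<Sum>q<r. R i q * z q)" for i
    have Yg: "(\<Sum>p<r. Y i p * g p) = z i" if i: "i < r" for i
    proof -
      have "z i = (\<Sum>q<r. of_bool (i = q) * z q)"
        using i by (subst sum.remove[of _ i]) auto
      also have "\<dots> = (\<Sum>q<r. (\<Sum>p<r. Y i p * R p q) * z q)"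
        using R[OF i] by (intro sum.cong refl) simp
      also have "\<dots> = (\<Sum>p<r. Y i p * g p)"
        unfolding g_def sum_distrib_left sum_distrib_right by (subst sum.swap) (simp add: mult_ac)
      finally show ?thesis by simp
    qed
    show *: "Q z = (\<Sum>i<r. z i * (\<Sum>q<r. R i q * z q))"
      by (simp add: Q_def sum_distrib_left mult_ac)
    then have "Q z = (\<Sum>i<r. g i * (\<Sum>p<r. Y i p * g p))"
      unfolding g_def[symmetric] by (auto simp: Yg mult.commute[of "g _"] intro!: sum.cong)
    then show "Q z = T (\<lambda>i. \<Sum>q<r. R i q * z q)" by (simp add: Yform g_def)
  qed
  have T_nonneg: "0 \<le> T u" for u
    using T_ge[of u] \<mu> by (meson mult_nonneg_nonneg order_trans less_imp_le sum_nonneg zero_le_power2)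
  have Q_nonneg: "0 \<le> Q z" for z unfolding QT by (rule T_nonneg)
  \<comment> \<open>This is \<open>\<mu> Y^-1 \<le> I\<close>, read off from
    \<open>Y \<ge> \<mu> I\<close> by Young's inequality for \<open>z\<close> and
    \<open>\<mu> * g\<close>.\<close>
  have Q_le: "\<mu> * Q z \<le> (\<Sum>i<r. (z i)\<^sup>2)" for z
  proof -
    define g where "g i = (\<Sum>q<r. R i q * z q)" for i
    have "2 * (\<mu> * Q z) = (\<Sum>i<r. 2 * (z i * (\<mu> * g i)))"
      unfolding Qz g_def[symmetric] by (simp add: sum_distrib_left mult_ac)
    also have "\<dots> \<le> (\<Sum>i<r. (z i)\<^sup>2 + (\<mu> * g i)\<^sup>2)"
      using sum_squares_bound[of "z _" "\<mu> * g _"] by (intro sum_mono) (auto simp: mult.assoc)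
    also have "\<dots> = (\<Sum>i<r. (z i)\<^sup>2) + \<mu> * (\<mu> * (\<Sum>i<r. (g i)\<^sup>2))"
      by (simp add: sum.distrib sum_distrib_left power2_eq_square mult_ac)
    also have "\<dots> \<le> (\<Sum>i<r. (z i)\<^sup>2) + \<mu> * Q z"
      unfolding QT g_def[symmetric] using T_ge \<mu> by (intro add_left_mono mult_left_mono) auto
    finally show ?thesis by simp
  qed
  \<comment> \<open>At \<open>u = R a_j\<close> both sides of \<open>lev\<close> are powers of
    \<open>Q (a j)\<close>: it says \<open>2 Q^2 \<le> Q\<close>.\<close>
  have Q_row: "Q (\<lambda>i. a j i * b) \<le> b\<^sup>2 / 2" if j: "j < m" for j b
  proof -
    have "2 * (Q (a j))\<^sup>2 \<le> Q (a j)"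
      using lev[OF j, of "\<lambda>i. \<Sum>q<r. R i q * a j q"] unfolding T_def[symmetric] QT[symmetric] Qz[symmetric] .
    then have "Q (a j) * (2 * Q (a j) - 1) \<le> 0" by (simp add: power2_eq_square algebra_simps)
    then have "Q (a j) \<le> 1 / 2" using Q_nonneg[of "a j"] by (auto simp: mult_le_0_iff)
    then have "b\<^sup>2 * Q (a j) \<le> b\<^sup>2 * (1 / 2)" by (intro mult_left_mono) auto
    moreover have "Q (\<lambda>i. a j i * b) = b\<^sup>2 * Q (a j)"
      by (simp add: Q_def sum_distrib_left power2_eq_square mult_ac)
    ultimately show ?thesis by simp
  qed
  define ub where "ub i = (\<Sum>j<m. a j i * \<beta> j) / m" for i
  define B where "B = (\<Sum>j<m. (\<beta> j)\<^sup>2)"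
  define z where "z ys i = c i - (\<Sum>y\<leftarrow>ys. a y i * \<beta> y)" for ys i
  have avgQ: "iid_avg m s (\<lambda>ys. Q (z ys)) \<le> Q (\<lambda>i. c i - s * ub i) + s * (B / 2 / m)"
  proof -
    have "iid_avg m s (\<lambda>ys. Q (z ys))
        \<le> Q (\<lambda>i. c i - s * ub i) + s * ((\<Sum>j<m. Q (\<lambda>i. a j i * \<beta> j)) / m)"
      unfolding Q_def z_def ub_def
      by (rule iid_avg_quadratic_form_le[OF m_pos]) (use Q_nonneg Q_def in simp)
    also have "\<dots> \<le> Q (\<lambda>i. c i - s * ub i) + s * ((\<Sum>j<m. (\<beta> j)\<^sup>2 / 2) / m)"
      by (intro add_left_mono mult_left_mono divide_right_mono sum_mono Q_row) auto
    finally show ?thesis by (simp add: B_def sum_divide_distrib)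
  qed
  have avgC: "iid_avg m s (\<lambda>ys. \<Sum>j<m. (real (count_list ys j))\<^sup>2 * (\<beta> j)\<^sup>2) \<le> 2 * real s / m * B"
  proof -
    have "iid_avg m s (\<lambda>ys. \<Sum>j<m. (real (count_list ys j))\<^sup>2 * (\<beta> j)\<^sup>2)
        = (\<Sum>j<m. (\<beta> j)\<^sup>2 * iid_avg m s (\<lambda>ys. (real (count_list ys j))\<^sup>2))"
      unfolding iid_avg_cmult[symmetric] iid_avg_sum[symmetric] by (simp add: mult.commute)
    also have "\<dots> \<le> (\<Sum>j<m. (\<beta> j)\<^sup>2 * (2 * real s / m))"
      using iid_avg_count_square_le s by (intro sum_mono mult_left_mono) auto
    finally show ?thesis by (simp add: B_def sum_distrib_left mult_ac)
  qed
  define D where "D ys = \<mu> * Q (z ys) + 2 * l * (\<Sum>j<m. (real (count_list ys j))\<^sup>2 * (\<beta> j)\<^sup>2)" for ys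
  have "iid_avg m s D = \<mu> * iid_avg m s (\<lambda>ys. Q (z ys))
      + 2 * l * iid_avg m s (\<lambda>ys. \<Sum>j<m. (real (count_list ys j))\<^sup>2 * (\<beta> j)\<^sup>2)"
    by (simp only: D_def[abs_def] iid_avg_add iid_avg_cmult)
  also have "\<dots> \<le> \<mu> * (Q (\<lambda>i. c i - s * ub i) + s * (B / 2 / m)) + 2 * l * (2 * real s / m * B)"
    using \<mu> l_nonneg by (intro add_mono mult_left_mono avgQ avgC) auto
  also have "\<dots> \<le> (\<Sum>i<r. (c i - s * ub i)\<^sup>2) + (\<mu> / 2 + 4 * l) * (s / m) * B"
    using Q_le[of "\<lambda>i. c i - s * ub i"] by (simp add: algebra_simps)
  finally have D_le: "iid_avg m s D \<le> \<dots>" .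
  have "(\<Sum>i<r. (c i)\<^sup>2) - iid_avg m s D = iid_avg m s (\<lambda>ys. (\<Sum>i<r. (c i)\<^sup>2) + (-1) * D ys)"
    unfolding iid_avg_add iid_avg_cmult iid_avg_const[OF m_pos] by simp
  also have "\<dots> \<le> iid_avg m s (\<lambda>ys. value_of c (set (xs @ ys)))"
  proof (rule iid_avg_mono)
    fix ys :: "nat list" assume ys: "set ys \<subseteq> {..<m}"
    show "(\<Sum>i<r. (c i)\<^sup>2) + (-1) * D ys \<le> value_of c (set (xs @ ys))"
      using value_of_append_ge[OF xs ys R[unfolded Y_def] less_imp_le[OF \<mu>] cnt, of c h]
      unfolding D_def Q_def z_def \<beta>_def by simp
  qed
  finally show ?thesis using D_le unfolding ub_def \<beta>_def B_def by linarith
qed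

end

section \<open>Sampling rows with bounded ridge leverage scores\<close>

lemma iid_avg_exp_count_le:
  assumes "j < m" "s \<le> m"
  shows "iid_avg m s (\<lambda>xs. exp (real (count_list xs j))) \<le> exp 2"
proof -
  have e: "exp 1 \<le> (3 :: real)" using exp_le by simp
  have "(1 + (exp 1 - 1) / real m) ^ s \<le> (exp (2 / m)) ^ s"
  proof (rule power_mono)
    have "1 + (exp 1 - 1) / real m \<le> 1 + 2 / m"
      using e by (intro add_left_mono divide_right_mono) auto
    also have "\<dots> \<le> exp (2 / m)" by (rule exp_ge_add_one_self)
    finally show "1 + (exp 1 - 1) / real m \<le> exp (2 / m)" .
  qed simp
  also have "\<dots> = exp (s * (2 / m))" by (simp only: exp_of_nat_mult)
  also have "\<dots> \<le> exp 2" using assms by (simp add: field_simps)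
  finally show ?thesis using iid_avg_exp_count[OF assms(1)] by simp
qed

lemma sum_square_orthonormal:
  fixes W :: "nat \<Rightarrow> nat \<Rightarrow> real"
  assumes "\<And>i i'. i < r \<Longrightarrow> i' < r \<Longrightarrow> (\<Sum>j<m. W j i * W j i') = of_bool (i = i')"
  shows "(\<Sum>j<m. (\<Sum>i<r. W j i * t i)\<^sup>2) = (\<Sum>i<r. (t i)\<^sup>2)"
proof -
  have "(\<Sum>j<m. (\<Sum>i<r. W j i * t i)\<^sup>2) = (\<Sum>j<m. \<Sum>i<r. \<Sum>i'<r. (W j i * W j i') * (t i * t i'))"
    by (simp only: power2_eq_square sum_product) (simp only: mult_ac)
  also have "\<dots> = (\<Sum>i<r. \<Sum>i'<r. \<Sum>j<m. (W j i * W j i') * (t i * t i'))"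
    by (subst sum.swap, rule sum.cong[OF refl], subst sum.swap, rule refl)
  also have "\<dots> = (\<Sum>i<r. \<Sum>i'<r. of_bool (i = i') * (t i * t i'))"
    by (intro sum.cong refl) (simp add: assms sum_distrib_right[symmetric])
  also have "\<dots> = (\<Sum>i<r. (t i)\<^sup>2)"
  proof (rule sum.cong[OF refl])
    fix i assume "i \<in> {..<r}"
    then show "(\<Sum>i'<r. of_bool (i = i') * (t i * t i')) = (t i)\<^sup>2"
      by (subst sum.remove[of _ i]) (auto simp: power2_eq_square)
  qed
  finally show ?thesis .
qed

text \<open>The interface between transform and sampling: \<open>W\<close> stands for the relevant
  columns of \<open>Q U\<close>, and \<open>lev\<close> is the flatness that the random signs
  provide. All that follows here is for a fixed \<open>Q\<close>.\<close>

locale flat_rows =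
  fixes m r k :: nat and W :: "nat \<Rightarrow> nat \<Rightarrow> real" and \<sigma> :: "nat \<Rightarrow> real" and lb l :: real
  assumes r_le: "r \<le> m" and m_pos': "0 < m" and k_pos: "0 < k" and lb_pos: "0 < lb"
    and \<sigma>_nonneg: "\<And>i. i < r \<Longrightarrow> 0 \<le> \<sigma> i"
    and orth: "\<And>i i'. i < r \<Longrightarrow> i' < r \<Longrightarrow> (\<Sum>j<m. W j i * W j i') = of_bool (i = i')"
    and lev: "\<And>j. j < m \<Longrightarrow> (\<Sum>i<r. (\<sigma> i)\<^sup>2 / ((\<sigma> i)\<^sup>2 + lb) * (W j i)\<^sup>2) \<le> 8 * k / m"
    and l_nonneg': "0 \<le> l" and l_le: "l \<le> k / m * lb"
begin

definition M :: "nat \<Rightarrow> real" where "M i = (\<sigma> i)\<^sup>2 / ((\<sigma> i)\<^sup>2 + lb)"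

lemma denom_pos: "0 < (\<sigma> i)\<^sup>2 + lb"
  using lb_pos by (simp add: add_nonneg_pos)

lemma M_bounds: "0 \<le> M i" "M i \<le> 1"
  using denom_pos[of i] lb_pos by (auto simp: M_def)

lemmas sum_W_sq = sum_square_orthonormal[OF orth]

definition a :: "nat \<Rightarrow> nat \<Rightarrow> real" where "a j i = \<sigma> i * W j i"

sublocale sampled_ridge m r a l
  by unfold_locales (use m_pos' l_nonneg' in auto)

text \<open>Row \<open>j\<close> whitened by \<open>1 / sqrt (\<sigma>\<^sup>2 + lb)\<close> and
  scaled. The 64 exceeds what length 1 requires; it is \<open>4 * 2 * 8\<close>, from the 1/4 in the
  energy bound, the domination of \<open>2 a_j a_j^T\<close>, and the leverage bound
  \<open>8 k / m\<close>.\<close>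

definition v :: "nat \<Rightarrow> nat \<Rightarrow> real" where "v j i = W j i * sqrt (M i * m / (64 * k))"

sublocale kz: kaczmarz m r v M "64 * real k"
proof
  show "0 < m" by (rule m_pos')
  show "1 \<le> 64 * real k" using k_pos by simp
  show "0 \<le> M i \<and> M i \<le> 1" for i using M_bounds by auto
  fix j assume j: "j < m"
  have "(\<Sum>i<r. (v j i)\<^sup>2) = (\<Sum>i<r. M i * (W j i)\<^sup>2) * (m / (64 * k))"
    using M_bounds by (simp add: v_def power_mult_distrib sum_distrib_left sum_distrib_right mult_ac)
  also have "\<dots> \<le> (8 * k / m) * (m / (64 * k))"
    using lev[OF j] by (intro mult_right_mono) (auto simp: M_def)
  also have "\<dots> \<le> 1" using k_pos m_pos' by (simp add: field_simps)
  finally show "(\<Sum>i<r. (v j i)\<^sup>2) \<le> 1" .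
next
  fix y :: "nat \<Rightarrow> real"
  have "(\<Sum>j<m. (\<Sum>i<r. v j i * y i)\<^sup>2) = (\<Sum>i<r. (sqrt (M i * m / (64 * k)) * y i)\<^sup>2)"
    unfolding v_def mult.assoc by (rule sum_W_sq)
  also have "\<dots> = m / (64 * real k) * (\<Sum>i<r. M i * (y i)\<^sup>2)"
    using M_bounds by (simp add: power_mult_distrib sum_distrib_left mult_ac)
  finally show "(\<Sum>j<m. (\<Sum>i<r. v j i * y i)\<^sup>2) = m / (64 * real k) * (\<Sum>i<r. M i * (y i)\<^sup>2)" .
qed

text \<open>Both sides are compared with \<open>\<Sum> N i * (u i)^2\<close>: the energy bound puts
  the right side above \<open>16 k / m\<close> times it, and Cauchy-Schwarz with the leverage bound
  puts \<open>(a_j . u)^2\<close> below \<open>8 k / m\<close> times it.\<close>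

lemma sampled_form_ge:
  assumes good: "\<And>p. (\<Sum>i<r. (p i)\<^sup>2) / 4 \<le> kz.energy xs p" and j: "j < m"
  shows "2 * (\<Sum>i<r. a j i * u i)\<^sup>2
    \<le> length xs / m * lb * (\<Sum>i<r. (u i)\<^sup>2) + (\<Sum>j\<leftarrow>xs. (\<Sum>i<r. a j i * u i)\<^sup>2)"
proof -
  define N where "N i = (\<sigma> i)\<^sup>2 + lb" for i
  define p where "p i = sqrt (N i) * u i" for i
  have N: "0 < N i" for i using denom_pos by (simp add: N_def)
  have sM: "sqrt (M i) * sqrt (N i) = \<sigma> i" if "i < r" for i
    using N[of i] \<sigma>_nonneg[OF that] by (simp add: M_def N_def real_sqrt_divide)
  have vp: "(\<Sum>i<r. v j i * p i)\<^sup>2 = m / (64 * k) * (\<Sum>i<r. a j i * u i)\<^sup>2" for j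
  proof -
    have "(\<Sum>i<r. v j i * p i) = (\<Sum>i<r. sqrt (m / (64 * k)) * (a j i * u i))"
    proof (intro sum.cong refl)
      fix i assume "i \<in> {..<r}"
      have "sqrt (M i * m / (64 * k)) = sqrt (M i) * sqrt (m / (64 * k))"
        by (simp add: real_sqrt_mult[symmetric])
      then show "v j i * p i = sqrt (m / (64 * k)) * (a j i * u i)"
        using sM[of i] \<open>i \<in> {..<r}\<close> by (simp add: v_def p_def a_def)
    qed
    then show ?thesis
      by (simp add: sum_distrib_left[symmetric] power_mult_distrib)
  qed
  have "16 * k / m * (\<Sum>i<r. N i * (u i)\<^sup>2) = 64 * k / m * ((\<Sum>i<r. (p i)\<^sup>2) / 4)"
    using N by (simp add: p_def power_mult_distrib less_imp_le)
  also have "\<dots> \<le> 64 * k / m * kz.energy xs p"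
    using good by (intro mult_left_mono) auto
  also have "\<dots> = length xs / m * lb * (\<Sum>i<r. (u i)\<^sup>2) + (\<Sum>j\<leftarrow>xs. (\<Sum>i<r. a j i * u i)\<^sup>2)"
  proof -
    have sh: "kz.shrink i * (p i)\<^sup>2 = lb * (u i)\<^sup>2 / (64 * k)" for i
    proof -
      have "(1 - M i) * N i = lb" using N[of i] by (simp add: M_def N_def field_simps)
      then show ?thesis
        using N[of i] by (simp add: kz.shrink_def p_def power_mult_distrib mult.assoc[symmetric])
    qed
    have "(\<Sum>i<r. kz.shrink i * (p i)\<^sup>2) = lb * (\<Sum>i<r. (u i)\<^sup>2) / (64 * k)"
      unfolding sh by (simp add: sum_distrib_left sum_divide_distrib)
    moreover have "(\<Sum>j\<leftarrow>xs. (\<Sum>i<r. v j i * p i)\<^sup>2) = m / (64 * k) * (\<Sum>j\<leftarrow>xs. (\<Sum>i<r. a j i * u i)\<^sup>2)"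
      unfolding vp by (rule sum_list_const_mult)
    ultimately show ?thesis
      using k_pos m_pos' unfolding kz.energy_def by (simp add: field_simps)
  qed
  finally have 1: "16 * k / m * (\<Sum>i<r. N i * (u i)\<^sup>2)
    \<le> length xs / m * lb * (\<Sum>i<r. (u i)\<^sup>2) + (\<Sum>j\<leftarrow>xs. (\<Sum>i<r. a j i * u i)\<^sup>2)" .
  have "(\<Sum>i<r. a j i * u i)\<^sup>2 = (\<Sum>i<r. (sqrt (M i) * W j i) * p i)\<^sup>2"
    by (intro arg_cong[of _ _ "\<lambda>x. x\<^sup>2"] sum.cong refl) (simp add: a_def p_def sM[symmetric])
  also have "\<dots> \<le> (\<Sum>i<r. (sqrt (M i) * W j i)\<^sup>2) * (\<Sum>i<r. (p i)\<^sup>2)"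
    by (rule Cauchy_Schwarz_ineq_sum)
  also have "\<dots> = (\<Sum>i<r. M i * (W j i)\<^sup>2) * (\<Sum>i<r. N i * (u i)\<^sup>2)"
    using N M_bounds by (simp add: p_def power_mult_distrib less_imp_le)
  also have "\<dots> \<le> 8 * k / m * (\<Sum>i<r. N i * (u i)\<^sup>2)"
    using lev[OF j] N by (intro mult_right_mono sum_nonneg) (auto simp: M_def less_imp_le)
  finally show ?thesis using 1 by simp
qed

text \<open>With the right \<open>h\<close> the bias is \<open>(1 - M) c\<close> and the fluctuation
  costs at most \<open>M (1 - M) c^2\<close> per coordinate, which together leave exactly
  \<open>M c^2\<close>.\<close>

lemma iid_avg_second_half:
  assumes xs: "set xs \<subseteq> {..<m}" and good: "\<And>p. (\<Sum>i<r. (p i)\<^sup>2) / 4 \<le> kz.energy xs p"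
    and cnt: "\<And>j. j < m \<Longrightarrow> count_list xs j \<le> length xs / (2 * k)"
    and len: "0 < length xs" "length xs \<le> s" "8 * k \<le> s" "s \<le> m"
  shows "(\<Sum>i<r. M i * (c i)\<^sup>2) \<le> iid_avg m s (\<lambda>ys. value_of c (set (xs @ ys)))"
proof -
  define \<mu> where "\<mu> = length xs / m * lb"
  define N where "N i = (\<sigma> i)\<^sup>2 + lb" for i
  \<comment> \<open>Makes the expected combination of second-half rows equal to
    \<open>M i * c i\<close>, the ridge fit of \<open>c\<close> on all rows.\<close>
  define h where "h i = m / s * (c i / N i)" for i
  have N: "0 < N i" for i using denom_pos by (simp add: N_def)
  have s: "0 < s" using len(1,2) by linarith
  have \<mu>: "0 < \<mu>" using len lb_pos m_pos' by (simp add: \<mu>_def)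
  have cnt': "2 * l * count_list xs j \<le> \<mu>" if "j < m" for j
  proof -
    have "2 * l * count_list xs j \<le> 2 * (k / m * lb) * (length xs / (2 * k))"
      using l_le cnt[OF that] l_nonneg' lb_pos by (intro mult_mono) auto
    also have "\<dots> = \<mu>" using k_pos by (simp add: \<mu>_def)
    finally show ?thesis .
  qed
  have mean: "(\<Sum>j<m. a j i * (\<Sum>p<r. a j p * h p)) = (\<sigma> i)\<^sup>2 * h i" if i: "i < r" for i
  proof -
    have "(\<Sum>j<m. a j i * (\<Sum>p<r. a j p * h p)) = (\<Sum>j<m. \<Sum>p<r. (W j i * W j p) * (\<sigma> i * \<sigma> p * h p))"
      by (simp add: a_def sum_distrib_left mult_ac)
    also have "\<dots> = (\<Sum>p<r. of_bool (i = p) * (\<sigma> i * \<sigma> p * h p))"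
      using i by (subst sum.swap) (simp add: orth sum_distrib_right[symmetric])
    also have "\<dots> = (\<sigma> i)\<^sup>2 * h i"
      using i by (subst sum.remove[of _ i]) (auto simp: power2_eq_square)
    finally show ?thesis .
  qed
  have var: "(\<Sum>j<m. (\<Sum>p<r. a j p * h p)\<^sup>2) = (\<Sum>i<r. (\<sigma> i * h i)\<^sup>2)"
    using sum_W_sq[where t = "\<lambda>i. \<sigma> i * h i"] by (simp add: a_def mult_ac)
  have shift: "s * ((\<sigma> i)\<^sup>2 * h i / m) = M i * c i" for i
    using s m_pos' by (simp add: h_def M_def N_def)
  have coef: "(\<mu> / 2 + 4 * l) * (s / m) * (\<sigma> i * h i)\<^sup>2 \<le> M i * (1 - M i) * (c i)\<^sup>2" for i
  proof -
    \<comment> \<open>Half of the budget \<open>s / m * lb\<close> goes to \<open>\<mu> / 2\<close>,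
      by \<open>length xs \<le> s\<close>; the other half to \<open>4 * l\<close>, by
      \<open>l \<le> k / m * lb\<close> and \<open>8 * k \<le> s\<close>.\<close>
    have "\<mu> / 2 + 4 * l \<le> s / m * lb / 2 + 4 * (s / 8 / m * lb)"
    proof (intro add_mono mult_left_mono)
      show "\<mu> / 2 \<le> s / m * lb / 2"
        using len lb_pos by (simp add: \<mu>_def divide_right_mono mult_right_mono)
      have "k / m * lb \<le> s / 8 / m * lb"
        using len lb_pos by (intro mult_right_mono divide_right_mono) auto
      then show "l \<le> s / 8 / m * lb" using l_le by linarith
    qed auto
    also have "\<dots> = s / m * lb" by simp
    finally have "(\<mu> / 2 + 4 * l) * ((s / m) * (\<sigma> i * h i)\<^sup>2) \<le> (s / m * lb) * ((s / m) * (\<sigma> i * h i)\<^sup>2)"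
      by (rule mult_right_mono) auto
    also have "\<dots> = M i * (1 - M i) * (c i)\<^sup>2"
    proof -
      have "1 - M i = lb / N i" using N[of i] by (simp add: M_def N_def field_simps)
      moreover have "M i = (\<sigma> i)\<^sup>2 / N i" by (simp add: M_def N_def)
      moreover have "(s / m * lb) * ((s / m) * (\<sigma> i * h i)\<^sup>2)
          = ((s / m) * (m / s))\<^sup>2 * ((\<sigma> i)\<^sup>2 / N i * (lb / N i) * (c i)\<^sup>2)"
        by (simp add: h_def power_mult_distrib power2_eq_square)
      ultimately show ?thesis
        using s m_pos' by simp
    qed
    finally show ?thesis by (simp add: mult.assoc)
  qed
  \<comment> \<open>The identity \<open>1 - (1 - M)^2 - M (1 - M) = M\<close> in each
    coordinate.\<close>
  have "(\<Sum>i<r. M i * (c i)\<^sup>2)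
      = (\<Sum>i<r. (c i)\<^sup>2 - (c i - M i * c i)\<^sup>2 - M i * (1 - M i) * (c i)\<^sup>2)"
    by (intro sum.cong refl) (simp add: power2_eq_square algebra_simps)
  also have "\<dots> \<le> (\<Sum>i<r. (c i)\<^sup>2 - (c i - M i * c i)\<^sup>2 - (\<mu> / 2 + 4 * l) * (s / m) * (\<sigma> i * h i)\<^sup>2)"
    using coef by (intro sum_mono) simp
  also have "\<dots> = (\<Sum>i<r. (c i)\<^sup>2) - (\<Sum>i<r. (c i - M i * c i)\<^sup>2)
      - (\<mu> / 2 + 4 * l) * (s / m) * (\<Sum>i<r. (\<sigma> i * h i)\<^sup>2)"
    by (simp add: sum_subtractf sum_distrib_left)
  also have "(\<Sum>i<r. (c i - M i * c i)\<^sup>2)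
      = (\<Sum>i<r. (c i - s * ((\<Sum>j<m. a j i * (\<Sum>p<r. a j p * h p)) / m))\<^sup>2)"
    by (intro sum.cong refl) (simp only: lessThan_iff mean shift)
  also have "(\<Sum>i<r. (\<sigma> i * h i)\<^sup>2) = (\<Sum>j<m. (\<Sum>p<r. a j p * h p)\<^sup>2)"
    by (simp only: var)
  also have "(\<Sum>i<r. (c i)\<^sup>2) - (\<Sum>i<r. (c i - s * ((\<Sum>j<m. a j i * (\<Sum>p<r. a j p * h p)) / m))\<^sup>2)
      - (\<mu> / 2 + 4 * l) * (s / m) * (\<Sum>j<m. (\<Sum>p<r. a j p * h p)\<^sup>2)
    \<le> iid_avg m s (\<lambda>ys. value_of c (set (xs @ ys)))"
    using sampled_form_ge[OF good] unfolding \<mu>_def[symmetric]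
    by (intro iid_avg_value_of_ge xs \<mu> cnt' len) auto
  finally show ?thesis .
qed

text \<open>Each failure gets probability 1/4. The 16 in the logarithm turns
  \<open>4 r exp (- s / (64 k))\<close> into at most \<open>4 m / (16 m)\<close>; the multiplicities
  are handled by an exponential moment and a union bound over rows.\<close>

lemma prob_first_half_bad:
  assumes s: "64 * real k * ln (16 * real m) \<le> s" "s \<le> m"
  shows "iid_avg m s (\<lambda>xs. of_bool (\<exists>p. kz.energy xs p < (\<Sum>i<r. (p i)\<^sup>2) / 4)) \<le> 1 / 4"
    and "iid_avg m s (\<lambda>xs. of_bool (\<exists>j<m. s / (2 * k) < count_list xs j)) \<le> 1 / 4"
proof -
  have m1: "1 \<le> real m" using m_pos' by simp
  have k1: "0 < real k" using k_pos by simp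
  have "exp (- real s / (64 * k)) \<le> exp (- ln (16 * real m))"
    using s k1 by (simp add: field_simps)
  also have "\<dots> = 1 / (16 * real m)" using m_pos' by (simp add: exp_minus field_simps)
  finally have "4 * real r * exp (- real s / (64 * k)) \<le> 4 * m * (1 / (16 * real m))"
    using r_le by (intro mult_mono) auto
  also have "\<dots> = 1 / 4" using m_pos' by simp
  finally show "iid_avg m s (\<lambda>xs. of_bool (\<exists>p. kz.energy xs p < (\<Sum>i<r. (p i)\<^sup>2) / 4)) \<le> 1 / 4"
    using kz.prob_energy_small[of s] by simp
  have each: "iid_avg m s (\<lambda>xs. of_bool (s / (2 * k) < count_list xs j)) \<le> 1 / (4 * real m)" if j: "j < m" for j
  proof -
    have "iid_avg m s (\<lambda>xs. of_bool (s / (2 * k) < count_list xs j))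
      \<le> iid_avg m s (\<lambda>xs. exp (real (count_list xs j))) / exp (s / (2 * k))"
      by (rule iid_avg_markov[OF m_pos']) auto
    also have "\<dots> \<le> exp 2 / exp (s / (2 * k))"
      by (intro divide_right_mono iid_avg_exp_count_le j s) auto
    also have "\<dots> = exp (2 - s / (2 * k))" by (simp add: exp_diff)
    also have "\<dots> \<le> exp (- ln (4 * real m))"
    proof -
      have "ln (16 * real m) = ln 4 + ln (4 * real m)" using m_pos' by (simp add: ln_mult_pos[symmetric])
      moreover have "0 \<le> ln (4 * real m)" using m1 by (intro ln_ge_zero) auto
      moreover have "1 \<le> ln (4 :: real)" using exp_le by (subst ln_ge_iff) auto
      ultimately have "2 + ln (4 * real m) \<le> 32 * ln (16 * real m)" by linarith
      also have "\<dots> \<le> s / (2 * k)" using s(1) k1 by (simp add: field_simps)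
      finally show ?thesis by simp
    qed
    also have "\<dots> = 1 / (4 * real m)" using m_pos' by (simp add: exp_minus field_simps)
    finally show ?thesis .
  qed
  have "iid_avg m s (\<lambda>xs. of_bool (\<exists>j<m. s / (2 * k) < count_list xs j))
      \<le> iid_avg m s (\<lambda>xs. \<Sum>j<m. of_bool (s / (2 * k) < count_list xs j))"
  proof (rule iid_avg_mono)
    fix xs :: "nat list"
    show "of_bool (\<exists>j<m. s / (2 * k) < count_list xs j) \<le> (\<Sum>j<m. of_bool (s / (2 * k) < count_list xs j) :: real)"
    proof (cases "\<exists>j<m. s / (2 * k) < count_list xs j")
      case True
      then obtain j where "j < m" "s / (2 * k) < count_list xs j" by auto
      then show ?thesis
        using member_le_sum[of j "{..<m}" "\<lambda>j. of_bool (s / (2 * k) < count_list xs j) :: real"] by auto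
    qed (simp add: sum_nonneg)
  qed
  also have "\<dots> \<le> (\<Sum>j<m. 1 / (4 * real m))"
    unfolding iid_avg_sum[of m s "\<lambda>j xs. of_bool (s / (2 * k) < count_list xs j)"]
    by (intro sum_mono each) auto
  also have "\<dots> = 1 / 4" using m_pos' by simp
  finally show "iid_avg m s (\<lambda>xs. of_bool (\<exists>j<m. s / (2 * k) < count_list xs j)) \<le> 1 / 4" .
qed

text \<open>A bad first half contributes at least 0 and a good one at least the full form, so the
  total failure probability 1/2 costs a factor 2.\<close>

lemma subset_avg_value_of_ge:
  assumes s: "200 * real k * ln (16 * real m) \<le> s" "s \<le> m"
  shows "(\<Sum>i<r. M i * (c i)\<^sup>2) / 2 \<le> subset_avg m s (value_of c)"
proof -
  \<comment> \<open>Rounding down gives \<open>s1 \<le> s2\<close>, which the second half needs. The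
    surplus of 200 over \<open>2 * 64\<close> pays for the rounding.\<close>
  define s1 where "s1 = s div 2"
  define s2 where "s2 = s - s1"
  have sum: "s = s1 + s2" by (simp add: s1_def s2_def)
  have k1: "1 \<le> real k" using k_pos by simp
  have "1 \<le> real m" using m_pos' by simp
  then have "ln 4 \<le> ln (16 * real m)" by (subst ln_le_cancel_iff) auto
  moreover have "1 \<le> ln (4 :: real)" using exp_le by (subst ln_ge_iff) auto
  ultimately have L: "1 \<le> ln (16 * real m)" by linarith
  then have kL: "real k \<le> real k * ln (16 * real m)" using mult_left_mono[OF L, of "real k"] by simp
  have s1: "real s - 1 \<le> 2 * real s1" unfolding s1_def by linarith
  have len: "64 * real k * ln (16 * real m) \<le> s1" "8 * k \<le> s2" "s1 \<le> s2" "s1 \<le> m" "s2 \<le> m" "0 < s1"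
  proof -
    show A: "64 * real k * ln (16 * real m) \<le> s1" using s(1) s1 kL k1 by linarith
    show "s1 \<le> s2" "s1 \<le> m" "s2 \<le> m" using s(2) unfolding s1_def s2_def by linarith+
    then show "8 * k \<le> s2" "0 < s1" using A kL k1 by linarith+
  qed
  define T where "T = (\<Sum>i<r. M i * (c i)\<^sup>2)"
  have T: "0 \<le> T" unfolding T_def using M_bounds by (intro sum_nonneg) auto
  define B1 where "B1 xs \<longleftrightarrow> (\<exists>p. kz.energy xs p < (\<Sum>i<r. (p i)\<^sup>2) / 4)" for xs
  define B2 where "B2 xs \<longleftrightarrow> (\<exists>j<m. s1 / (2 * k) < count_list xs j)" for xs
  have "T / 2 \<le> T * (1 + (-1) * (iid_avg m s1 (\<lambda>xs. of_bool (B1 xs)) + iid_avg m s1 (\<lambda>xs. of_bool (B2 xs))))"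
  proof -
    define b1 where "b1 = iid_avg m s1 (\<lambda>xs. of_bool (B1 xs))"
    define b2 where "b2 = iid_avg m s1 (\<lambda>xs. of_bool (B2 xs))"
    have "b1 \<le> 1 / 4" "b2 \<le> 1 / 4"
      using prob_first_half_bad[OF len(1,4)] unfolding b1_def b2_def B1_def B2_def by blast+
    then have "1 / 2 \<le> 1 + (-1) * (b1 + b2)" by simp
    from mult_left_mono[OF this T] show ?thesis unfolding b1_def b2_def by simp
  qed
  also have "\<dots> = iid_avg m s1 (\<lambda>xs. T * (1 + (-1) * (of_bool (B1 xs) + of_bool (B2 xs))))"
    unfolding iid_avg_cmult iid_avg_add iid_avg_const[OF m_pos'] by (rule refl)
  also have "\<dots> \<le> iid_avg m s1 (\<lambda>xs. iid_avg m s2 (\<lambda>ys. value_of c (set (xs @ ys))))"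
  proof (rule iid_avg_mono)
    fix xs :: "nat list" assume xs: "set xs \<subseteq> {..<m}" "length xs = s1"
    have nn: "0 \<le> iid_avg m s2 (\<lambda>ys. value_of c (set (xs @ ys)))"
    proof -
      have "iid_avg m s2 (\<lambda>_. 0) \<le> iid_avg m s2 (\<lambda>ys. value_of c (set (xs @ ys)))"
        by (intro iid_avg_mono value_of_nonneg)
      then show ?thesis unfolding iid_avg_const[OF m_pos'] .
    qed
    show "T * (1 + (-1) * (of_bool (B1 xs) + of_bool (B2 xs)))
      \<le> iid_avg m s2 (\<lambda>ys. value_of c (set (xs @ ys)))"
    proof (cases "B1 xs \<or> B2 xs")
      case True
      then have "T * (1 + (-1) * (of_bool (B1 xs) + of_bool (B2 xs))) \<le> 0"
        using T by (auto simp: mult_le_0_iff)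
      with nn show ?thesis by linarith
    next
      case False
      then have "T \<le> iid_avg m s2 (\<lambda>ys. value_of c (set (xs @ ys)))"
        unfolding T_def
      proof (intro iid_avg_second_half)
        fix j p
        show "(\<Sum>i<r. (p i)\<^sup>2) / 4 \<le> kz.energy xs p"
          using False unfolding B1_def by (meson not_less)
        assume "j < m"
        then show "count_list xs j \<le> length xs / (2 * k)"
          using False xs unfolding B2_def by (meson not_less)
      qed (use xs len in auto)
      with False show ?thesis by simp
    qed
  qed
  also have "\<dots> = iid_avg m s (\<lambda>xs. value_of c (set xs))"
    unfolding sum iid_avg_append by simp
  also have "\<dots> \<le> subset_avg m s (value_of c)"
    using s(2) by (intro iid_avg_le_subset_avg value_of_mono)
  finally show ?thesis by (simp add: T_def)
qed

end

section \<open>Leverage scores after the randomized Hadamard transform\<close>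

abbreviation gaussian :: "real measure" where
  "gaussian \<equiv> density lborel std_normal_density"

lemma nn_integral_normal_density: "0 < s \<Longrightarrow> (\<integral>\<^sup>+x. normal_density \<mu> s x \<partial>lborel) = 1"
  by (simp add: nn_integral_eq_integral)

lemma nn_integral_gaussian:
  assumes [measurable]: "f \<in> borel_measurable borel" and "\<And>x. 0 \<le> f x"
  shows "(\<integral>\<^sup>+x. ennreal (f x) \<partial>gaussian) = (\<integral>\<^sup>+x. ennreal (std_normal_density x * f x) \<partial>lborel)"
  using assms by (simp add: nn_integral_density ennreal_mult)

lemma nn_integral_gaussian_exp: "(\<integral>\<^sup>+x. exp (a * x) \<partial>gaussian) = exp (a\<^sup>2 / 2)"
proof -
  have "std_normal_density x * exp (a * x) = exp (a\<^sup>2 / 2) * normal_density a 1 x" for x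
  proof -
    have "- x\<^sup>2 / 2 + a * x = a\<^sup>2 / 2 + - (x - a)\<^sup>2 / 2"
      by (simp add: power2_eq_square field_simps)
    then have "exp (- x\<^sup>2 / 2) * exp (a * x) = exp (a\<^sup>2 / 2) * exp (- (x - a)\<^sup>2 / 2)"
      unfolding exp_add[symmetric] by simp
    then show ?thesis by (simp add: normal_density_def)
  qed
  then show ?thesis
    by (simp add: nn_integral_gaussian ennreal_mult nn_integral_cmult nn_integral_normal_density)
qed

text \<open>The tilted density is a multiple of the normal density of variance
  \<open>1 / (1 - 2 * b)\<close>.\<close>

lemma nn_integral_gaussian_exp_square:
  assumes "b < 1 / 2"
  shows "(\<integral>\<^sup>+x. exp (b * x\<^sup>2) \<partial>gaussian) = ennreal (1 / sqrt (1 - 2 * b))"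
proof -
  define s where "s = 1 / sqrt (1 - 2 * b)"
  have s: "0 < s" using assms by (simp add: s_def)
  have s2: "1 / s\<^sup>2 = 1 - 2 * b" using assms by (simp add: s_def power_divide)
  have "std_normal_density x * exp (b * x\<^sup>2) = s * normal_density 0 s x" for x
  proof -
    have "- x\<^sup>2 / 2 + b * x\<^sup>2 = - x\<^sup>2 * (1 / s\<^sup>2) / 2"
      unfolding s2 by (simp add: algebra_simps)
    then have "- x\<^sup>2 / 2 + b * x\<^sup>2 = - x\<^sup>2 / (2 * s\<^sup>2)" by simp
    then have "exp (- x\<^sup>2 / 2) * exp (b * x\<^sup>2) = exp (- x\<^sup>2 / (2 * s\<^sup>2))"
      unfolding exp_add[symmetric] by simp
    then show ?thesis using s by (simp add: normal_density_def real_sqrt_mult)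
  qed
  then show ?thesis using s
    by (simp add: nn_integral_gaussian ennreal_mult nn_integral_cmult nn_integral_normal_density s_def[symmetric])
qed

lemma cosh_le_exp_square: "cosh x \<le> exp (x\<^sup>2 / 2)" for x :: real
proof -
  have "cosh y \<le> exp (y\<^sup>2 / 2)" if "0 \<le> y" for y :: real
  proof -
    have pos: "0 < 1 + (exp (2 * y) - 1) / 2" by (simp add: add_pos_pos field_simps)
    \<comment> \<open>Hoeffding's estimate for a fair coin, with interval length
      \<open>2 * y\<close>.\<close>
    have "- y + ln (1 + (exp (2 * y) - 1) / 2) \<le> y\<^sup>2 / 2"
      using Hoeffdings_lemma_aux[of "2 * y" "1 / 2"] that by (simp add: power_mult_distrib)
    then have "exp (- y + ln (1 + (exp (2 * y) - 1) / 2)) \<le> exp (y\<^sup>2 / 2)" by simp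
    moreover have "exp (- y + ln (1 + (exp (2 * y) - 1) / 2)) = exp (- y) * (1 + (exp (2 * y) - 1) / 2)"
      using pos by (simp only: exp_add exp_ln)
    moreover have "exp (- y) * (1 + (exp (2 * y) - 1) / 2) = cosh y"
    proof -
      have "exp (- y) * exp (2 * y) = exp y" by (simp add: exp_add[symmetric])
      then show ?thesis by (simp add: cosh_def field_simps)
    qed
    ultimately show ?thesis by metis
  qed
  from this[of "\<bar>x\<bar>"] show ?thesis by (cases "x < 0") auto
qed

text \<open>Linearize the squares by \<open>exp (\<alpha>\<^sup>2 t\<^sup>2 / 2) = E exp (\<alpha> t g)\<close> for a standard Gaussian \<open>g\<close>.\<close>

lemma exp_moment_by_gaussian:
  fixes P :: "'a pmf" and t :: "nat \<Rightarrow> 'a \<Rightarrow> real" and M :: "nat \<Rightarrow> real"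
  assumes fin: "finite (set_pmf P)" and M: "\<And>i. i < r \<Longrightarrow> 0 \<le> M i \<and> M i \<le> 1"
    and sub: "\<And>g. (\<integral>\<^sup>+d. exp (\<Sum>i<r. sqrt (M i / 2) * g i * t i d) \<partial>P) \<le> exp (\<Sum>i<r. M i / 4 * (g i)\<^sup>2)"
  shows "(\<integral>\<^sup>+d. exp (\<Sum>i<r. M i / 4 * (t i d)\<^sup>2) \<partial>P) \<le> exp ((\<Sum>i<r. M i) / 2)"
proof -
  interpret product_sigma_finite "\<lambda>_::nat. gaussian"
    by (intro product_sigma_finite.intro prob_space_imp_sigma_finite prob_space_normal_density) simp
  let ?G = "PiM {..<r} (\<lambda>_. gaussian)"
  have lin: "ennreal (exp (\<Sum>i<r. M i / 4 * (t i d)\<^sup>2))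
      = (\<integral>\<^sup>+g. exp (\<Sum>i<r. sqrt (M i / 2) * g i * t i d) \<partial>?G)" for d
  proof -
    have "ennreal (exp (\<Sum>i<r. M i / 4 * (t i d)\<^sup>2)) = (\<Prod>i<r. ennreal (exp ((sqrt (M i / 2) * t i d)\<^sup>2 / 2)))"
      using M by (simp add: exp_sum prod_ennreal power_mult_distrib)
    also have "\<dots> = (\<Prod>i<r. \<integral>\<^sup>+x. exp (sqrt (M i / 2) * t i d * x) \<partial>gaussian)"
      by (simp only: nn_integral_gaussian_exp)
    also have "\<dots> = (\<integral>\<^sup>+g. (\<Prod>i<r. ennreal (exp (sqrt (M i / 2) * t i d * g i))) \<partial>?G)"
      by (rule product_nn_integral_prod[symmetric]) auto
    also have "\<dots> = (\<integral>\<^sup>+g. exp (\<Sum>i<r. sqrt (M i / 2) * g i * t i d) \<partial>?G)"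
      by (simp add: exp_sum prod_ennreal mult_ac)
    finally show ?thesis .
  qed
  have "(\<integral>\<^sup>+d. exp (\<Sum>i<r. M i / 4 * (t i d)\<^sup>2) \<partial>P)
      = (\<Sum>d\<in>set_pmf P. (\<integral>\<^sup>+g. exp (\<Sum>i<r. sqrt (M i / 2) * g i * t i d) \<partial>?G) * pmf P d)"
    \<comment> \<open>Finite support turns the outer integral into a finite sum, so the exchange
      with the Gaussian integral is plain additivity.\<close>
    unfolding lin by (rule nn_integral_measure_pmf_finite[OF fin]) simp
  also have "\<dots> = (\<integral>\<^sup>+g. (\<Sum>d\<in>set_pmf P. exp (\<Sum>i<r. sqrt (M i / 2) * g i * t i d) * ennreal (pmf P d)) \<partial>?G)"
    by (subst nn_integral_sum) (auto simp: nn_integral_multc)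
  also have "\<dots> = (\<integral>\<^sup>+g. (\<integral>\<^sup>+d. exp (\<Sum>i<r. sqrt (M i / 2) * g i * t i d) \<partial>P) \<partial>?G)"
    by (simp add: nn_integral_measure_pmf_finite[OF fin])
  also have "\<dots> \<le> (\<integral>\<^sup>+g. exp (\<Sum>i<r. M i / 4 * (g i)\<^sup>2) \<partial>?G)"
    by (intro nn_integral_mono sub)
  also have "\<dots> = (\<integral>\<^sup>+g. (\<Prod>i<r. ennreal (exp (M i / 4 * (g i)\<^sup>2))) \<partial>?G)"
    by (simp add: exp_sum prod_ennreal)
  also have "\<dots> = (\<Prod>i<r. \<integral>\<^sup>+x. exp (M i / 4 * x\<^sup>2) \<partial>gaussian)"
    by (rule product_nn_integral_prod) auto
  also have "\<dots> \<le> (\<Prod>i<r. ennreal (exp (M i / 2)))"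
  proof (rule prod_mono_ennreal)
    fix i assume "i \<in> {..<r}"
    then have Mi: "0 \<le> M i" "M i \<le> 1" using M by auto
    \<comment> \<open>The Gaussian integral is \<open>(1 - M i / 2)^(-1/2)\<close>;
      \<open>M i \<le> 1\<close> bounds its square by \<open>1 + M i\<close>, hence by
      \<open>exp (M i)\<close>.\<close>
    have "(1 + M i) * (1 - M i / 2) \<ge> 1"
      using Mi mult_left_mono[of "M i" 1 "M i"] by (simp add: algebra_simps)
    then have "1 / (1 - M i / 2) \<le> 1 + M i" using Mi by (simp add: field_simps)
    also have "\<dots> \<le> exp (M i)" by (rule exp_ge_add_one_self)
    also have "\<dots> = (exp (M i / 2))\<^sup>2" by (simp add: exp_double[symmetric])
    finally have "sqrt (1 / (1 - M i / 2)) \<le> exp (M i / 2)" by (intro real_le_lsqrt) auto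
    then have "1 / sqrt (1 - M i / 2) \<le> exp (M i / 2)" by (simp add: real_sqrt_divide)
    then show "(\<integral>\<^sup>+x. exp (M i / 4 * x\<^sup>2) \<partial>gaussian) \<le> ennreal (exp (M i / 2))"
      using Mi by (subst nn_integral_gaussian_exp_square) (auto intro!: ennreal_leI)
  qed
  also have "\<dots> = exp ((\<Sum>i<r. M i) / 2)"
    by (simp add: prod_ennreal exp_sum sum_divide_distrib)
  finally show ?thesis .
qed

section \<open>The tail of one ridge leverage score under random signs\<close>

definition sign_pmf :: "nat \<Rightarrow> (nat \<Rightarrow> real) pmf" where
  "sign_pmf m = Pi_pmf {..<m} 0 (\<lambda>_. pmf_of_set {1 / sqrt (real m), - 1 / sqrt (real m)})"

lemma finite_set_sign_pmf: "finite (set_pmf (sign_pmf m))"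
  unfolding sign_pmf_def by (subst set_Pi_pmf) (auto intro!: finite_PiE_dflt)

lemma set_sign_pmf: "d \<in> set_pmf (sign_pmf m) \<Longrightarrow> x < m \<Longrightarrow> d x = 1 / sqrt m \<or> d x = - 1 / sqrt m"
  unfolding sign_pmf_def by (subst (asm) set_Pi_pmf) (auto simp: PiE_dflt_def)

text \<open>On the event the exponent \<open>\<Sum> M i / 4 * t^2\<close> exceeds
  \<open>2 * k\<close>, while its exponential moment is at most
  \<open>exp (trace / 2) \<le> exp k\<close>. Markov's inequality leaves
  \<open>exp (- k)\<close>.\<close>

lemma prob_leverage_large:
  fixes b :: "nat \<Rightarrow> nat \<Rightarrow> real" and k :: real
  assumes m: "0 < m" and M: "\<And>i. i < r \<Longrightarrow> 0 \<le> M i \<and> M i \<le> 1" and trace: "(\<Sum>i<r. M i) \<le> 2 * k"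
    and orth: "\<And>i i'. i < r \<Longrightarrow> i' < r \<Longrightarrow> (\<Sum>x<m. b x i * b x i') = of_bool (i = i')"
  shows "measure_pmf.prob (sign_pmf m) {d. 8 * k / m < (\<Sum>i<r. M i * (\<Sum>x<m. b x i * d x)\<^sup>2)} \<le> exp (- k)"
proof -
  define t where "t i d = sqrt m * (\<Sum>x<m. b x i * d x)" for i and d :: "nat \<Rightarrow> real"
  have sub: "(\<integral>\<^sup>+d. exp (\<Sum>i<r. sqrt (M i / 2) * g i * t i d) \<partial>sign_pmf m) \<le> exp (\<Sum>i<r. M i / 4 * (g i)\<^sup>2)" for g
  proof -
    \<comment> \<open>After linearization the exponent is linear in the signs, so the mean is a
      product of \<open>cosh (y x)\<close>; orthonormality then evaluates the sum of the squares of
      \<open>y\<close>.\<close>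
    define y where "y x = (\<Sum>i<r. b x i * (sqrt (M i / 2) * g i))" for x
    have "(\<Sum>i<r. sqrt (M i / 2) * g i * t i d) = (\<Sum>x<m. sqrt m * y x * d x)" for d
      unfolding t_def y_def sum_distrib_left sum_distrib_right by (subst sum.swap) (simp add: mult_ac)
    then have "(\<integral>\<^sup>+d. exp (\<Sum>i<r. sqrt (M i / 2) * g i * t i d) \<partial>sign_pmf m)
        = (\<integral>\<^sup>+d. (\<Prod>x<m. ennreal (exp (sqrt m * y x * d x))) \<partial>sign_pmf m)"
      by (simp add: exp_sum prod_ennreal)
    also have "\<dots> = (\<Prod>x<m. \<integral>\<^sup>+e. exp (sqrt m * y x * e) \<partial>pmf_of_set {1 / sqrt (real m), - 1 / sqrt (real m)})"
      unfolding sign_pmf_def by (rule nn_integral_prod_Pi_pmf) simp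
    also have "\<dots> = (\<Prod>x<m. ennreal (cosh (y x)))"
    proof (rule prod.cong[OF refl])
      fix x
      have ne: "1 / sqrt (real m) \<noteq> - 1 / sqrt (real m)"
        using m by (simp add: field_simps)
      then show "(\<integral>\<^sup>+e. exp (sqrt m * y x * e) \<partial>pmf_of_set {1 / sqrt (real m), - 1 / sqrt (real m)}) = ennreal (cosh (y x))"
        using m by (subst nn_integral_pmf_of_set)
          (auto simp: cosh_def ennreal_plus[symmetric] divide_ennreal[symmetric] ennreal_numeral[symmetric]
            simp del: ennreal_plus ennreal_numeral)
    qed
    also have "\<dots> \<le> (\<Prod>x<m. ennreal (exp ((y x)\<^sup>2 / 2)))"
      by (intro prod_mono_ennreal ennreal_leI cosh_le_exp_square)
    also have "\<dots> = exp ((\<Sum>x<m. (y x)\<^sup>2) / 2)"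
      by (simp add: prod_ennreal exp_sum sum_divide_distrib)
    also have "(\<Sum>x<m. (y x)\<^sup>2) = (\<Sum>i<r. (sqrt (M i / 2) * g i)\<^sup>2)"
      unfolding y_def by (rule sum_square_orthonormal[OF orth])
    also have "\<dots> / 2 = (\<Sum>i<r. M i / 4 * (g i)\<^sup>2)"
      using M by (simp add: power_mult_distrib sum_divide_distrib)
    finally show ?thesis .
  qed
  have large: "exp (2 * k) \<le> exp (\<Sum>i<r. M i / 4 * (t i d)\<^sup>2)"
    if "8 * k / m < (\<Sum>i<r. M i * (\<Sum>x<m. b x i * d x)\<^sup>2)" for d
  proof -
    have "(\<Sum>i<r. M i / 4 * (t i d)\<^sup>2) = m / 4 * (\<Sum>i<r. M i * (\<Sum>x<m. b x i * d x)\<^sup>2)"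
      unfolding t_def power_mult_distrib by (simp add: sum_distrib_left mult_ac)
    moreover have "m / 4 * (8 * k / m) \<le> m / 4 * (\<Sum>i<r. M i * (\<Sum>x<m. b x i * d x)\<^sup>2)"
      using that by (intro mult_left_mono) auto
    ultimately show ?thesis using m by simp
  qed
  have "emeasure (sign_pmf m) {d. 8 * k / m < (\<Sum>i<r. M i * (\<Sum>x<m. b x i * d x)\<^sup>2)}
      \<le> emeasure (sign_pmf m) {d \<in> UNIV. 1 \<le> ennreal (exp (- 2 * k)) * ennreal (exp (\<Sum>i<r. M i / 4 * (t i d)\<^sup>2))}"
  proof (intro emeasure_mono subsetI)
    fix d assume "d \<in> {d. 8 * k / m < (\<Sum>i<r. M i * (\<Sum>x<m. b x i * d x)\<^sup>2)}"
    then have "exp (- 2 * k) * exp (2 * k) \<le> exp (- 2 * k) * exp (\<Sum>i<r. M i / 4 * (t i d)\<^sup>2)"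
      using large[of d] by (intro mult_left_mono) auto
    then have "1 \<le> exp (- 2 * k) * exp (\<Sum>i<r. M i / 4 * (t i d)\<^sup>2)"
      by (simp add: exp_add[symmetric])
    then show "d \<in> {d \<in> UNIV. 1 \<le> ennreal (exp (- 2 * k)) * ennreal (exp (\<Sum>i<r. M i / 4 * (t i d)\<^sup>2))}"
      by (simp add: ennreal_mult[symmetric])
  qed simp
  also have "\<dots> \<le> ennreal (exp (- 2 * k)) * (\<integral>\<^sup>+d. ennreal (exp (\<Sum>i<r. M i / 4 * (t i d)\<^sup>2)) * indicator UNIV d \<partial>sign_pmf m)"
    by (rule nn_integral_Markov_inequality) auto
  also have "\<dots> \<le> ennreal (exp (- 2 * k)) * ennreal (exp ((\<Sum>i<r. M i) / 2))"
    using exp_moment_by_gaussian[OF finite_set_sign_pmf M sub] by (intro mult_left_mono) auto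
  also have "\<dots> \<le> ennreal (exp (- k))"
    using trace by (auto simp: ennreal_mult[symmetric] exp_add[symmetric] intro!: ennreal_leI)
  finally show ?thesis
    by (simp add: measure_pmf.emeasure_eq_measure)
qed

unbundle no inner_syntax


section \<open>Moore--Penrose inverses\<close>

lemma mult_assoc_dim:
  "dim_col A = dim_row B \<Longrightarrow> dim_col B = dim_row C \<Longrightarrow> A * B * C = A * (B * (C :: 'a :: semiring_0 mat))"
  by (rule assoc_mult_mat) auto

lemma transpose_mult_dim:
  "dim_col A = dim_row B \<Longrightarrow> transpose_mat (A * B) = transpose_mat B * transpose_mat (A :: 'a :: comm_semiring_0 mat)"
  by (rule transpose_mult) auto

text \<open>For the echelon form \<open>C = P A\<close>, let \<open>G\<close> place coordinate
  \<open>i\<close> at the pivot column of row \<open>i\<close>. Then \<open>C G\<close> is the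
  identity on the nonzero rows, so \<open>C G C = C\<close>, and \<open>G P\<close> serves for
  \<open>A\<close>.\<close>

lemma inner_inverse_exists:
  fixes A :: "'a :: field mat"
  assumes A: "A \<in> carrier_mat nr nc"
  shows "\<exists>G \<in> carrier_mat nc nr. A * G * A = A"
proof -
  obtain C where C: "gauss_jordan_single A = C" by simp
  from gauss_jordan_single[OF A C] obtain P Q f where
    Cc: "C \<in> carrier_mat nr nc" and f: "pivot_fun C f nc" and
    PQ: "C = P * A" "P \<in> carrier_mat nr nr" "Q \<in> carrier_mat nr nr" "Q * P = 1\<^sub>m nr"
    unfolding row_echelon_form_def by auto
  have dC: "dim_row C = nr" using Cc by simp
  note piv = pivot_funD[OF dC f]
  define G where "G = mat nc nr (\<lambda>(j, i). if j = f i then 1 else (0 :: 'a))"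
  have G: "G \<in> carrier_mat nc nr" by (simp add: G_def)
  have CG: "(C * G) $$ (i, i') = (if i = i' \<and> f i < nc then 1 else 0)" if i: "i < nr" "i' < nr" for i i'
  proof -
    have "(C * G) $$ (i, i') = (\<Sum>j<nc. C $$ (i, j) * (if j = f i' then 1 else 0))"
      using Cc i by (simp add: G_def scalar_prod_def atLeast0LessThan)
    also have "\<dots> = (if f i' < nc then C $$ (i, f i') else 0)"
      by (simp add: if_distrib[of "\<lambda>x. _ * x"] cong: if_cong)
    also have "\<dots> = (if i = i' \<and> f i < nc then 1 else 0)"
      using piv(4,5) i by auto
    finally show ?thesis .
  qed
  have "C * G * C = C"
  proof (rule eq_matI)
    fix i j assume "i < dim_row C" "j < dim_col C"
    then have i: "i < nr" and j: "j < nc" using Cc by auto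
    have "(C * G * C) $$ (i, j) = (\<Sum>i'<nr. (C * G) $$ (i, i') * C $$ (i', j))"
      using Cc G i j
      by (simp add: scalar_prod_def atLeast0LessThan index_mult_mat(1)[of i "C * G" j C] del: assoc_mult_mat)
    also have "\<dots> = (\<Sum>i'<nr. (if i = i' then (if f i < nc then C $$ (i, j) else 0) else 0))"
      by (intro sum.cong refl) (auto simp: CG i)
    also have "\<dots> = (if f i < nc then C $$ (i, j) else 0)" using i by simp
    \<comment> \<open>A row without pivot has \<open>f i = nc\<close>, so all its entries lie before
      the pivot and vanish.\<close>
    also have "\<dots> = C $$ (i, j)" using piv(1)[OF i] piv(2)[OF i, of j] j by (cases "f i < nc") auto
    finally show "(C * G * C) $$ (i, j) = C $$ (i, j)" .
  qed (use Cc G in auto)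
  then have "Q * (C * G * C) = Q * C" by simp
  moreover have QC: "Q * C = A"
  proof -
    have "Q * C = Q * P * A" unfolding PQ(1) using PQ(2,3) A by (simp add: mult_assoc_dim)
    then show ?thesis unfolding PQ(4) using A by simp
  qed
  moreover have "Q * (C * G * C) = A * (G * P) * A"
  proof -
    have "Q * (C * G * C) = (Q * C) * (G * C)" using Cc G PQ(3) by (simp add: mult_assoc_dim)
    also have "\<dots> = A * (G * P) * A" unfolding QC unfolding PQ(1) using A G PQ(2) by (simp add: mult_assoc_dim)
    finally show ?thesis .
  qed
  ultimately show ?thesis using G PQ(2) by (intro bexI[of _ "G * P"]) auto
qed

lemma scalar_prod_ge_0_real: "0 \<le> v \<bullet> (v :: real vec)"
  by (simp add: scalar_prod_def sum_nonneg)

lemma scalar_prod_eq_0_real: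
  fixes v :: "real vec"
  assumes "v \<in> carrier_vec n" "v \<bullet> v = 0"
  shows "v = 0\<^sub>v n"
proof (rule eq_vecI)
  fix i assume "i < dim_vec (0\<^sub>v n)"
  then have i: "i < n" by simp
  have "(\<Sum>i\<in>{0..<n}. v $ i * v $ i) = 0"
    using assms by (simp add: scalar_prod_def)
  then have "\<forall>i\<in>{0..<n}. v $ i * v $ i = 0"
    by (subst (asm) sum_nonneg_eq_0_iff) auto
  then show "v $ i = 0\<^sub>v n $ i" using i by auto
qed (use assms in auto)

lemma mult_transpose_self_eq_0:
  fixes A :: "real mat"
  assumes A: "A \<in> carrier_mat nr nc" and 0: "A * transpose_mat A = 0\<^sub>m nr nr"
  shows "A = 0\<^sub>m nr nc"
proof (rule eq_matI)
  fix i j assume "i < dim_row (0\<^sub>m nr nc :: real mat)" "j < dim_col (0\<^sub>m nr nc :: real mat)"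
  then have i: "i < nr" and j: "j < nc" by auto
  have "row A i \<bullet> row A i = (A * transpose_mat A) $$ (i, i)" using A i by simp
  then have "row A i = 0\<^sub>v nc" using A i 0 by (intro scalar_prod_eq_0_real) auto
  then have "row A i $ j = 0" using j by simp
  then show "A $$ (i, j) = 0\<^sub>m nr nc $$ (i, j)" using A i j by simp
qed (use A in auto)

text \<open>Cancels \<open>A^T\<close> on the right: for \<open>B = A A^T G - I\<close> the
  hypothesis reads \<open>B A A^T = 0\<close>, so \<open>B A\<close> has zero Gram matrix and
  vanishes.\<close>

lemma inner_inverse_gram:
  fixes A :: "real mat"
  assumes A: "A \<in> carrier_mat nr nc" and G: "G \<in> carrier_mat nr nr"
    and GI: "(A * transpose_mat A) * G * (A * transpose_mat A) = A * transpose_mat A"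
  shows "A * (transpose_mat A * (G * A)) = A"
proof -
  let ?T = "transpose_mat A"
  define B where "B = A * (?T * G) - 1\<^sub>m nr"
  have At: "?T \<in> carrier_mat nc nr" using A by simp
  have B: "B \<in> carrier_mat nr nr" unfolding B_def using A G by auto
  have BA: "B * A = A * (?T * (G * A)) - A"
    unfolding B_def using A G At by (subst minus_mult_distrib_mat[of _ nr nr]) (auto simp: mult_assoc_dim)
  have "B * A * ?T = A * (?T * (G * (A * ?T))) - A * ?T"
    unfolding BA using A G At by (subst minus_mult_distrib_mat[of _ nr nc]) (auto simp: mult_assoc_dim)
  also have "A * (?T * (G * (A * ?T))) = A * ?T" using GI A G At by (simp add: mult_assoc_dim)
  finally have "B * A * ?T = 0\<^sub>m nr nr" using A by auto
  then have "B * A * transpose_mat (B * A) = 0\<^sub>m nr nr"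
  proof -
    have "B * A * transpose_mat (B * A) = B * A * ?T * transpose_mat B"
      using A B by (simp add: mult_assoc_dim transpose_mult_dim)
    then show ?thesis using \<open>B * A * ?T = 0\<^sub>m nr nr\<close> B by simp
  qed
  from mult_transpose_self_eq_0[OF _ this] have BA0: "B * A = 0\<^sub>m nr nc" using A B by simp
  show ?thesis
  proof (rule eq_matI)
    fix i j assume ij: "i < dim_row A" "j < dim_col A"
    have "(B * A) $$ (i, j) = 0" unfolding BA0 using ij A by simp
    then show "(A * (?T * (G * A))) $$ (i, j) = A $$ (i, j)"
      unfolding BA using ij A G by (simp del: index_mult_mat(1))
  qed (use A G in auto)
qed

text \<open>\<open>G\<close> itself may be nonsymmetric. The transpose of
  \<open>A A^T G A = A\<close> is \<open>A^T G^T A A^T = A^T\<close>; inserting it into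
  \<open>A^T G A\<close> yields \<open>A^T G^T A\<close>.\<close>

lemma gram_projection_symmetric:
  fixes A :: "real mat"
  assumes A: "A \<in> carrier_mat nr nc" and G: "G \<in> carrier_mat nr nr"
    and GI: "(A * transpose_mat A) * G * (A * transpose_mat A) = A * transpose_mat A"
  shows "transpose_mat (transpose_mat A * (G * A)) = transpose_mat A * (G * A)"
proof -
  let ?T = "transpose_mat A" and ?Gt = "transpose_mat G"
  have At: "?T \<in> carrier_mat nc nr" and Gt: "?Gt \<in> carrier_mat nr nr" using A G by auto
  have AG: "A * (?T * (G * A)) = A" by (rule inner_inverse_gram[OF A G GI])
  have tr: "transpose_mat (?T * (G * A)) = ?T * (?Gt * A)"
    using A G At Gt by (simp add: transpose_mult_dim mult_assoc_dim)
  have "?T = transpose_mat (A * (?T * (G * A)))" unfolding AG ..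
  also have "\<dots> = ?T * (?Gt * A) * ?T"
    using A G At Gt by (subst transpose_mult_dim) (auto simp: tr)
  finally have T: "?T = ?T * (?Gt * A) * ?T" .
  have "?T * (G * A) = ?T * (?Gt * A) * ?T * (G * A)" using T by simp
  also have "\<dots> = ?T * (?Gt * (A * (?T * (G * A))))"
    using A G At Gt by (simp add: mult_assoc_dim)
  also have "\<dots> = ?T * (?Gt * A)" unfolding AG ..
  finally show ?thesis using tr by simp
qed

lemma is_pinv_exists: "\<exists>X. is_pinv A X"
proof -
  define nr nc where "nr = dim_row A" and "nc = dim_col A"
  let ?T = "transpose_mat A"
  have A: "A \<in> carrier_mat nr nc" and At: "?T \<in> carrier_mat nc nr" by (auto simp: nr_def nc_def)
  obtain G where G: "G \<in> carrier_mat nr nr" "(A * ?T) * G * (A * ?T) = A * ?T"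
    using inner_inverse_exists[of "A * ?T" nr nr] A At by auto
  obtain H where H: "H \<in> carrier_mat nc nc" "(?T * A) * H * (?T * A) = ?T * A"
    using inner_inverse_exists[of "?T * A" nc nc] A At by auto
  have AG: "A * (?T * (G * A)) = A" by (rule inner_inverse_gram[OF A G])
  have TH: "?T * (A * (H * ?T)) = ?T" using inner_inverse_gram[OF At H(1)] H(2) by simp
  have sG: "transpose_mat (?T * (G * A)) = ?T * (G * A)" by (rule gram_projection_symmetric[OF A G])
  have sH: "transpose_mat (A * (H * ?T)) = A * (H * ?T)"
    using gram_projection_symmetric[OF At H(1)] H(2) by simp
  have AH: "A * (H * ?T) * A = A"
  proof -
    have "A = transpose_mat (?T * (A * (H * ?T)))" unfolding TH by simp
    also have "\<dots> = A * (H * ?T) * A"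
      using A At H(1) by (subst transpose_mult_dim) (auto simp: sH)
    finally show ?thesis by simp
  qed
  \<comment> \<open>Built from inner inverses \<open>G\<close> of \<open>A A^T\<close> and
    \<open>H\<close> of \<open>A^T A\<close>, so that \<open>A X = A H A^T\<close> and
    \<open>X A = A^T G A\<close> are the symmetric projections onto column and row space.\<close>
  define X where "X = ?T * (G * (A * (H * ?T)))"
  have X: "X \<in> carrier_mat nc nr" using A At G(1) H(1) by (auto simp: X_def)
  have "A * X = A * (?T * (G * A)) * (H * ?T)"
    unfolding X_def using A At G(1) H(1) by (simp add: mult_assoc_dim)
  then have AX: "A * X = A * (H * ?T)" unfolding AG .
  have "X * A = ?T * (G * (A * (H * ?T) * A))"
    unfolding X_def using A At G(1) H(1) by (simp add: mult_assoc_dim)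
  then have XA: "X * A = ?T * (G * A)" unfolding AH .
  have "X * A * X = ?T * (G * (A * (H * (?T * (A * (H * ?T))))))"
  proof -
    have "X * A * X = X * (A * X)" using X A by (simp add: mult_assoc_dim)
    also have "\<dots> = X * (A * (H * ?T))" unfolding AX ..
    also have "\<dots> = ?T * (G * (A * (H * (?T * (A * (H * ?T))))))"
      unfolding X_def using A At G(1) H(1) by (simp add: mult_assoc_dim)
    finally show ?thesis .
  qed
  then have XAX: "X * A * X = X" unfolding TH X_def .
  have "is_pinv A X"
    unfolding is_pinv_def
  proof (intro conjI)
    show "X \<in> carrier_mat (dim_col A) (dim_row A)" using X by (simp add: nr_def nc_def)
    show "A * X * A = A" unfolding AX by (rule AH)
    show "transpose_mat (A * X) = A * X" unfolding AX by (rule sH)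
    show "transpose_mat (X * A) = X * A" unfolding XA by (rule sG)
  qed (rule XAX)
  then show ?thesis by blast
qed

lemma is_pinv_unique:
  assumes X: "is_pinv A X" and Y: "is_pinv A Y"
  shows "X = Y"
proof -
  define nr nc where "nr = dim_row A" and "nc = dim_col A"
  have A: "A \<in> carrier_mat nr nc" by (simp add: nr_def nc_def)
  have c: "X \<in> carrier_mat nc nr" "Y \<in> carrier_mat nc nr"
    using X Y by (auto simp: is_pinv_def nr_def nc_def)
  have x: "A * X * A = A" "X * A * X = X" "transpose_mat (A * X) = A * X" "transpose_mat (X * A) = X * A"
    and y: "A * Y * A = A" "Y * A * Y = Y" "transpose_mat (A * Y) = A * Y" "transpose_mat (Y * A) = Y * A"
    using X Y by (auto simp: is_pinv_def)
  have AX: "A * X = A * Y"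
  proof -
    have 1: "A * Y * (A * X) = A * Y * A * X" "A * X * (A * Y) = A * X * A * Y" using A c by (simp_all add: mult_assoc_dim)
    have "A * X = transpose_mat (A * Y * (A * X))" unfolding 1 x y ..
    also have "\<dots> = A * X * (A * Y)"
      using A c by (subst transpose_mult_dim) (auto simp: x y simp del: assoc_mult_mat)
    finally show ?thesis unfolding 1 x .
  qed
  have XA: "X * A = Y * A"
  proof -
    have 1: "X * A * (Y * A) = X * (A * Y * A)" "Y * A * (X * A) = Y * (A * X * A)" using A c by (simp_all add: mult_assoc_dim)
    have "X * A = transpose_mat (X * A * (Y * A))" unfolding 1 x y ..
    also have "\<dots> = Y * A * (X * A)"
      using A c by (subst transpose_mult_dim) (auto simp: x y simp del: assoc_mult_mat)
    finally show ?thesis unfolding 1 x .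
  qed
  have "X = X * A * X" using x by simp
  also have "\<dots> = Y * A * X" unfolding XA ..
  also have "\<dots> = Y * (A * X)" using A c by (simp add: mult_assoc_dim)
  also have "\<dots> = Y * A * Y" unfolding AX using A c by (simp add: mult_assoc_dim)
  also have "\<dots> = Y" by (rule y)
  finally show ?thesis .
qed

lemma is_pinv_pinv: "is_pinv A (pinv A)"
  unfolding pinv_def using is_pinv_exists[of A] is_pinv_unique by (metis theI)

lemma pinv_symmetric:
  assumes "K \<in> carrier_mat s s" "transpose_mat K = K"
  shows "transpose_mat (pinv K) = pinv K"
proof -
  let ?X = "pinv K"
  have X: "?X \<in> carrier_mat s s" and p: "K * ?X * K = K" "?X * K * ?X = ?X"
    "transpose_mat (K * ?X) = K * ?X" "transpose_mat (?X * K) = ?X * K"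
    using is_pinv_pinv[of K] assms(1) by (auto simp: is_pinv_def)
  have t: "transpose_mat (K * ?X) = transpose_mat ?X * K" "transpose_mat (?X * K) = K * transpose_mat ?X"
    using assms X by (simp_all add: transpose_mult_dim)
  have "transpose_mat (K * ?X * K) = K * transpose_mat ?X * K"
    using assms X by (simp add: transpose_mult_dim mult_assoc_dim)
  then have 1: "K * transpose_mat ?X * K = K" unfolding p assms(2) by simp
  have "transpose_mat (?X * K * ?X) = transpose_mat ?X * K * transpose_mat ?X"
    using assms X by (simp add: transpose_mult_dim mult_assoc_dim)
  then have 2: "transpose_mat ?X * K * transpose_mat ?X = transpose_mat ?X" unfolding p by simp
  have "is_pinv K (transpose_mat ?X)"
    unfolding is_pinv_def
  proof (intro conjI 1 2)
    show "transpose_mat ?X \<in> carrier_mat (dim_col K) (dim_row K)" using X assms by simp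
    show "transpose_mat (K * transpose_mat ?X) = K * transpose_mat ?X"
      unfolding t(2)[symmetric] p(4) ..
    show "transpose_mat (transpose_mat ?X * K) = transpose_mat ?X * K"
      unfolding t(1)[symmetric] p(3) ..
  qed
  with is_pinv_pinv show ?thesis by (rule is_pinv_unique[symmetric])
qed

section \<open>Quadratic forms of the regularized projections\<close>

lemma ridge_gram_mult_vec:
  fixes M :: "real mat"
  assumes M: "M \<in> carrier_mat s n" and w: "w \<in> carrier_vec s"
  shows "(M * transpose_mat M + l \<cdot>\<^sub>m 1\<^sub>m s) *\<^sub>v w = M *\<^sub>v (transpose_mat M *\<^sub>v w) + l \<cdot>\<^sub>v w"
proof -
  have "(M * transpose_mat M + l \<cdot>\<^sub>m 1\<^sub>m s) *\<^sub>v w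
      = (M * transpose_mat M) *\<^sub>v w + (l \<cdot>\<^sub>m 1\<^sub>m s) *\<^sub>v w"
    using M w by (intro add_mult_distrib_mat_vec[of _ s s]) auto
  also have "(l \<cdot>\<^sub>m 1\<^sub>m s) *\<^sub>v w = l \<cdot>\<^sub>v w"
  proof (rule eq_vecI)
    fix i assume "i < dim_vec (l \<cdot>\<^sub>v w)"
    then have i: "i < s" using w by simp
    then have "((l \<cdot>\<^sub>m 1\<^sub>m s) *\<^sub>v w) $ i = (\<Sum>q\<in>{0..<s}. l * of_bool (i = q) * w $ q)"
      using w by (auto simp: scalar_prod_def intro!: sum.cong)
    also have "\<dots> = l * w $ i"
      using i by (subst sum.remove[of _ i]) auto
    finally show "((l \<cdot>\<^sub>m 1\<^sub>m s) *\<^sub>v w) $ i = (l \<cdot>\<^sub>v w) $ i" using i w by simp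
  qed (use w in auto)
  also have "(M * transpose_mat M) *\<^sub>v w = M *\<^sub>v (transpose_mat M *\<^sub>v w)"
    using M w by (intro assoc_mult_mat_vec) auto
  finally show ?thesis .
qed

lemma ridge_gram_form:
  fixes M :: "real mat"
  assumes M: "M \<in> carrier_mat s n" and w: "w \<in> carrier_vec s"
  shows "w \<bullet> ((M * transpose_mat M + l \<cdot>\<^sub>m 1\<^sub>m s) *\<^sub>v w)
    = (transpose_mat M *\<^sub>v w) \<bullet> (transpose_mat M *\<^sub>v w) + l * (w \<bullet> w)"
proof -
  have t: "transpose_mat M *\<^sub>v w \<in> carrier_vec n" using M w by simp
  have "w \<bullet> (M *\<^sub>v (transpose_mat M *\<^sub>v w)) = (transpose_mat M *\<^sub>v w) \<bullet> (transpose_mat M *\<^sub>v w)"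
    by (rule transpose_vec_mult_scalar[OF M t w, symmetric])
  moreover have "w \<bullet> (M *\<^sub>v (transpose_mat M *\<^sub>v w) + l \<cdot>\<^sub>v w) = w \<bullet> (M *\<^sub>v (transpose_mat M *\<^sub>v w)) + l * (w \<bullet> w)"
    using M w t by (subst scalar_prod_add_distrib[of _ s]) auto
  ultimately show ?thesis unfolding ridge_gram_mult_vec[OF M w] by simp
qed

lemma ridge_gram_symmetric:
  fixes M :: "real mat"
  assumes "M \<in> carrier_mat s n"
  shows "transpose_mat (M * transpose_mat M + l \<cdot>\<^sub>m 1\<^sub>m s) = M * transpose_mat M + l \<cdot>\<^sub>m 1\<^sub>m s"
proof -
  have "transpose_mat (M * transpose_mat M) = M * transpose_mat M"
    by (simp add: transpose_mult_dim)
  then show ?thesis using assms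
    by (subst transpose_add[of _ s s]) (auto intro!: arg_cong2[of _ _ _ _ "(+)"] eq_matI)
qed

lemma symmetric_form_swap:
  fixes K :: "real mat"
  assumes "K \<in> carrier_mat s s" "transpose_mat K = K" "v \<in> carrier_vec s" "w \<in> carrier_vec s"
  shows "(K *\<^sub>v v) \<bullet> w = v \<bullet> (K *\<^sub>v w)"
  using transpose_vec_mult_scalar[of K s s w v] assms by simp

lemma
  assumes M: "M \<in> carrier_mat s n"
  shows reg_proj_carrier: "reg_proj l M \<in> carrier_mat n n"
    and reg_proj_symmetric: "transpose_mat (reg_proj l M) = reg_proj l M"
    and reg_proj_form: "x \<in> carrier_vec n \<Longrightarrow> x \<bullet> (reg_proj l M *\<^sub>v x)
      = (M *\<^sub>v x) \<bullet> (pinv (M * transpose_mat M + l \<cdot>\<^sub>m 1\<^sub>m s) *\<^sub>v (M *\<^sub>v x))"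
proof -
  let ?K = "M * transpose_mat M + l \<cdot>\<^sub>m 1\<^sub>m s"
  let ?X = "pinv ?K"
  have K: "?K \<in> carrier_mat s s" using M by simp
  have X: "?X \<in> carrier_mat s s"
    using is_pinv_pinv[of ?K] K unfolding is_pinv_def by auto
  have R: "reg_proj l M = transpose_mat M * ?X * M" using M by (simp add: reg_proj_def)
  show "reg_proj l M \<in> carrier_mat n n" unfolding R using M X by auto
  have sX: "transpose_mat ?X = ?X"
    by (rule pinv_symmetric[OF K ridge_gram_symmetric[OF M]])
  show "transpose_mat (reg_proj l M) = reg_proj l M"
    unfolding R using M X by (simp add: transpose_mult_dim sX mult_assoc_dim)
  assume x: "x \<in> carrier_vec n"
  have "reg_proj l M *\<^sub>v x = transpose_mat M *\<^sub>v (?X *\<^sub>v (M *\<^sub>v x))"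
    unfolding R using M X x
    by (subst assoc_mult_mat_vec[of _ n s _ n], auto)+
  moreover have "x \<bullet> (transpose_mat M *\<^sub>v (?X *\<^sub>v (M *\<^sub>v x))) = (M *\<^sub>v x) \<bullet> (?X *\<^sub>v (M *\<^sub>v x))"
    using transpose_vec_mult_scalar[of "transpose_mat M" n s "?X *\<^sub>v (M *\<^sub>v x)" x] M X x by simp
  ultimately show "x \<bullet> (reg_proj l M *\<^sub>v x) = (M *\<^sub>v x) \<bullet> (?X *\<^sub>v (M *\<^sub>v x))" by simp
qed

text \<open>The point is \<open>l = 0\<close>, where the matrix may be singular: the residual
  \<open>e\<close> lies in its kernel, hence in that of \<open>M^T\<close>, and is therefore
  orthogonal to \<open>M x\<close> and to the range, so \<open>e = 0\<close>.\<close>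

lemma ridge_gram_pinv_solves:
  assumes M: "M \<in> carrier_mat s n" and l: "0 \<le> l" and x: "x \<in> carrier_vec n"
  shows "(M * transpose_mat M + l \<cdot>\<^sub>m 1\<^sub>m s) *\<^sub>v (pinv (M * transpose_mat M + l \<cdot>\<^sub>m 1\<^sub>m s) *\<^sub>v (M *\<^sub>v x)) = M *\<^sub>v x"
proof -
  define K where "K = M * transpose_mat M + l \<cdot>\<^sub>m 1\<^sub>m s"
  define z where "z = M *\<^sub>v x"
  define X where "X = pinv K"
  have K: "K \<in> carrier_mat s s" and Ks: "transpose_mat K = K"
    using M ridge_gram_symmetric[OF M] by (auto simp: K_def)
  have z: "z \<in> carrier_vec s" using M x by (simp add: z_def)
  have X: "X \<in> carrier_mat s s" and p: "K * X * K = K" "transpose_mat (K * X) = K * X"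
    using is_pinv_pinv[of K] K by (auto simp: is_pinv_def X_def)
  have sX: "transpose_mat X = X" unfolding X_def by (rule pinv_symmetric[OF K Ks])
  define u where "u = K *\<^sub>v (X *\<^sub>v z)"
  have u: "u \<in> carrier_vec s" using K X z by (simp add: u_def)
  define e where "e = z - u"
  have e: "e \<in> carrier_vec s" using z u by (simp add: e_def)
  have KX: "K * X = X * K" using p(2) K X by (simp add: transpose_mult_dim sX Ks)
  have "K * (K * X) = K" unfolding KX using p(1) K X by (simp add: mult_assoc_dim)
  then have "K *\<^sub>v u = K *\<^sub>v z"
    unfolding u_def using K X z
    by (metis assoc_mult_mat_vec mult_carrier_mat)
  then have Ke: "K *\<^sub>v e = 0\<^sub>v s"
    unfolding e_def using K z u by (subst mult_minus_distrib_mat_vec[of _ s s]) auto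
  then have "0 = e \<bullet> (K *\<^sub>v e)" using e by simp
  also have "\<dots> = (transpose_mat M *\<^sub>v e) \<bullet> (transpose_mat M *\<^sub>v e) + l * (e \<bullet> e)"
    unfolding K_def by (rule ridge_gram_form[OF M e])
  finally have "(transpose_mat M *\<^sub>v e) \<bullet> (transpose_mat M *\<^sub>v e) = 0"
    using scalar_prod_ge_0_real[of "transpose_mat M *\<^sub>v e"] scalar_prod_ge_0_real[of e] l
    by (metis add_nonneg_eq_0_iff mult_nonneg_nonneg)
  then have Mt: "transpose_mat M *\<^sub>v e = 0\<^sub>v n"
    using M e by (intro scalar_prod_eq_0_real) auto
  have "e \<bullet> z = (transpose_mat M *\<^sub>v e) \<bullet> x"
    unfolding z_def by (rule transpose_vec_mult_scalar[OF M x e, symmetric])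
  then have ez: "e \<bullet> z = 0" unfolding Mt using x by simp
  have "e \<bullet> u = (K *\<^sub>v e) \<bullet> (X *\<^sub>v z)"
    unfolding u_def using symmetric_form_swap[OF K Ks e, of "X *\<^sub>v z"] X z by simp
  then have eu: "e \<bullet> u = 0" unfolding Ke using X z by simp
  have "e \<bullet> e = e \<bullet> z - e \<bullet> u"
    using e z u by (subst (2) e_def) (simp add: scalar_prod_minus_distrib[of _ s])
  then have "e \<bullet> e = 0" using ez eu by simp
  then have e0: "e = 0\<^sub>v s" by (rule scalar_prod_eq_0_real[OF e])
  have "u = z"
  proof (rule eq_vecI)
    fix i assume "i < dim_vec z"
    then have i: "i < s" using z by simp
    have "e $ i = 0" unfolding e0 using i by simp
    then show "u $ i = z $ i" unfolding e_def using i z u by simp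
  qed (use z u in auto)
  then show ?thesis by (simp add: u_def K_def X_def z_def)
qed

text \<open>The maximizer is \<open>v = K^+ M x\<close>, and the bound expands
  \<open>(v - w)^T K (v - w) \<ge> 0\<close> using \<open>K v = M x\<close>.\<close>

lemma reg_proj_form_ge:
  assumes M: "M \<in> carrier_mat s n" and l: "0 \<le> l" and x: "x \<in> carrier_vec n" and w: "w \<in> carrier_vec s"
  shows "2 * (w \<bullet> (M *\<^sub>v x)) - (transpose_mat M *\<^sub>v w) \<bullet> (transpose_mat M *\<^sub>v w) - l * (w \<bullet> w)
    \<le> x \<bullet> (reg_proj l M *\<^sub>v x)"
proof -
  define K where "K = M * transpose_mat M + l \<cdot>\<^sub>m 1\<^sub>m s"
  define z where "z = M *\<^sub>v x"
  define v where "v = pinv K *\<^sub>v z"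
  have K: "K \<in> carrier_mat s s" and Ks: "transpose_mat K = K"
    using M ridge_gram_symmetric[OF M] by (auto simp: K_def)
  have z: "z \<in> carrier_vec s" using M x by (simp add: z_def)
  have v: "v \<in> carrier_vec s"
    using is_pinv_pinv[of K] K z by (auto simp: is_pinv_def v_def)
  have Kv: "K *\<^sub>v v = z"
    unfolding v_def K_def z_def by (rule ridge_gram_pinv_solves[OF M l x])
  have vw: "v - w \<in> carrier_vec s" using v w by simp
  have Kw: "K *\<^sub>v w \<in> carrier_vec s" using K w by simp
  have "0 \<le> (v - w) \<bullet> (K *\<^sub>v (v - w))"
    unfolding K_def ridge_gram_form[OF M vw] using l
    by (intro add_nonneg_nonneg mult_nonneg_nonneg scalar_prod_ge_0_real)
  also have "K *\<^sub>v (v - w) = z - K *\<^sub>v w"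
    using K v w Kv by (subst mult_minus_distrib_mat_vec[of _ s s]) auto
  also have "(v - w) \<bullet> (z - K *\<^sub>v w) = v \<bullet> z - v \<bullet> (K *\<^sub>v w) - (w \<bullet> z - w \<bullet> (K *\<^sub>v w))"
    using v w z Kw
    by (simp add: minus_scalar_prod_distrib[of _ s] scalar_prod_minus_distrib[of _ s])
  also have "v \<bullet> (K *\<^sub>v w) = w \<bullet> z"
    using symmetric_form_swap[OF K Ks v w] comm_scalar_prod[OF z w] Kv by simp
  finally have "2 * (w \<bullet> z) - w \<bullet> (K *\<^sub>v w) \<le> v \<bullet> z" by simp
  also have "v \<bullet> z = x \<bullet> (reg_proj l M *\<^sub>v x)"
    unfolding reg_proj_form[OF M x] using comm_scalar_prod[OF v z] by (simp add: v_def K_def z_def)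
  finally show ?thesis
    using ridge_gram_form[OF M w, of l] by (simp add: K_def z_def)
qed

text \<open>An inverse satisfies the Penrose equations, so both sides of the theorem can be treated
  through \<open>reg_proj\<close>.\<close>

lemma ridge_proj_eq_reg_proj:
  assumes A: "A \<in> carrier_mat m n" and l: "0 < l"
  shows "ridge_proj l A = reg_proj l A"
proof -
  define K where "K = A * transpose_mat A + l \<cdot>\<^sub>m 1\<^sub>m m"
  have K: "K \<in> carrier_mat m m" using A by (simp add: K_def)
  have "det K \<noteq> 0"
  proof
    assume "det K = 0"
    then obtain v where v: "v \<in> carrier_vec m" "v \<noteq> 0\<^sub>v m" "K *\<^sub>v v = 0\<^sub>v m"
      using det_0_iff_vec_prod_zero[OF K] by auto
    have "0 = v \<bullet> (K *\<^sub>v v)" using v by simp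
    also have "\<dots> = (transpose_mat A *\<^sub>v v) \<bullet> (transpose_mat A *\<^sub>v v) + l * (v \<bullet> v)"
      unfolding K_def by (rule ridge_gram_form[OF A v(1)])
    finally have "l * (v \<bullet> v) \<le> 0"
      using scalar_prod_ge_0_real[of "transpose_mat A *\<^sub>v v"] by linarith
    then have "v \<bullet> v = 0" using l scalar_prod_ge_0_real[of v] by (simp add: mult_le_0_iff)
    with v show False using scalar_prod_eq_0_real by blast
  qed
  then have "K \<in> Units (ring_mat TYPE(real) m ())" by (rule det_non_zero_imp_unit[OF K])
  then obtain B where B: "mat_inverse K = Some B" using mat_inverse(1)[OF K, of "()"] by auto
  from mat_inverse(2)[OF K B] have B': "K * B = 1\<^sub>m m" "B * K = 1\<^sub>m m" "B \<in> carrier_mat m m" by auto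
  have "is_pinv K B" unfolding is_pinv_def B' using K B' by auto
  then have "pinv K = B" using is_pinv_pinv is_pinv_unique by blast
  then show ?thesis using A B by (simp add: ridge_proj_def reg_proj_def K_def)
qed

lemma sum_pick:
  assumes "finite S"
  shows "(\<Sum>i<card S. f (pick S i)) = (\<Sum>j\<in>S. f j)"
proof -
  have inj: "inj_on (pick S) {..<card S}"
    by (rule inj_onI) (metis lessThan_iff nat_neq_iff pick_mono_le)
  have "pick S ` {..<card S} \<subseteq> S" using pick_in_set_le by auto
  then have "pick S ` {..<card S} = S"
    using assms inj by (intro card_subset_eq) (auto simp: card_image)
  then show ?thesis using sum.reindex[OF inj, of f] by simp
qed

section \<open>Singular value coordinates\<close>

lemma sum_if_less_min: "(\<Sum>i<(m::nat). if i < n then f i else 0) = (\<Sum>i<min m n. f i)"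
proof -
  have "{..<m} \<inter> {i. i < n} = {..<min m n}" by auto
  then show ?thesis by (simp add: sum.If_cases)
qed

lemma mult_mat_vec_index:
  fixes A :: "real mat"
  assumes "A \<in> carrier_mat nr nc" "v \<in> carrier_vec nc" "i < nr"
  shows "(A *\<^sub>v v) $ i = (\<Sum>j<nc. A $$ (i, j) * v $ j)"
  using assms by (simp add: scalar_prod_def atLeast0LessThan)

lemma scalar_prod_sum: "w \<in> carrier_vec n \<Longrightarrow> v \<bullet> w = (\<Sum>i<n. v $ i * (w $ i :: real))"
  by (simp add: scalar_prod_def atLeast0LessThan)

lemma rows_of_carrier:
  assumes B: "B \<in> carrier_mat m n" and S: "S \<subseteq> {..<m}"
  shows "rows_of B S \<in> carrier_mat (card S) n"
proof -
  have "{i. i < m \<and> i \<in> S} = S" using S by auto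
  then show ?thesis using B by (intro carrier_matI) (simp_all add: dim_submatrix)
qed

text \<open>\<open>submatrix\<close> renumbers rows through \<open>pick\<close>. Weights on all rows
  supported in \<open>S\<close> are translated into a vector of length \<open>card S\<close> with
  the same pairings and norm.\<close>

lemma rows_of_weights:
  fixes w :: "nat \<Rightarrow> real"
  assumes B: "B \<in> carrier_mat m n" and S: "S \<subseteq> {..<m}" and w: "\<And>j. j \<notin> S \<Longrightarrow> w j = 0"
    and x: "x \<in> carrier_vec n"
  shows "\<exists>wv \<in> carrier_vec (card S). wv \<bullet> (rows_of B S *\<^sub>v x) = (\<Sum>j<m. w j * (B *\<^sub>v x) $ j)
    \<and> transpose_mat (rows_of B S) *\<^sub>v wv = transpose_mat B *\<^sub>v vec m w
    \<and> wv \<bullet> wv = (\<Sum>j<m. (w j)\<^sup>2)"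
proof -
  define M where "M = rows_of B S"
  define wv where "wv = vec (card S) (\<lambda>i. w (pick S i))"
  have fS: "finite S" using S finite_subset by blast
  have cS: "{i. i < m \<and> i \<in> S} = S" using S by auto
  have M: "M \<in> carrier_mat (card S) n" unfolding M_def by (rule rows_of_carrier[OF B S])
  have Mi: "M $$ (i, b) = B $$ (pick S i, b)" if "i < card S" "b < n" for i b
    using that B by (simp add: M_def submatrix_index cS pick_UNIV)
  have wv: "wv \<in> carrier_vec (card S)" by (simp add: wv_def)
  have pick: "pick S i < m" if "i < card S" for i
    using pick_in_set_le[OF that] S by auto
  have ext: "(\<Sum>i<card S. w (pick S i) * f (pick S i)) = (\<Sum>j<m. w j * f j)" for f
    unfolding sum_pick[OF fS, of "\<lambda>j. w j * f j"] using S w by (intro sum.mono_neutral_left) auto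
  have "wv \<bullet> (M *\<^sub>v x) = (\<Sum>i<card S. wv $ i * (M *\<^sub>v x) $ i)"
    using M x by (intro scalar_prod_sum) simp
  also have "\<dots> = (\<Sum>i<card S. w (pick S i) * (B *\<^sub>v x) $ pick S i)"
  proof (rule sum.cong[OF refl])
    fix i assume i: "i \<in> {..<card S}"
    then have "(M *\<^sub>v x) $ i = (B *\<^sub>v x) $ pick S i"
      using pick[of i] Mi mult_mat_vec_index[OF M x, of i] mult_mat_vec_index[OF B x, of "pick S i"]
      by (simp del: index_mult_mat_vec)
    then show "wv $ i * (M *\<^sub>v x) $ i = w (pick S i) * (B *\<^sub>v x) $ pick S i"
      using i by (simp add: wv_def)
  qed
  also have "\<dots> = (\<Sum>j<m. w j * (B *\<^sub>v x) $ j)" by (rule ext)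
  finally have 1: "wv \<bullet> (M *\<^sub>v x) = (\<Sum>j<m. w j * (B *\<^sub>v x) $ j)" .
  have 2: "transpose_mat M *\<^sub>v wv = transpose_mat B *\<^sub>v vec m w"
  proof (rule eq_vecI)
    fix b assume "b < dim_vec (transpose_mat B *\<^sub>v vec m w)"
    then have b: "b < n" using B by simp
    have "(transpose_mat M *\<^sub>v wv) $ b = (\<Sum>i<card S. transpose_mat M $$ (b, i) * wv $ i)"
      using M wv b by (intro mult_mat_vec_index) auto
    also have "\<dots> = (\<Sum>i<card S. w (pick S i) * B $$ (pick S i, b))"
      using M b Mi by (intro sum.cong refl) (simp add: wv_def)
    also have "\<dots> = (\<Sum>j<m. w j * B $$ (j, b))" by (rule ext)
    also have "\<dots> = (\<Sum>j<m. transpose_mat B $$ (b, j) * vec m w $ j)"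
      using B b by (intro sum.cong refl) simp
    also have "\<dots> = (transpose_mat B *\<^sub>v vec m w) $ b"
      using B b by (intro mult_mat_vec_index[symmetric]) auto
    finally show "(transpose_mat M *\<^sub>v wv) $ b = (transpose_mat B *\<^sub>v vec m w) $ b" .
  qed (use M B in auto)
  have "wv \<bullet> wv = (\<Sum>i<card S. w (pick S i) * w (pick S i))"
    unfolding scalar_prod_sum[OF wv] by (intro sum.cong refl) (simp add: wv_def)
  also have "\<dots> = (\<Sum>j<m. (w j)\<^sup>2)" unfolding ext by (simp add: power2_eq_square)
  finally show ?thesis using wv 1 2 unfolding M_def by blast
qed

locale svd_factors =
  fixes m n :: nat and A U V :: "real mat" and \<sigma> :: "nat \<Rightarrow> real"
  assumes A: "A \<in> carrier_mat m n" and U: "U \<in> carrier_mat m m" "transpose_mat U * U = 1\<^sub>m m"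
    and V: "V \<in> carrier_mat n n" "transpose_mat V * V = 1\<^sub>m n"
    and A_eq: "A = U * mat m n (\<lambda>(i, j). if i = j then \<sigma> i else 0) * transpose_mat V"
begin

definition Sg :: "real mat" where "Sg = mat m n (\<lambda>(i, j). if i = j then \<sigma> i else 0)"

lemma Sg: "Sg \<in> carrier_mat m n" by (simp add: Sg_def)

lemma Sg_mult_vec:
  assumes "c \<in> carrier_vec n" "i < m"
  shows "(Sg *\<^sub>v c) $ i = (if i < n then \<sigma> i * c $ i else 0)"
proof -
  have "(Sg *\<^sub>v c) $ i = (\<Sum>j<n. if i = j then \<sigma> i * c $ j else 0)"
    unfolding mult_mat_vec_index[OF Sg assms] using assms by (intro sum.cong) (auto simp: Sg_def)
  then show ?thesis by simp
qed

lemma Sg_transpose_mult_vec: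
  assumes "c \<in> carrier_vec m" "i < n"
  shows "(transpose_mat Sg *\<^sub>v c) $ i = (if i < m then \<sigma> i * c $ i else 0)"
proof -
  have "(transpose_mat Sg *\<^sub>v c) $ i = (\<Sum>j<m. if i = j then \<sigma> i * c $ j else 0)"
  proof -
    have "(transpose_mat Sg *\<^sub>v c) $ i = (\<Sum>j<m. transpose_mat Sg $$ (i, j) * c $ j)"
      using assms Sg by (intro mult_mat_vec_index) auto
    also have "\<dots> = (\<Sum>j<m. if i = j then \<sigma> i * c $ j else 0)"
      using assms by (intro sum.cong refl) (auto simp: Sg_def)
    finally show ?thesis .
  qed
  then show ?thesis by simp
qed

definition coord :: "real vec \<Rightarrow> nat \<Rightarrow> real" where
  "coord x i = (transpose_mat V *\<^sub>v x) $ i"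

lemma mult_A_vec:
  assumes Q: "Q \<in> carrier_mat m m" and x: "x \<in> carrier_vec n"
  shows "(Q * A) *\<^sub>v x = (Q * U) *\<^sub>v (Sg *\<^sub>v (transpose_mat V *\<^sub>v x))"
proof -
  have "Q * A = (Q * U) * (Sg * transpose_mat V)"
    unfolding A_eq Sg_def[symmetric] using Q U V Sg by (simp add: mult_assoc_dim)
  also have "\<dots> *\<^sub>v x = (Q * U) *\<^sub>v ((Sg * transpose_mat V) *\<^sub>v x)"
    using Q U V Sg x by (intro assoc_mult_mat_vec[of _ m m _ n]) auto
  also have "(Sg * transpose_mat V) *\<^sub>v x = Sg *\<^sub>v (transpose_mat V *\<^sub>v x)"
    using V Sg x by (intro assoc_mult_mat_vec[of _ m n _ n]) auto
  finally show ?thesis .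
qed

lemma mult_A_transpose_vec:
  assumes Q: "Q \<in> carrier_mat m m" and w: "w \<in> carrier_vec m"
  shows "transpose_mat (Q * A) *\<^sub>v w = V *\<^sub>v (transpose_mat Sg *\<^sub>v (transpose_mat (Q * U) *\<^sub>v w))"
proof -
  have "transpose_mat (Q * A) = V * (transpose_mat Sg * transpose_mat (Q * U))"
    unfolding A_eq Sg_def[symmetric] using Q U V Sg by (simp add: mult_assoc_dim transpose_mult_dim)
  also have "\<dots> *\<^sub>v w = V *\<^sub>v ((transpose_mat Sg * transpose_mat (Q * U)) *\<^sub>v w)"
    using Q U V Sg w by (intro assoc_mult_mat_vec[of _ n n _ m]) auto
  also have "(transpose_mat Sg * transpose_mat (Q * U)) *\<^sub>v w
      = transpose_mat Sg *\<^sub>v (transpose_mat (Q * U) *\<^sub>v w)"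
    using Q U Sg w by (intro assoc_mult_mat_vec[of _ n m _ m]) auto
  finally show ?thesis .
qed

lemma mult_A_vec_index:
  assumes Q: "Q \<in> carrier_mat m m" and x: "x \<in> carrier_vec n" and j: "j < m"
  shows "((Q * A) *\<^sub>v x) $ j = (\<Sum>i<min m n. \<sigma> i * (Q * U) $$ (j, i) * coord x i)"
proof -
  have c: "transpose_mat V *\<^sub>v x \<in> carrier_vec n" using V x by simp
  have "((Q * A) *\<^sub>v x) $ j = (\<Sum>i<m. (Q * U) $$ (j, i) * (Sg *\<^sub>v (transpose_mat V *\<^sub>v x)) $ i)"
    unfolding mult_A_vec[OF Q x] using Q U Sg c j by (intro mult_mat_vec_index) auto
  also have "\<dots> = (\<Sum>i<m. if i < n then \<sigma> i * (Q * U) $$ (j, i) * coord x i else 0)"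
    by (intro sum.cong refl) (simp add: Sg_mult_vec[OF c] coord_def del: index_mult_mat_vec)
  finally show ?thesis unfolding sum_if_less_min .
qed

lemma norm_mult_A_transpose_vec:
  assumes Q: "Q \<in> carrier_mat m m"
  shows "(transpose_mat (Q * A) *\<^sub>v vec m w) \<bullet> (transpose_mat (Q * A) *\<^sub>v vec m w)
    = (\<Sum>i<min m n. (\<Sum>j<m. w j * (\<sigma> i * (Q * U) $$ (j, i)))\<^sup>2)"
proof -
  define y where "y = transpose_mat (Q * U) *\<^sub>v vec m w"
  have QU: "transpose_mat (Q * U) \<in> carrier_mat m m" using Q U by simp
  have y: "y \<in> carrier_vec m" using QU by (simp add: y_def)
  define g where "g = transpose_mat Sg *\<^sub>v y"
  have g: "g \<in> carrier_vec n" using Sg y by (simp add: g_def)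
  have "(V *\<^sub>v g) \<bullet> (V *\<^sub>v g) = (transpose_mat V *\<^sub>v (V *\<^sub>v g)) \<bullet> g"
    using transpose_vec_mult_scalar[OF V(1) g, of "V *\<^sub>v g"] V g by simp
  also have "transpose_mat V *\<^sub>v (V *\<^sub>v g) = (transpose_mat V * V) *\<^sub>v g"
    using V(1) g by (intro assoc_mult_mat_vec[symmetric]) auto
  also have "\<dots> = g" using V g by simp
  finally have "(transpose_mat (Q * A) *\<^sub>v vec m w) \<bullet> (transpose_mat (Q * A) *\<^sub>v vec m w) = g \<bullet> g"
    by (simp add: mult_A_transpose_vec[OF Q] g_def y_def)
  also have "\<dots> = (\<Sum>i<n. if i < m then (\<sigma> i * y $ i)\<^sup>2 else 0)"
    unfolding scalar_prod_sum[OF g]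
    by (intro sum.cong refl) (simp add: g_def Sg_transpose_mult_vec[OF y] power2_eq_square del: index_mult_mat_vec)
  also have "\<dots> = (\<Sum>i<min m n. (\<sigma> i * y $ i)\<^sup>2)"
    unfolding sum_if_less_min by (simp add: min.commute)
  also have "\<dots> = (\<Sum>i<min m n. (\<Sum>j<m. w j * (\<sigma> i * (Q * U) $$ (j, i)))\<^sup>2)"
  proof (intro sum.cong refl arg_cong[of _ _ "\<lambda>x. x\<^sup>2"])
    fix i assume "i \<in> {..<min m n}"
    then have "y $ i = (\<Sum>j<m. transpose_mat (Q * U) $$ (i, j) * vec m w $ j)"
      unfolding y_def using QU by (intro mult_mat_vec_index) auto
    also have "\<dots> = (\<Sum>j<m. (Q * U) $$ (j, i) * w j)"
      using \<open>i \<in> {..<min m n}\<close> Q U by (intro sum.cong refl) (auto simp del: index_mult_mat(1))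
    finally show "\<sigma> i * y $ i = (\<Sum>j<m. w j * (\<sigma> i * (Q * U) $$ (j, i)))"
      by (simp add: sum_distrib_left mult_ac del: index_mult_mat(1))
  qed
  finally show ?thesis .
qed

text \<open>The left side is \<open>gain\<close> for the rows of \<open>Q A\<close> in right
  singular coordinates, written out because \<open>flat_rows\<close> is not yet available
  here.\<close>

lemma rows_form_ge:
  assumes Q: "Q \<in> carrier_mat m m" and x: "x \<in> carrier_vec n" and l: "0 \<le> l"
    and S: "S \<subseteq> {..<m}" and w: "\<And>j. j \<notin> S \<Longrightarrow> w j = 0"
  shows "2 * (\<Sum>j<m. w j * (\<Sum>i<min m n. \<sigma> i * (Q * U) $$ (j, i) * coord x i))
      - (\<Sum>i<min m n. (\<Sum>j<m. w j * (\<sigma> i * (Q * U) $$ (j, i)))\<^sup>2) - l * (\<Sum>j<m. (w j)\<^sup>2)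
    \<le> x \<bullet> (reg_proj l (rows_of (Q * A) S) *\<^sub>v x)"
proof -
  have QA: "Q * A \<in> carrier_mat m n" using Q A by simp
  obtain wv where wv: "wv \<in> carrier_vec (card S)"
      "wv \<bullet> (rows_of (Q * A) S *\<^sub>v x) = (\<Sum>j<m. w j * ((Q * A) *\<^sub>v x) $ j)"
      "transpose_mat (rows_of (Q * A) S) *\<^sub>v wv = transpose_mat (Q * A) *\<^sub>v vec m w"
      "wv \<bullet> wv = (\<Sum>j<m. (w j)\<^sup>2)"
    using rows_of_weights[OF QA S, of w x] w x by blast
  have "(\<Sum>j<m. w j * ((Q * A) *\<^sub>v x) $ j)
      = (\<Sum>j<m. w j * (\<Sum>i<min m n. \<sigma> i * (Q * U) $$ (j, i) * coord x i))"
    by (intro sum.cong refl) (simp only: lessThan_iff mult_A_vec_index[OF Q x])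
  then show ?thesis
    using reg_proj_form_ge[OF rows_of_carrier[OF QA S] l x wv(1)]
    unfolding wv(2-4) norm_mult_A_transpose_vec[OF Q] by simp
qed

text \<open>In singular coordinates the ridge equation is diagonal:
  \<open>(\<sigma>\<^sup>2 + l) \<eta> = \<sigma> c\<close>.\<close>

lemma ridge_form:
  assumes x: "x \<in> carrier_vec n" and l: "0 < l"
  shows "x \<bullet> (ridge_proj l A *\<^sub>v x) = (\<Sum>i<min m n. (\<sigma> i)\<^sup>2 / ((\<sigma> i)\<^sup>2 + l) * (coord x i)\<^sup>2)"
proof -
  define y where "y = pinv (A * transpose_mat A + l \<cdot>\<^sub>m 1\<^sub>m m) *\<^sub>v (A *\<^sub>v x)"
  have Ax: "A *\<^sub>v x \<in> carrier_vec m" using A x by simp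
  have y: "y \<in> carrier_vec m"
    using is_pinv_pinv[of "A * transpose_mat A + l \<cdot>\<^sub>m 1\<^sub>m m"] A Ax by (auto simp: is_pinv_def y_def)
  define c where "c = transpose_mat V *\<^sub>v x"
  define \<eta> where "\<eta> = transpose_mat U *\<^sub>v y"
  have c: "c \<in> carrier_vec n" and \<eta>: "\<eta> \<in> carrier_vec m" using V U x y by (auto simp: c_def \<eta>_def)
  have UU: "transpose_mat U *\<^sub>v (U *\<^sub>v v) = v" if "v \<in> carrier_vec m" for v
    using that U assoc_mult_mat_vec[of "transpose_mat U" m m U m v, symmetric] by simp
  have VV: "transpose_mat V *\<^sub>v (V *\<^sub>v v) = v" if "v \<in> carrier_vec n" for v
    using that V assoc_mult_mat_vec[of "transpose_mat V" n n V n v, symmetric] by simp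
  have Av: "A *\<^sub>v v = U *\<^sub>v (Sg *\<^sub>v (transpose_mat V *\<^sub>v v))" if "v \<in> carrier_vec n" for v
    using mult_A_vec[of "1\<^sub>m m" v] that A U by simp
  have At: "transpose_mat A *\<^sub>v y = V *\<^sub>v (transpose_mat Sg *\<^sub>v \<eta>)"
    using mult_A_transpose_vec[of "1\<^sub>m m" y] y A U by (simp add: \<eta>_def)
  have St: "transpose_mat Sg *\<^sub>v \<eta> \<in> carrier_vec n" using Sg \<eta> by simp
  have "A *\<^sub>v x = A *\<^sub>v (transpose_mat A *\<^sub>v y) + l \<cdot>\<^sub>v y"
    using ridge_gram_pinv_solves[OF A less_imp_le[OF l] x] ridge_gram_mult_vec[OF A y]
    by (simp add: y_def)
  also have "A *\<^sub>v (transpose_mat A *\<^sub>v y) = U *\<^sub>v (Sg *\<^sub>v (transpose_mat Sg *\<^sub>v \<eta>))"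
    using St V by (simp add: At Av VV)
  finally have eq: "U *\<^sub>v (Sg *\<^sub>v c) = U *\<^sub>v (Sg *\<^sub>v (transpose_mat Sg *\<^sub>v \<eta>)) + l \<cdot>\<^sub>v y"
    using x by (simp add: Av c_def)
  have "transpose_mat U *\<^sub>v (U *\<^sub>v (Sg *\<^sub>v c))
      = transpose_mat U *\<^sub>v (U *\<^sub>v (Sg *\<^sub>v (transpose_mat Sg *\<^sub>v \<eta>))) + l \<cdot>\<^sub>v \<eta>"
    unfolding eq using U Sg St y
    by (subst mult_add_distrib_mat_vec[of _ m m]) (auto simp: \<eta>_def mult_mat_vec)
  then have eq2: "Sg *\<^sub>v c = Sg *\<^sub>v (transpose_mat Sg *\<^sub>v \<eta>) + l \<cdot>\<^sub>v \<eta>"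
    using Sg c St by (simp add: UU)
  have comp: "((\<sigma> i)\<^sup>2 + l) * \<eta> $ i = \<sigma> i * c $ i" if "i < min m n" for i
  proof -
    have i: "i < m" "i < n" using that by auto
    have "(Sg *\<^sub>v c) $ i = (Sg *\<^sub>v (transpose_mat Sg *\<^sub>v \<eta>)) $ i + l * \<eta> $ i"
      using arg_cong[OF eq2, of "\<lambda>v. v $ i"] i \<eta> Sg by (simp del: index_mult_mat_vec)
    then show ?thesis
      using i by (simp add: Sg_mult_vec[OF c] Sg_mult_vec[OF St] Sg_transpose_mult_vec[OF \<eta>]
          power2_eq_square algebra_simps del: index_mult_mat_vec)
  qed
  have "x \<bullet> (ridge_proj l A *\<^sub>v x) = (A *\<^sub>v x) \<bullet> y"
    unfolding ridge_proj_eq_reg_proj[OF A l] reg_proj_form[OF A x] y_def ..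
  also have "\<dots> = y \<bullet> (U *\<^sub>v (Sg *\<^sub>v c))"
    using comm_scalar_prod[OF Ax y] Av[OF x] by (simp add: c_def)
  also have "\<dots> = \<eta> \<bullet> (Sg *\<^sub>v c)"
    unfolding \<eta>_def using U y Sg c by (intro transpose_vec_mult_scalar[symmetric]) auto
  also have "\<dots> = (\<Sum>i<m. \<eta> $ i * (Sg *\<^sub>v c) $ i)"
    using Sg c by (intro scalar_prod_sum) simp
  also have "\<dots> = (\<Sum>i<m. if i < n then \<eta> $ i * (\<sigma> i * c $ i) else 0)"
    by (intro sum.cong refl) (simp add: Sg_mult_vec[OF c] del: index_mult_mat_vec)
  also have "\<dots> = (\<Sum>i<min m n. \<eta> $ i * (\<sigma> i * c $ i))" by (rule sum_if_less_min)
  also have "\<dots> = (\<Sum>i<min m n. (\<sigma> i)\<^sup>2 / ((\<sigma> i)\<^sup>2 + l) * (coord x i)\<^sup>2)"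
  proof (rule sum.cong[OF refl])
    fix i assume "i \<in> {..<min m n}"
    then have i: "i < min m n" by simp
    have pos: "0 < (\<sigma> i)\<^sup>2 + l" using l by (simp add: add_nonneg_pos)
    have "\<eta> $ i = \<sigma> i * c $ i / ((\<sigma> i)\<^sup>2 + l)" using comp[OF i] pos by (simp add: field_simps)
    then show "\<eta> $ i * (\<sigma> i * c $ i) = (\<sigma> i)\<^sup>2 / ((\<sigma> i)\<^sup>2 + l) * (coord x i)\<^sup>2"
      by (simp add: coord_def c_def power2_eq_square)
  qed
  finally show ?thesis .
qed

end

lemma mat_expectation_unif_subset_form:
  assumes s: "s \<le> m" and x: "x \<in> carrier_vec n" and F: "\<And>S. S \<subseteq> {..<m} \<Longrightarrow> F S \<in> carrier_mat n n"
  shows "x \<bullet> (mat_expectation n n (unif_subset m s) F *\<^sub>v x) = subset_avg m s (\<lambda>S. x \<bullet> (F S *\<^sub>v x))"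
proof -
  let ?E = "mat_expectation n n (unif_subset m s) F"
  let ?X = "{S. S \<subseteq> {..<m} \<and> card S = s}"
  have E: "?E \<in> carrier_mat n n" by (simp add: mat_expectation_def)
  have form: "x \<bullet> (B *\<^sub>v x) = (\<Sum>i<n. \<Sum>j<n. x $ i * x $ j * B $$ (i, j))" if B: "B \<in> carrier_mat n n" for B
  proof -
    have "x \<bullet> (B *\<^sub>v x) = (\<Sum>i<n. x $ i * (B *\<^sub>v x) $ i)" using B x by (intro scalar_prod_sum) simp
    also have "\<dots> = (\<Sum>i<n. x $ i * (\<Sum>j<n. B $$ (i, j) * x $ j))"
      by (intro sum.cong refl) (simp only: lessThan_iff mult_mat_vec_index[OF B x])
    finally show ?thesis by (simp add: sum_distrib_left mult_ac)
  qed
  have "x \<bullet> (?E *\<^sub>v x) = (\<Sum>i<n. \<Sum>j<n. x $ i * x $ j * ((\<Sum>S\<in>?X. F S $$ (i, j)) / (m choose s)))"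
    unfolding form[OF E]
    by (intro sum.cong refl) (simp add: mat_expectation_def expectation_unif_subset[OF s] subset_avg_def)
  also have "\<dots> = (\<Sum>i<n. \<Sum>j<n. \<Sum>S\<in>?X. x $ i * x $ j * F S $$ (i, j)) / (m choose s)"
    by (simp add: sum_distrib_left sum_divide_distrib)
  also have "(\<Sum>i<n. \<Sum>j<n. \<Sum>S\<in>?X. x $ i * x $ j * F S $$ (i, j))
      = (\<Sum>S\<in>?X. \<Sum>i<n. \<Sum>j<n. x $ i * x $ j * F S $$ (i, j))"
  proof -
    have "(\<Sum>j<n. \<Sum>S\<in>?X. x $ i * x $ j * F S $$ (i, j)) = (\<Sum>S\<in>?X. \<Sum>j<n. x $ i * x $ j * F S $$ (i, j))" for i
      by (rule sum.swap)
    then show ?thesis by (simp only:) (rule sum.swap)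
  qed
  also have "\<dots> = (\<Sum>S\<in>?X. x \<bullet> (F S *\<^sub>v x))"
    by (intro sum.cong refl) (simp add: form F)
  finally show ?thesis by (simp add: subset_avg_def)
qed

lemma mat_expectation_symmetric:
  assumes s: "s \<le> m"
    and F: "\<And>S. S \<subseteq> {..<m} \<Longrightarrow> F S \<in> carrier_mat n n" "\<And>S. S \<subseteq> {..<m} \<Longrightarrow> transpose_mat (F S) = F S"
  shows "transpose_mat (mat_expectation n n (unif_subset m s) F) = mat_expectation n n (unif_subset m s) F"
proof (rule eq_matI)
  fix i j assume "i < dim_row (mat_expectation n n (unif_subset m s) F)"
    "j < dim_col (mat_expectation n n (unif_subset m s) F)"
  then have ij: "i < n" "j < n" by (auto simp: mat_expectation_def)
  have "F S $$ (j, i) = F S $$ (i, j)" if "S \<subseteq> {..<m}" for S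
    using arg_cong[OF F(2)[OF that], of "\<lambda>B. B $$ (i, j)"] F(1)[OF that] ij by simp
  then have "subset_avg m s (\<lambda>S. F S $$ (j, i)) = subset_avg m s (\<lambda>S. F S $$ (i, j))"
    unfolding subset_avg_def by (intro arg_cong2[of _ _ _ _ "(/)"] sum.cong) auto
  then show "transpose_mat (mat_expectation n n (unif_subset m s) F) $$ (i, j)
      = mat_expectation n n (unif_subset m s) F $$ (i, j)"
    using ij by (simp add: mat_expectation_def expectation_unif_subset[OF s])
qed (auto simp: mat_expectation_def)

section \<open>Rank and condition number\<close>

lemma rank_sum_products_le:
  fixes f g :: "nat \<Rightarrow> nat \<Rightarrow> real"
  shows "vec_space.rank m (mat m n (\<lambda>(a, b). \<Sum>i<q. f i a * g i b)) \<le> q"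
proof (induction q)
  case 0
  have zero: "mat m n (\<lambda>(a, b). \<Sum>i<(0::nat). f i a * g i b) = 0\<^sub>m m n" by (rule eq_matI) auto
  show ?case unfolding zero vec_space.rank_0I ..
next
  case (Suc q)
  let ?M = "\<lambda>q. mat m n (\<lambda>(a, b). \<Sum>i<q. f i a * g i b)"
  let ?P = "mat m n (\<lambda>(a, b). f q a * g q b)"
  have "?M (Suc q) = ?M q + ?P" by (rule eq_matI) auto
  then have "vec_space.rank m (?M (Suc q)) \<le> vec_space.rank m (?M q) + vec_space.rank m ?P"
    using vec_space.rank_subadditive[of "?M q" m n ?P] by simp
  moreover have "vec_space.rank m ?P \<le> 1"
    by (rule vec_space.rank_le_1_product_entries[of _ m n "f q" "g q"]) auto
  ultimately show ?case using Suc by simp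
qed

section \<open>Norm estimates and a lower bound for the averaged condition number\<close>

lemma eucl_norm_nonneg: "0 \<le> eucl_norm v"
  by (simp add: eucl_norm_def scalar_prod_ge_0_real)

lemma eucl_norm_smult: "eucl_norm (c \<cdot>\<^sub>v v) = \<bar>c\<bar> * eucl_norm v"
proof -
  have "(c \<cdot>\<^sub>v v) \<bullet> (c \<cdot>\<^sub>v v) = c\<^sup>2 * (v \<bullet> v)"
    by (simp add: scalar_prod_def sum_distrib_left power2_eq_square mult_ac)
  then show ?thesis by (simp add: eucl_norm_def real_sqrt_mult)
qed

lemma eucl_norm_mult_vec_le:
  assumes B: "B \<in> carrier_mat nr nc" and v: "v \<in> carrier_vec nc"
  shows "eucl_norm (B *\<^sub>v v) \<le> frob_norm B * eucl_norm v"
proof -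
  have "(B *\<^sub>v v) \<bullet> (B *\<^sub>v v) = (\<Sum>i<nr. (\<Sum>j<nc. B $$ (i, j) * v $ j)\<^sup>2)"
    using B v by (subst scalar_prod_sum[of _ nr])
      (auto simp: power2_eq_square mult_mat_vec_index[OF B v] simp del: index_mult_mat_vec)
  also have "\<dots> \<le> (\<Sum>i<nr. (\<Sum>j<nc. (B $$ (i, j))\<^sup>2) * (\<Sum>j<nc. (v $ j)\<^sup>2))"
    by (intro sum_mono Cauchy_Schwarz_ineq_sum)
  also have "\<dots> = (\<Sum>i<nr. \<Sum>j<nc. (B $$ (i, j))\<^sup>2) * (v \<bullet> v)"
    by (simp add: scalar_prod_sum[OF v] sum_distrib_right power2_eq_square)
  finally have "sqrt ((B *\<^sub>v v) \<bullet> (B *\<^sub>v v)) \<le> sqrt ((\<Sum>i<nr. \<Sum>j<nc. (B $$ (i, j))\<^sup>2) * (v \<bullet> v))"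
    by (rule real_sqrt_le_mono)
  then show ?thesis using B by (simp add: eucl_norm_def frob_norm_def real_sqrt_mult)
qed

lemma eucl_norm_le_spec_norm:
  assumes B: "B \<in> carrier_mat nr nc" and v: "v \<in> carrier_vec nc"
  shows "eucl_norm (B *\<^sub>v v) \<le> spec_norm B * eucl_norm v"
proof (cases "eucl_norm v = 0")
  case True
  then show ?thesis using eucl_norm_mult_vec_le[OF B v] by simp
next
  case False
  define e where "e = eucl_norm v"
  have e: "0 < e" using False eucl_norm_nonneg[of v] by (simp add: e_def)
  have fn: "0 \<le> frob_norm B" by (simp add: frob_norm_def sum_nonneg)
  have "eucl_norm (B *\<^sub>v ((1 / e) \<cdot>\<^sub>v v)) \<le> spec_norm B"
    unfolding spec_norm_def
  proof (rule cSUP_upper)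
    show "(1 / e) \<cdot>\<^sub>v v \<in> {v \<in> carrier_vec (dim_col B). eucl_norm v \<le> 1}"
      using B v e by (simp add: eucl_norm_smult e_def[symmetric])
    show "bdd_above ((\<lambda>v. eucl_norm (B *\<^sub>v v)) ` {v \<in> carrier_vec (dim_col B). eucl_norm v \<le> 1})"
    proof (rule bdd_aboveI2)
      fix v :: "real vec" assume "v \<in> {v \<in> carrier_vec (dim_col B). eucl_norm v \<le> 1}"
      then have v: "v \<in> carrier_vec nc" "eucl_norm v \<le> 1" using B by auto
      show "eucl_norm (B *\<^sub>v v) \<le> frob_norm B"
        using eucl_norm_mult_vec_le[OF B v(1)] mult_left_mono[OF v(2) fn] by simp
    qed
  qed
  also have "B *\<^sub>v ((1 / e) \<cdot>\<^sub>v v) = (1 / e) \<cdot>\<^sub>v (B *\<^sub>v v)" by (rule mult_mat_vec[OF B v])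
  finally show ?thesis using e by (simp add: eucl_norm_smult e_def[symmetric] field_simps)
qed

text \<open>A nonzero column \<open>u\<close> of \<open>B\<close> satisfies
  \<open>u = B B^+ u\<close>; the norm bounds for the two factors then give the claim.\<close>

lemma frob_norm_mult_spec_norm_pinv_ge_1:
  assumes B: "B \<in> carrier_mat m n" and ne: "B \<noteq> 0\<^sub>m m n"
  shows "1 \<le> frob_norm B * spec_norm (pinv B)"
proof -
  obtain i j where ij: "i < m" "j < n" "B $$ (i, j) \<noteq> 0"
    using ne B by (metis eq_matI carrier_matD index_zero_mat)
  define u where "u = col B j"
  have u: "u \<in> carrier_vec m" using B ij by (simp add: u_def)
  have X: "pinv B \<in> carrier_mat n m" and p: "B * pinv B * B = B"
    using is_pinv_pinv[of B] B by (auto simp: is_pinv_def)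
  have "u \<noteq> 0\<^sub>v m" using ij B by (auto simp: u_def vec_eq_iff)
  then have "u \<bullet> u \<noteq> 0" using scalar_prod_eq_0_real[OF u] by blast
  then have pos: "0 < eucl_norm u"
    using scalar_prod_ge_0_real[of u] by (simp add: eucl_norm_def)
  have "u = B *\<^sub>v (pinv B *\<^sub>v u)"
  proof -
    have "u = col (B * (pinv B * B)) j" unfolding u_def using p B X by (simp add: mult_assoc_dim)
    also have "\<dots> = B *\<^sub>v (pinv B *\<^sub>v u)" 
      using col_mult2[of B m n "pinv B * B" n j] col_mult2[of "pinv B" n m B n j] B X ij by (simp add: u_def)
    finally show ?thesis .
  qed
  then have "eucl_norm u \<le> frob_norm B * eucl_norm (pinv B *\<^sub>v u)"
    using eucl_norm_mult_vec_le[OF B, of "pinv B *\<^sub>v u"] X u by simp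
  also have "\<dots> \<le> frob_norm B * (spec_norm (pinv B) * eucl_norm u)"
    by (intro mult_left_mono eucl_norm_le_spec_norm[OF X u]) (simp add: frob_norm_def sum_nonneg)
  finally show ?thesis using pos by (simp add: mult.assoc[symmetric])
qed

lemma (in svd_factors) A_index:
  assumes "a < m" "b < n"
  shows "A $$ (a, b) = (\<Sum>i<min m n. \<sigma> i * U $$ (a, i) * V $$ (b, i))"
proof -
  have e: "unit_vec n b \<in> carrier_vec n" by simp
  have "coord (unit_vec n b) i = V $$ (b, i)" if "i < n" for i
    unfolding coord_def using that assms V by (subst mult_mat_vec_index[of _ n n])
      (auto simp: unit_vec_def if_distrib cong: if_cong)
  moreover have "A $$ (a, b) = (A *\<^sub>v unit_vec n b) $ a"
    using A assms by simp
  ultimately show ?thesis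
    using mult_A_vec_index[of "1\<^sub>m m" "unit_vec n b" a] assms A U by (simp del: index_mult_mat_vec)
qed

text \<open>Removing \<open>k\<close> rank-one terms from a matrix of larger rank leaves a nonzero
  remainder of rank between 1 and \<open>m\<close>, whose \<open>kappa_bar\<close> is thus at least
  \<open>1 / sqrt m\<close>.\<close>

lemma (in svd_factors) rank_facts:
  assumes \<sigma>: "\<And>i. i < min m n \<Longrightarrow> 0 \<le> \<sigma> i" "\<And>i j. i \<le> j \<Longrightarrow> j < min m n \<Longrightarrow> \<sigma> j \<le> \<sigma> i"
    and k: "k < mat_rank A"
  shows "k < min m n" "0 < \<sigma> k" "sqrt m \<le> m * kappa_bar (A - svd_top k U \<sigma> V)"
proof -
  let ?f = "\<lambda>i a. \<sigma> i * U $$ (a, i)" and ?g = "\<lambda>i b. V $$ (b, i)"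
  let ?M = "\<lambda>q. mat m n (\<lambda>(a, b). \<Sum>i<q. ?f i a * ?g i b)"
  have dr: "dim_row A = m" using A by simp
  have AM: "A = ?M (min m n)" using A by (intro eq_matI) (auto simp: A_index)
  have rA: "k < vec_space.rank m A" using k dr by simp
  have "vec_space.rank m A \<le> min m n" by (subst AM) (rule rank_sum_products_le)
  then show kr: "k < min m n" using rA by simp
  have "\<sigma> k \<noteq> 0"
  proof
    assume "\<sigma> k = 0"
    then have z: "\<sigma> i = 0" if "k \<le> i" "i < min m n" for i
      using \<sigma>(1)[of i] \<sigma>(2)[of k i] that by simp
    have "(\<Sum>i<min m n. ?f i a * ?g i b) = (\<Sum>i<k. ?f i a * ?g i b)" for a b
      using kr z by (intro sum.mono_neutral_right) auto
    then have "A = ?M k" by (subst AM) simp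
    then have "vec_space.rank m A \<le> k" using rank_sum_products_le[where f = ?f and g = ?g] by simp
    with rA show False by simp
  qed
  then show "0 < \<sigma> k" using \<sigma>(1)[OF kr] by simp
  define D where "D = A - svd_top k U \<sigma> V"
  have top: "svd_top k U \<sigma> V = ?M k"
    using U V unfolding svd_top_def by (intro eq_matI) auto
  have D: "D \<in> carrier_mat m n" unfolding D_def top by (intro minus_carrier_mat) simp
  have "A = D + ?M k" unfolding D_def top using A by (intro eq_matI) auto
  then have "vec_space.rank m A \<le> vec_space.rank m D + vec_space.rank m (?M k)"
    using vec_space.rank_subadditive[OF D, of "?M k"] by simp
  also have "\<dots> \<le> vec_space.rank m D + k" by (intro add_left_mono rank_sum_products_le)
  finally have rD1: "1 \<le> vec_space.rank m D" using rA by simp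
  \<comment> \<open>Zeroing the first \<open>k\<close> left factors keeps \<open>min m n\<close>
    products, hence rank at most \<open>m\<close>.\<close>
  have Deq: "D = mat m n (\<lambda>(a, b). \<Sum>i<min m n. (if i < k then 0 else ?f i a) * ?g i b)"
  proof (rule eq_matI)
    fix a b assume "a < dim_row (mat m n (\<lambda>(a, b). \<Sum>i<min m n. (if i < k then 0 else ?f i a) * ?g i b))"
      "b < dim_col (mat m n (\<lambda>(a, b). \<Sum>i<min m n. (if i < k then 0 else ?f i a) * ?g i b))"
    then have ab: "a < m" "b < n" by auto
    have "(\<Sum>i<k. ?f i a * ?g i b) = (\<Sum>i<min m n. if i < k then ?f i a * ?g i b else 0)"
      unfolding sum_if_less_min using kr by (simp add: min.absorb2 min.absorb1)
    then have "D $$ (a, b) = (\<Sum>i<min m n. ?f i a * ?g i b) - (\<Sum>i<min m n. if i < k then ?f i a * ?g i b else 0)"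
      using ab A by (simp add: D_def top A_index)
    also have "\<dots> = (\<Sum>i<min m n. (if i < k then 0 else ?f i a) * ?g i b)"
      unfolding sum_subtractf[symmetric] by (intro sum.cong) auto
    finally show "D $$ (a, b) = mat m n (\<lambda>(a, b). \<Sum>i<min m n. (if i < k then 0 else ?f i a) * ?g i b) $$ (a, b)"
      using ab by simp
  qed (use D in auto)
  have rDm: "vec_space.rank m D \<le> m"
    unfolding Deq by (rule order_trans[OF rank_sum_products_le]) simp
  have "vec_space.rank m (0\<^sub>m m n :: real mat) = 0" by (rule vec_space.rank_0I)
  then have "D \<noteq> 0\<^sub>m m n" using rD1 by auto
  then have "1 / sqrt m \<le> frob_norm D * spec_norm (pinv D) / sqrt (vec_space.rank m D)"
    using rD1 rDm frob_norm_mult_spec_norm_pinv_ge_1[OF D] by (intro frac_le) auto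
  also have "\<dots> = kappa_bar D" using D by (simp add: kappa_bar_def)
  finally have "m * (1 / sqrt m) \<le> m * kappa_bar D" by (intro mult_left_mono) auto
  then show "sqrt m \<le> m * kappa_bar (A - svd_top k U \<sigma> V)"
    by (simp add: D_def real_div_sqrt)
qed

section \<open>The Hadamard matrix\<close>

lemma hadamard_carrier: "hadamard p \<in> carrier_mat (2 ^ p) (2 ^ p)"
proof (induction p)
  case (Suc p)
  then show ?case by (simp add: mult_2)
qed simp

lemma hadamard_Suc_index:
  assumes "i < 2 * 2 ^ p" "j < 2 * 2 ^ p"
  shows "hadamard (Suc p) $$ (i, j) = (if i < 2 ^ p \<or> j < 2 ^ p then 1 else - 1)
    * hadamard p $$ (if i < 2 ^ p then i else i - 2 ^ p, if j < 2 ^ p then j else j - 2 ^ p)"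
  using assms hadamard_carrier[of p] by (auto simp: index_mat_four_block)

lemma hadamard_square: "i < 2 ^ p \<Longrightarrow> j < 2 ^ p \<Longrightarrow> (hadamard p $$ (i, j))\<^sup>2 = 1"
proof (induction p arbitrary: i j)
  case (Suc p)
  then have ij: "i < 2 * 2 ^ p" "j < 2 * 2 ^ p" by auto
  then show ?case
    unfolding hadamard_Suc_index[OF ij] power_mult_distrib by (subst Suc.IH) auto
qed simp

lemma sum_lessThan_double: "(\<Sum>j<2 * (N::nat). f j) = (\<Sum>j<N. f j) + (\<Sum>j<N. f (j + N))"
proof -
  have "(\<Sum>j<2 * N. f j) = (\<Sum>j<N. f j) + (\<Sum>j=N..<N + N. f j)"
    by (simp add: mult_2 lessThan_atLeast0 sum.atLeastLessThan_concat)
  also have "(\<Sum>j=N..<N + N. f j) = (\<Sum>j<N. f (j + N))"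
    using sum.shift_bounds_nat_ivl[of f 0 N N] by (simp add: lessThan_atLeast0)
  finally show ?thesis .
qed

text \<open>By blocks: the lower half repeats the upper inner product, with opposite sign exactly
  when \<open>x\<close> and \<open>y\<close> lie in different halves, so it doubles or
  cancels.\<close>

lemma hadamard_orthogonal:
  "x < 2 ^ p \<Longrightarrow> y < 2 ^ p \<Longrightarrow>
    (\<Sum>j<2 ^ p. hadamard p $$ (j, x) * hadamard p $$ (j, y)) = 2 ^ p * of_bool (x = y)"
proof (induction p arbitrary: x y)
  case (Suc p)
  let ?H = "hadamard p" and ?N = "2 ^ p :: nat"
  define x' y' where "x' = (if x < ?N then x else x - ?N)" and "y' = (if y < ?N then y else y - ?N)"
  have xy: "x < 2 * ?N" "y < 2 * ?N" "x' < ?N" "y' < ?N" using Suc.prems by (auto simp: x'_def y'_def)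
  have "(\<Sum>j<2 * ?N. hadamard (Suc p) $$ (j, x) * hadamard (Suc p) $$ (j, y))
      = (\<Sum>j<?N. ?H $$ (j, x') * ?H $$ (j, y'))
       + (\<Sum>j<?N. (if x < ?N then 1 else - 1) * (if y < ?N then 1 else - 1) * (?H $$ (j, x') * ?H $$ (j, y')))"
    unfolding sum_lessThan_double using xy
    by (intro arg_cong2[of _ _ _ _ "(+)"] sum.cong refl)
      (auto simp: hadamard_Suc_index x'_def y'_def simp del: hadamard.simps)
  also have "\<dots> = (1 + (if x < ?N then 1 else - 1) * (if y < ?N then 1 else - 1)) * (2 ^ p * of_bool (x' = y'))"
    unfolding sum_distrib_left[symmetric] Suc.IH[OF xy(3,4)] by (simp add: algebra_simps)
  also have "\<dots> = 2 ^ Suc p * of_bool (x = y)"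
    using xy by (auto simp: x'_def y'_def)
  finally show ?case by simp
qed simp

section \<open>The transformed rows and the assembly of the probability bound\<close>

lemma rht_eq: "rht p = map_pmf (\<lambda>d. hadamard p * mat_diag (2 ^ p) d) (sign_pmf (2 ^ p))"
  by (simp add: rht_def sign_pmf_def Let_def)

context svd_factors
begin

lemma U_orthonormal:
  assumes "i < m" "i' < m"
  shows "(\<Sum>x<m. U $$ (x, i) * U $$ (x, i')) = of_bool (i = i')"
proof -
  have "(transpose_mat U * U) $$ (i, i') = (\<Sum>x<m. U $$ (x, i) * U $$ (x, i'))"
    using assms U(1) by (simp add: scalar_prod_def atLeast0LessThan)
  moreover have "(transpose_mat U * U) $$ (i, i') = of_bool (i = i')" unfolding U(2) using assms by simp
  ultimately show ?thesis by simp
qed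

lemma rht_index:
  assumes m: "m = 2 ^ p" and "j < m" "i < m"
  shows "(hadamard p * mat_diag m d * U) $$ (j, i) = (\<Sum>x<m. (hadamard p $$ (j, x) * U $$ (x, i)) * d x)"
proof -
  have "hadamard p * mat_diag m d = mat m m (\<lambda>(i, j). hadamard p $$ (i, j) * d j)"
    using hadamard_carrier[of p] m by (intro mat_diag_mult_right) simp
  then show ?thesis
    using assms(2,3) U(1) by (simp add: scalar_prod_def atLeast0LessThan mult_ac)
qed

lemma rht_orthonormal:
  assumes m: "m = 2 ^ p" and d: "\<And>x. x < m \<Longrightarrow> d x = 1 / sqrt m \<or> d x = - 1 / sqrt m"
    and i: "i < m" "i' < m"
  defines "W \<equiv> \<lambda>j i. (hadamard p * mat_diag m d * U) $$ (j, i)"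
  shows "(\<Sum>j<m. W j i * W j i') = of_bool (i = i')"
proof -
  let ?H = "\<lambda>j x. hadamard p $$ (j, x)"
  have m_pos: "0 < m" using m by simp
  have d2: "(d x)\<^sup>2 = 1 / m" if "x < m" for x
    using d[OF that] by (auto simp: power_divide)
  have "(\<Sum>j<m. W j i * W j i')
      = (\<Sum>j<m. \<Sum>x<m. \<Sum>y<m. (?H j x * ?H j y) * (U $$ (x, i) * d x * (U $$ (y, i') * d y)))"
  proof (rule sum.cong[OF refl])
    fix j assume "j \<in> {..<m}"
    then have "W j i * W j i' = (\<Sum>x<m. (?H j x * U $$ (x, i)) * d x) * (\<Sum>y<m. (?H j y * U $$ (y, i')) * d y)"
      unfolding W_def using i by (simp only: lessThan_iff rht_index[OF m])
    then show "W j i * W j i' = (\<Sum>x<m. \<Sum>y<m. (?H j x * ?H j y) * (U $$ (x, i) * d x * (U $$ (y, i') * d y)))"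
      unfolding sum_product by (simp add: mult_ac)
  qed
  also have "\<dots> = (\<Sum>x<m. \<Sum>y<m. \<Sum>j<m. (?H j x * ?H j y) * (U $$ (x, i) * d x * (U $$ (y, i') * d y)))"
    by (subst sum.swap, rule sum.cong[OF refl], subst sum.swap, rule refl)
  also have "\<dots> = (\<Sum>x<m. \<Sum>y<m. m * of_bool (x = y) * (U $$ (x, i) * d x * (U $$ (y, i') * d y)))"
    using hadamard_orthogonal[of _ p] m
    by (intro sum.cong refl) (simp add: sum_distrib_right[symmetric])
  also have "\<dots> = (\<Sum>x<m. U $$ (x, i) * U $$ (x, i'))"
  proof (rule sum.cong[OF refl])
    fix x assume "x \<in> {..<m}"
    then have x: "x < m" by simp
    have "(\<Sum>y<m. m * of_bool (x = y) * (U $$ (x, i) * d x * (U $$ (y, i') * d y)))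
        = m * (d x)\<^sup>2 * (U $$ (x, i) * U $$ (x, i'))"
      using x by (subst sum.remove[of _ x]) (auto simp: power2_eq_square)
    then show "(\<Sum>y<m. m * of_bool (x = y) * (U $$ (x, i) * d x * (U $$ (y, i') * d y)))
        = U $$ (x, i) * U $$ (x, i')"
      using d2[OF x] m_pos by simp
  qed
  finally show ?thesis unfolding U_orthonormal[OF i] .
qed

text \<open>For one fixed \<open>Q\<close> with flat rows the order is checked on each
  \<open>x\<close>: the sampling bound is applied to the coordinates of \<open>x\<close>, and every
  admissible weight certifies the form of the sampled projection.\<close>

lemma loewner_le_of_flat_rows:
  assumes Q: "Q \<in> carrier_mat m m"
    and flat: "flat_rows m (min m n) k (\<lambda>j i. (Q * U) $$ (j, i)) \<sigma> lb l"
    and s: "200 * real k * ln (16 * m) \<le> s" "s \<le> m"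
  shows "loewner_le ((1 / 2) \<cdot>\<^sub>m ridge_proj lb A)
    (mat_expectation n n (unif_subset m s) (\<lambda>S. reg_proj l (rows_of (Q * A) S)))"
proof -
  interpret flat_rows m "min m n" k "\<lambda>j i. (Q * U) $$ (j, i)" \<sigma> lb l by (rule flat)
  let ?F = "\<lambda>S. reg_proj l (rows_of (Q * A) S)"
  let ?E = "mat_expectation n n (unif_subset m s) ?F"
  let ?R = "(1 / 2) \<cdot>\<^sub>m ridge_proj lb A"
  have QA: "Q * A \<in> carrier_mat m n" using Q A by simp
  have F: "?F S \<in> carrier_mat n n" "transpose_mat (?F S) = ?F S" if "S \<subseteq> {..<m}" for S
    using reg_proj_carrier reg_proj_symmetric rows_of_carrier[OF QA that] by blast+
  have E: "?E \<in> carrier_mat n n" by (simp add: mat_expectation_def)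
  have ridge: "ridge_proj lb A \<in> carrier_mat n n" "transpose_mat (ridge_proj lb A) = ridge_proj lb A"
    unfolding ridge_proj_eq_reg_proj[OF A lb_pos] using reg_proj_carrier[OF A] reg_proj_symmetric[OF A] by auto
  have R: "?R \<in> carrier_mat n n" using ridge by simp
  have sR: "transpose_mat ?R = ?R"
    using ridge by (intro eq_matI) (auto, metis carrier_matD index_transpose_mat(1))
  have sE: "transpose_mat ?E = ?E"
    by (rule mat_expectation_symmetric[OF s(2) F])
  have "0 \<le> x \<bullet> ((?E - ?R) *\<^sub>v x)" if x: "x \<in> carrier_vec n" for x
  proof -
    have "(?E - ?R) *\<^sub>v x = ?E *\<^sub>v x - ?R *\<^sub>v x"
      using E R x by (intro minus_mult_distrib_mat_vec) auto
    then have diff: "x \<bullet> ((?E - ?R) *\<^sub>v x) = x \<bullet> (?E *\<^sub>v x) - x \<bullet> (?R *\<^sub>v x)"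
      using E R x by (simp add: scalar_prod_minus_distrib[of _ n])
    have "x \<bullet> (?R *\<^sub>v x) = (\<Sum>i<min m n. M i * (coord x i)\<^sup>2) / 2"
    proof -
      have "?R *\<^sub>v x = (1 / 2) \<cdot>\<^sub>v (ridge_proj lb A *\<^sub>v x)"
        using ridge x by (intro eq_vecI) (auto simp: scalar_prod_def sum_distrib_left sum_divide_distrib mult_ac)
      then have "x \<bullet> (?R *\<^sub>v x) = (1 / 2) * (x \<bullet> (ridge_proj lb A *\<^sub>v x))"
        using ridge x by simp
      then show ?thesis unfolding ridge_form[OF x lb_pos] by (simp add: M_def)
    qed
    also have "\<dots> \<le> subset_avg m s (value_of (coord x))"
      by (rule subset_avg_value_of_ge) (use s in auto)
    also have "\<dots> \<le> subset_avg m s (\<lambda>S. x \<bullet> (?F S *\<^sub>v x))"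
    proof (rule subset_avg_mono)
      fix S assume S: "S \<subseteq> {..<m}"
      show "value_of (coord x) S \<le> x \<bullet> (?F S *\<^sub>v x)"
      proof (rule value_of_le)
        fix w :: "nat \<Rightarrow> real" assume w: "\<And>j. j \<notin> S \<Longrightarrow> w j = 0"
        show "gain (coord x) w \<le> x \<bullet> (?F S *\<^sub>v x)"
          using rows_form_ge[OF Q x l_nonneg' S, of w] w unfolding gain_def a_def by simp
      qed
    qed
    also have "\<dots> = x \<bullet> (?E *\<^sub>v x)"
      by (rule mat_expectation_unif_subset_form[OF s(2) x F(1), symmetric])
    finally show ?thesis unfolding diff by simp
  qed
  moreover have "transpose_mat (?E - ?R) = ?E - ?R"
    using transpose_minus[OF E R] sE sR by simp
  moreover have "?E - ?R \<in> carrier_mat n n" by (rule minus_carrier_mat[OF R])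
  ultimately show ?thesis unfolding loewner_le_def psd_def using E R by auto
qed

text \<open>Flatness of all \<open>m\<close> rows implies the order relation, so a union bound over
  rows suffices.\<close>

lemma prob_rht_loewner_le:
  assumes m: "m = 2 ^ p" and \<sigma>: "\<And>i. i < min m n \<Longrightarrow> 0 \<le> \<sigma> i"
    and k: "0 < k" "k < min m n" and lb: "0 < lb" "lb = (\<Sum>i = k..<min m n. (\<sigma> i)\<^sup>2) / real k"
    and s: "200 * real k * ln (16 * m) \<le> s" "s \<le> m"
    and l: "0 \<le> l" "l \<le> real k / real m * lb"
  shows "1 - m * exp (- real k) \<le> measure_pmf.prob (rht p)
    {Q. loewner_le ((1 / 2) \<cdot>\<^sub>m ridge_proj lb A)
      (mat_expectation n n (unif_subset m s) (\<lambda>S. reg_proj l (rows_of (Q * A) S)))}"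
proof -
  define M where "M i = (\<sigma> i)\<^sup>2 / ((\<sigma> i)\<^sup>2 + lb)" for i
  have pos: "0 < (\<sigma> i)\<^sup>2 + lb" for i using lb by (simp add: add_nonneg_pos)
  have M: "0 \<le> M i \<and> M i \<le> 1" for i using pos[of i] lb by (simp add: M_def)
  have m_pos: "0 < m" using k by simp
  \<comment> \<open>The first \<open>k\<close> terms are at most 1 each; the tail is at most
    \<open>\<Sum> (\<sigma> i)^2 / lb\<close>, which is \<open>k\<close> by the choice of
    \<open>lb\<close>.\<close>
  have trace: "(\<Sum>i<min m n. M i) \<le> 2 * real k"
  proof -
    have "(\<Sum>i<min m n. M i) = (\<Sum>i<k. M i) + (\<Sum>i=k..<min m n. M i)"
      using k sum.atLeastLessThan_concat[of 0 k "min m n" M] by (simp add: atLeast0LessThan)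
    also have "\<dots> \<le> (\<Sum>i<k. 1) + (\<Sum>i=k..<min m n. (\<sigma> i)\<^sup>2 / lb)"
    proof (intro add_mono sum_mono)
      fix i show "M i \<le> 1" using M by simp
      show "M i \<le> (\<sigma> i)\<^sup>2 / lb" unfolding M_def using lb(1) by (intro divide_left_mono mult_pos_pos pos) auto
    qed
    also have "(\<Sum>i=k..<min m n. (\<sigma> i)\<^sup>2 / lb) = real k"
    proof -
      have "(\<Sum>i = k..<min m n. (\<sigma> i)\<^sup>2) = lb * k" using lb(2) k by simp
      then show ?thesis unfolding sum_divide_distrib[symmetric] using lb(1) by simp
    qed
    finally show ?thesis by simp
  qed
  define G where "G = {Q. loewner_le ((1 / 2) \<cdot>\<^sub>m ridge_proj lb A)
      (mat_expectation n n (unif_subset m s) (\<lambda>S. reg_proj l (rows_of (Q * A) S)))}"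
  define f where "f d = hadamard p * mat_diag m d" for d
  \<comment> \<open>Row \<open>j\<close> has a large leverage score. As Hadamard entries are signs,
    scaling the rows of \<open>U\<close> by row \<open>j\<close> of \<open>hadamard p\<close> keeps
    the columns orthonormal.\<close>
  define bad where "bad j = {d. 8 * real k / m < (\<Sum>i<min m n. M i * (\<Sum>x<m. (hadamard p $$ (j, x) * U $$ (x, i)) * d x)\<^sup>2)}" for j
  have prob_bad: "measure_pmf.prob (sign_pmf m) (bad j) \<le> exp (- real k)" if j: "j < m" for j
    unfolding bad_def
  proof (rule prob_leverage_large[OF m_pos M trace])
    fix i i' assume i: "i < min m n" "i' < min m n"
    have "(\<Sum>x<m. hadamard p $$ (j, x) * U $$ (x, i) * (hadamard p $$ (j, x) * U $$ (x, i')))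
        = (\<Sum>x<m. (hadamard p $$ (j, x))\<^sup>2 * (U $$ (x, i) * U $$ (x, i')))"
      by (simp add: power2_eq_square mult_ac)
    also have "\<dots> = (\<Sum>x<m. U $$ (x, i) * U $$ (x, i'))"
      using j m by (intro sum.cong refl) (simp add: hadamard_square)
    also have "\<dots> = of_bool (i = i')" using i by (intro U_orthonormal) auto
    finally show "(\<Sum>x<m. hadamard p $$ (j, x) * U $$ (x, i) * (hadamard p $$ (j, x) * U $$ (x, i'))) = of_bool (i = i')" .
  qed
  have good: "f d \<in> G" if d: "d \<in> set_pmf (sign_pmf m)" and nb: "\<And>j. j < m \<Longrightarrow> d \<notin> bad j" for d
    unfolding G_def mem_Collect_eq
  proof (rule loewner_le_of_flat_rows[OF _ _ s])
    show "f d \<in> carrier_mat m m" using hadamard_carrier[of p] m by (auto simp: f_def)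
    show "flat_rows m (min m n) k (\<lambda>j i. (f d * U) $$ (j, i)) \<sigma> lb l"
    proof
      fix j assume j: "j < m"
      have "(\<Sum>i<min m n. (\<sigma> i)\<^sup>2 / ((\<sigma> i)\<^sup>2 + lb) * ((f d * U) $$ (j, i))\<^sup>2)
          = (\<Sum>i<min m n. M i * (\<Sum>x<m. (hadamard p $$ (j, x) * U $$ (x, i)) * d x)\<^sup>2)"
        using j by (intro sum.cong refl) (simp add: f_def M_def rht_index[OF m] del: index_mult_mat(1))
      also have "\<dots> \<le> 8 * real k / m" using nb[OF j] by (simp add: bad_def)
      finally show "(\<Sum>i<min m n. (\<sigma> i)\<^sup>2 / ((\<sigma> i)\<^sup>2 + lb) * ((f d * U) $$ (j, i))\<^sup>2) \<le> real (8 * k) / real m"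
        by simp
    next
      fix i i' assume "i < min m n" "i' < min m n"
      then show "(\<Sum>j<m. (f d * U) $$ (j, i) * (f d * U) $$ (j, i')) = of_bool (i = i')"
        unfolding f_def using set_sign_pmf[OF d] by (intro rht_orthonormal[OF m]) auto
    qed (use m_pos k lb \<sigma> l in auto)
  qed
  have "measure_pmf.prob (sign_pmf m) (- (f -` G)) \<le> measure_pmf.prob (sign_pmf m) (\<Union>j<m. bad j)"
    using good by (intro measure_pmf.finite_measure_mono_AE) (auto simp: AE_measure_pmf_iff)
  also have "\<dots> \<le> (\<Sum>j<m. measure_pmf.prob (sign_pmf m) (bad j))"
    by (rule measure_pmf.finite_measure_subadditive_finite) auto
  also have "\<dots> \<le> (\<Sum>j<m. exp (- real k))" by (intro sum_mono prob_bad) auto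
  finally have "measure_pmf.prob (sign_pmf m) (- (f -` G)) \<le> m * exp (- real k)" by simp
  moreover have "measure_pmf.prob (sign_pmf m) (- (f -` G)) = 1 - measure_pmf.prob (sign_pmf m) (f -` G)"
    using measure_pmf.prob_compl[of "f -` G" "sign_pmf m"] by (simp add: Compl_eq_Diff_UNIV)
  moreover have "measure_pmf.prob (rht p) G = measure_pmf.prob (sign_pmf m) (f -` G)"
    unfolding rht_eq measure_map_pmf f_def m ..
  ultimately show ?thesis unfolding G_def by linarith
qed

end

text \<open>The constant 2000 is \<open>200 * 5 * 2\<close>: the sampling bound needs
  \<open>200 k ln (16 m)\<close>, \<open>16 \<le> m^4\<close> gives
  \<open>ln (16 m) \<le> 5 ln m\<close>, and \<open>ln m = 2 ln (sqrt m)\<close> meets the bound for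
  \<open>kappa_bar\<close>. The hypothesis on \<open>k\<close> makes the failure probability
  \<open>m exp (- k)\<close> at most \<delta>.\<close>

theorem theorem3p1:
  shows "\<exists>C::real. C \<ge> 64 \<and>
    (\<forall>(p::nat) (m::nat) (n::nat) (A::real mat) (U::real mat) (\<sigma>::nat \<Rightarrow> real) (V::real mat)
      (\<delta>::real) (k::nat) (lbar::real) (s::nat) (l::real).
      m = 2 ^ p \<longrightarrow>
      A \<in> carrier_mat m n \<longrightarrow>
      is_svd A U \<sigma> V \<longrightarrow>
      0 < \<delta> \<longrightarrow> \<delta> < 1 \<longrightarrow>
      C * ln (real m / \<delta>) \<le> real k \<longrightarrow>
      k < mat_rank A \<longrightarrow>
      lbar = (\<Sum>i = k..<min m n. (\<sigma> i)\<^sup>2) / real k \<longrightarrow>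
      s \<le> m \<longrightarrow>
      C * real k * ln (real m * kappa_bar (A - svd_top k U \<sigma> V)) \<le> real s \<longrightarrow>
      0 \<le> l \<longrightarrow> l \<le> real k / real m * lbar \<longrightarrow>
      measure_pmf.prob (rht p)
        {Q. loewner_le
              ((1 / 2) \<cdot>\<^sub>m ridge_proj lbar A)
              (mat_expectation n n (unif_subset m s) (\<lambda>S. reg_proj l (rows_of (Q * A) S)))}
        \<ge> 1 - \<delta>)"
proof (intro exI[of _ 2000] conjI allI impI)
  fix p m n :: nat and A U V :: "real mat" and \<sigma> :: "nat \<Rightarrow> real" and \<delta> lbar l :: real and k s :: nat
  assume m: "m = 2 ^ p" and A: "A \<in> carrier_mat m n" and svd: "is_svd A U \<sigma> V"
    and \<delta>: "0 < \<delta>" "\<delta> < 1" and k: "2000 * ln (real m / \<delta>) \<le> real k" "k < mat_rank A"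
    and lbar: "lbar = (\<Sum>i = k..<min m n. (\<sigma> i)\<^sup>2) / real k"
    and s: "s \<le> m" "2000 * real k * ln (real m * kappa_bar (A - svd_top k U \<sigma> V)) \<le> real s"
    and l: "0 \<le> l" "l \<le> real k / real m * lbar"
  have svd': "svd_factors m n A U V \<sigma>" "\<And>i. i < min m n \<Longrightarrow> 0 \<le> \<sigma> i"
    "\<And>i j. i \<le> j \<Longrightarrow> j < min m n \<Longrightarrow> \<sigma> j \<le> \<sigma> i"
    using svd A by (auto simp: is_svd_def Let_def svd_factors_def)
  interpret svd_factors m n A U V \<sigma> by (rule svd')
  note rank = rank_facts[OF svd'(2,3) k(2)]
  have m1: "1 \<le> real m" using m by simp
  have "1 < real m / \<delta>" using \<delta> m1 by (simp add: field_simps)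
  then have lnd: "0 < ln (real m / \<delta>)" by simp
  then have k_pos: "0 < k" using k(1) by (cases k) auto
  have lb: "0 < lbar"
  proof -
    have "(\<sigma> k)\<^sup>2 \<le> (\<Sum>i = k..<min m n. (\<sigma> i)\<^sup>2)"
      using rank(1) by (intro member_le_sum) auto
    then show ?thesis using rank(2) k_pos unfolding lbar by (intro divide_pos_pos) (auto intro: less_le_trans[of _ "(\<sigma> k)\<^sup>2"])
  qed
  \<comment> \<open>From \<open>0 < k < min m n\<close>; needed for
    \<open>16 \<le> m^4\<close>.\<close>
  have m2: "2 \<le> real m" using rank(1) k_pos by simp
  have "200 * real k * ln (16 * real m) \<le> s"
  proof -
    have "16 \<le> real m ^ 4" using power_mono[OF m2, of 4] by simp
    then have "ln 16 \<le> ln (real m ^ 4)" using m2 by (subst ln_le_cancel_iff) auto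
    then have "ln (16 * real m) \<le> 5 * ln (real m)"
      using m2 by (simp add: ln_mult_pos ln_realpow)
    also have "\<dots> = 10 * ln (sqrt m)" using m2 by (simp add: ln_sqrt)
    also have "\<dots> \<le> 10 * ln (real m * kappa_bar (A - svd_top k U \<sigma> V))"
    proof -
      have "0 < sqrt m" using m2 by simp
      then have "ln (sqrt m) \<le> ln (real m * kappa_bar (A - svd_top k U \<sigma> V))"
        using rank(3) by (intro iffD2[OF ln_le_cancel_iff]) linarith+
      then show ?thesis by simp
    qed
    finally have "200 * real k * ln (16 * real m) \<le> 200 * real k * (10 * ln (real m * kappa_bar (A - svd_top k U \<sigma> V)))"
      by (rule mult_left_mono) simp
    with s(2) show ?thesis by simp
  qed
  then have "1 - m * exp (- real k) \<le> measure_pmf.prob (rht p)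
    {Q. loewner_le ((1 / 2) \<cdot>\<^sub>m ridge_proj lbar A)
      (mat_expectation n n (unif_subset m s) (\<lambda>S. reg_proj l (rows_of (Q * A) S)))}"
    by (intro prob_rht_loewner_le m svd'(2) k_pos rank(1) lb lbar s(1) l) auto
  moreover have "m * exp (- real k) \<le> \<delta>"
  proof -
    have "- real k \<le> - ln (real m / \<delta>)" using k(1) lnd by linarith
    then have "exp (- real k) \<le> exp (- ln (real m / \<delta>))" by simp
    also have "\<dots> = \<delta> / m" using \<delta> m1 by (simp add: exp_minus field_simps)
    finally show ?thesis using m1 by (simp add: field_simps)
  qed
  ultimately show "1 - \<delta> \<le> measure_pmf.prob (rht p)
    {Q. loewner_le ((1 / 2) \<cdot>\<^sub>m ridge_proj lbar A)
      (mat_expectation n n (unif_subset m s) (\<lambda>S. reg_proj l (rows_of (Q * A) S)))}" by linarith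
qed simp

end
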